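(* Let $k\ge 0$ and $n\ge 1$ be integers. If $n\ge 2k+1$, then the pair of metric spaces $(\mathbb{H}^n,\mathbb{H}^{2k+1})$, where each Heisenberg group is endowed with its Carnot–Carathéodory metric $d_{cc}$, does not have the Lipschitz extension property.
   Context: Lipschitz extension property: for a map $g\colon A\to Y$ from a subset $A$ of a metric space $(X,d_X)$ to a metric space $(Y,d_Y)$, put $\mathrm{Lip}(g):=\inf\{L\ge 0: d_Y(g(x),g(y))\le L\,d_X(x,y)\text{ for all }x,y\in A\}$; $g$ is Lipschitz if this is finite. A pair of metric spaces $(X,Y)$ has the Lipschitz extension property if there exists a constant $C\ge 1$ such that any Lipschitz map $f\colon A\to Y$, $A\subset X$, has a Lipschitz extension $F\colon X\to Y$ (that is, $F|_A=f$) with $\mathrm{Lip}(F)\le C\cdot\mathrm{Lip}(f)$. Heisenberg group: $\mathbb{H}^n:=\mathbb{R}^n\times\mathbb{R}^n\times\mathbb{R}$ with group operation $(x,y,t)\ast(x',y',t')=(x+x',\,y+y',\,t+t'+2(y\cdot x'-x\cdot y'))$, where $\cdot$ between vectors of $\mathbb{R}^n$ is the Euclidean scalar product. The vector fields $X_i=\frac{\partial}{\partial x_i}+2y_i\frac{\partial}{\partial t}$ and $Y_i=\frac{\partial}{\partial y_i}-2x_i\frac{\partial}{\partial t}$, $i=1,\dots,n$, are left invariant; the horizontal plane at $p\in\mathbb{H}^n$ is $H_p=\mathrm{span}\{X_i(p),Y_i(p): i=1,\dots,n\}$, with the inner product (norm $|\cdot|$) making these vectors orthonormal. Carnot–Carathéodory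 metric: a (Euclidean) Lipschitz curve $\gamma\colon[0,1]\to\mathbb{H}^n$ is horizontal if $\gamma'(\tau)\in H_{\gamma(\tau)}$ for a.e. $\tau\in[0,1]$. For $p,q\in\mathbb{H}^n$, $d_{cc}(p,q):=\inf\int_0^1|\gamma'(\tau)|\,d\tau$, the infimum being over all horizontal curves connecting $p$ and $q$. *)

theory Defs
  imports "HOL-Analysis.Analysis"
begin

section \<open>The Lipschitz extension property\<close>

text \<open>
  Metric spaces are given by a carrier set and a distance function, because the metric of interest
  is not the one supplied by the type class. The infimum is taken in \<^typ>\<open>ennreal\<close>, so that
  the Lipschitz constant is infinite exactly when no admissible \<open>L\<close> exists.
\<close>

definition Lip :: "'a set \<Rightarrow> ('a \<Rightarrow> 'a \<Rightarrow> real) \<Rightarrow> ('b \<Rightarrow> 'b \<Rightarrow> real) \<Rightarrow> ('a \<Rightarrow> 'b) \<Rightarrow> ennreal"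
  where "Lip A dX dY g =
    Inf (ennreal ` {L. L \<ge> 0 \<and> (\<forall>x\<in>A. \<forall>y\<in>A. dY (g x) (g y) \<le> L * dX x y)})"

definition Lipschitz_map :: "'a set \<Rightarrow> ('a \<Rightarrow> 'a \<Rightarrow> real) \<Rightarrow> ('b \<Rightarrow> 'b \<Rightarrow> real) \<Rightarrow> ('a \<Rightarrow> 'b) \<Rightarrow> bool"
  where "Lipschitz_map A dX dY g \<longleftrightarrow> Lip A dX dY g < \<infinity>"

definition Lipschitz_extension_property ::
    "'a set \<Rightarrow> ('a \<Rightarrow> 'a \<Rightarrow> real) \<Rightarrow> 'b set \<Rightarrow> ('b \<Rightarrow> 'b \<Rightarrow> real) \<Rightarrow> bool"
  where "Lipschitz_extension_property X dX Y dY \<longleftrightarrow>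
    (\<exists>C::real. C \<ge> 1 \<and>
      (\<forall>A f. A \<subseteq> X \<longrightarrow> f \<in> A \<rightarrow> Y \<longrightarrow> Lipschitz_map A dX dY f \<longrightarrow>
        (\<exists>F. F \<in> X \<rightarrow> Y \<and> (\<forall>x\<in>A. F x = f x) \<and> Lipschitz_map X dX dY F \<and>
             Lip X dX dY F \<le> ennreal C * Lip A dX dY f)))"

section \<open>The Heisenberg group\<close>

text \<open>The Heisenberg group of index \<open>n = CARD('n)\<close>; its points are triples \<open>(x, y, t)\<close>.\<close>

type_synonym 'n heis = "(real ^ 'n) \<times> (real ^ 'n) \<times> real"

definition heis_mult :: "'n::finite heis \<Rightarrow> 'n heis \<Rightarrow> 'n heis"
  where "heis_mult = (\<lambda>(x, y, t) (x', y', t').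
    (x + x', y + y', t + t' + 2 * (y \<bullet> x' - x \<bullet> y')))"

definition heis_X :: "'n::finite \<Rightarrow> 'n heis \<Rightarrow> 'n heis"
  where "heis_X i = (\<lambda>(x, y, t). (axis i 1, 0, 2 * (y $ i)))"

definition heis_Y :: "'n::finite \<Rightarrow> 'n heis \<Rightarrow> 'n heis"
  where "heis_Y i = (\<lambda>(x, y, t). (0, axis i 1, - 2 * (x $ i)))"

lemma heis_mult_has_derivative:
  fixes p q :: "'n::finite heis"
  shows "(heis_mult p has_derivative
    (\<lambda>(u, v, s). (u, v, s + 2 * (fst (snd p) \<bullet> u - fst p \<bullet> v)))) (at q)"
  unfolding heis_mult_def case_prod_unfold
  by (auto intro!: derivative_eq_intros)

lemma heis_X_left_invariant:
  fixes p q :: "'n::finite heis"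
  shows "frechet_derivative (heis_mult p) (at q) (heis_X i q) = heis_X i (heis_mult p q)"
  unfolding frechet_derivative_at[OF heis_mult_has_derivative, symmetric]
  by (simp add: heis_X_def heis_mult_def case_prod_unfold inner_axis algebra_simps)

lemma heis_Y_left_invariant:
  fixes p q :: "'n::finite heis"
  shows "frechet_derivative (heis_mult p) (at q) (heis_Y i q) = heis_Y i (heis_mult p q)"
  unfolding frechet_derivative_at[OF heis_mult_has_derivative, symmetric]
  by (simp add: heis_Y_def heis_mult_def case_prod_unfold inner_axis algebra_simps)

definition horizontal_plane :: "'n::finite heis \<Rightarrow> 'n heis set"
  where "horizontal_plane p = span (range (\<lambda>i. heis_X i p) \<union> range (\<lambda>i. heis_Y i p))"

text \<open>
  The norm on the horizontal plane at \<open>p\<close> for which the fields \<open>X\<^sub>i\<close>, \<open>Y\<^sub>i\<close> are orthonormal.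
  Its value is only meaningful for horizontal vectors.
\<close>

definition horizontal_norm :: "'n::finite heis \<Rightarrow> 'n heis \<Rightarrow> real"
  where "horizontal_norm p v = (THE r. \<exists>a b :: 'n \<Rightarrow> real.
    v = (\<Sum>i\<in>UNIV. a i *\<^sub>R heis_X i p + b i *\<^sub>R heis_Y i p) \<and>
    r = sqrt (\<Sum>i\<in>UNIV. (a i)\<^sup>2 + (b i)\<^sup>2))"

lemma heis_frame_sum:
  fixes p :: "'n::finite heis"
  shows "(\<Sum>i\<in>UNIV. a i *\<^sub>R heis_X i p + b i *\<^sub>R heis_Y i p) =
    ((\<chi> i. a i), (\<chi> i. b i), 2 * (\<Sum>i\<in>UNIV. a i * (fst (snd p) $ i) - b i * (fst p $ i)))"
  by (simp add: prod_eq_iff fst_sum snd_sum heis_X_def heis_Y_def case_prod_unfold vec_eq_iff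
      axis_def if_distrib[of "(*) _"] sum_distrib_left algebra_simps cong: if_cong)

lemma horizontal_norm_frame:
  fixes p :: "'n::finite heis"
  shows "horizontal_norm p (\<Sum>i\<in>UNIV. a i *\<^sub>R heis_X i p + b i *\<^sub>R heis_Y i p) =
    sqrt (\<Sum>i\<in>UNIV. (a i)\<^sup>2 + (b i)\<^sup>2)"
  unfolding horizontal_norm_def heis_frame_sum
  by (rule the_equality) (auto simp: vec_eq_iff)

section \<open>The Carnot--Caratheodory metric\<close>

text \<open>
  The instance metric on the product type is the Euclidean one, so the Lipschitz condition below is
  with respect to the Euclidean metric. One-sided derivatives are used at the endpoints.
\<close>

definition horizontal_curve :: "(real \<Rightarrow> 'n::finite heis) \<Rightarrow> bool"
  where "horizontal_curve \<gamma> \<longleftrightarrow>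
    (\<exists>L. L-lipschitz_on {0..1} \<gamma>) \<and>
    (AE \<tau> in lebesgue. \<tau> \<in> {0..1} \<longrightarrow>
      \<gamma> differentiable (at \<tau> within {0..1}) \<and>
      vector_derivative \<gamma> (at \<tau> within {0..1}) \<in> horizontal_plane (\<gamma> \<tau>))"

definition horizontal_length :: "(real \<Rightarrow> 'n::finite heis) \<Rightarrow> real"
  where "horizontal_length \<gamma> =
    (LINT \<tau>:{0..1}|lebesgue. horizontal_norm (\<gamma> \<tau>) (vector_derivative \<gamma> (at \<tau> within {0..1})))"

definition d_cc :: "'n::finite heis \<Rightarrow> 'n heis \<Rightarrow> real"
  where "d_cc p q =
    Inf (horizontal_length ` {\<gamma>. horizontal_curve \<gamma> \<and> \<gamma> 0 = p \<and> \<gamma> 1 = q})"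

end

theory Submission
  imports Defs
begin

text \<open>
  Write \<open>p \<odot> q\<close> for the group law, in coordinates \<open>p = (z, t)\<close>, and \<open>nrm\<close> for the homogeneous norm
  \<open>|z| + |t|^(1/2)\<close>; up to constants, \<open>d_cc p q\<close> is \<open>nrm (- p \<odot> q)\<close>. On the lattice of points
  \<open>(\<epsilon> a, \<epsilon> b, \<epsilon>\<^sup>2 c)\<close> with integers \<open>a, b, c\<close>, any Euclidean Lipschitz map \<open>\<phi>\<close> has homogeneous Lipschitz
  constant of order \<open>\<epsilon>^(-1/2)\<close>. An extension with comparable constant differs from \<open>\<phi>\<close> by
  \<open>O(\<epsilon>^(1/2))\<close>, so the extension property makes \<open>\<phi>\<close> a uniform limit of Lipschitz maps \<open>F\<close>, which can
  moreover be kept equal to \<open>\<phi>\<close> where \<open>\<phi>\<close> is the identity.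

  Take \<open>\<phi>\<close> to be the identity outside a small ball, moved onto a second place where \<open>\<phi>\<close> is the
  identity; then \<open>\<phi>\<close> covers some ball twice, and it must reverse orientation somewhere. But a Lipschitz
  map between Heisenberg groups of odd index cannot: its blow-ups are approximately homogeneous
  homomorphisms \<open>(z, t) \<mapsto> (A z, \<lambda> t)\<close> with \<open>A\<close> conformally symplectic of factor \<open>\<lambda>\<close>, whose determinant
  \<open>\<lambda>^(m + 1)\<close> is nonnegative for odd \<open>m\<close>. Hence the negative part of the Jacobian determinant of the
  mollifications \<open>G\<close> of \<open>F\<close> tends to zero in \<open>L\<^sup>1\<close>, whereas its integral is the volume of the box because
  \<open>G\<close> is the identity near the boundary. The area inequality then contradicts the double covering.
\<close>

section \<open>The Heisenberg group in coordinates\<close>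

text \<open>A Lipschitz map for the homogeneous norm is in general only Hoelder of exponent 1/2 for
  the Euclidean one, so \<open>F\<close> itself has no Euclidean Jacobian. Mollification by group
  convolution repairs this and respects the structure: its differential at a point is, up to factors
  whose determinants cancel, that of the mollified blow-up at 0. The blow-ups are compared with
  homomorphisms only in mean square: the energy of horizontal difference quotients is almost maximal
  at some scale, and this forces all smaller scales to agree with it in L^2. The vertical coordinate
  enters through the contact condition alone. Oddness is tied to the reflection (x, y, t) -> (-x, y,
  -t), a group automorphism of determinant (-1)^(m+1): for even m it reverses orientation. The
  exponent of \<open>\<epsilon>\<close> comes from a square root: a Euclidean displacement d can
  cost sqrt d in the homogeneous norm, and distinct lattice points are at least
  \<open>\<epsilon>\<close> apart. Since every point is within order \<open>\<epsilon>\<close> of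
  the lattice, the growing Lipschitz constant is harmless.\<close>

type_synonym 'N pt = "(real, 'N) vec"

text \<open>The triples of the statement are replaced by vectors over a single well-ordered index
  type, the setting of the change-of-variables results used for Jacobians. The maps
  \<open>xi\<close>, \<open>yi\<close> and the index \<open>tau\<close> only name the
  coordinates.\<close>

locale heis_coords =
  fixes xi yi :: "'m::finite \<Rightarrow> 'N::{finite,wellorder}" and tau :: 'N
  assumes inj_xi: "inj xi" and inj_yi: "inj yi"
    and xi_yi [simp]: "\<And>i j. xi i \<noteq> yi j"
    and xi_tau [simp]: "\<And>i. xi i \<noteq> tau"
    and yi_tau [simp]: "\<And>i. yi i \<noteq> tau"
    and coord_cases: "\<And>k. k = tau \<or> k \<in> range xi \<or> k \<in> range yi"
begin

lemma yi_xi [simp]: "yi j \<noteq> xi i" using xi_yi[of i j] by metis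
lemma tau_xi [simp]: "tau \<noteq> xi i" using xi_tau[of i] by metis
lemma tau_yi [simp]: "tau \<noteq> yi i" using yi_tau[of i] by metis
lemma xi_eq [simp]: "xi i = xi j \<longleftrightarrow> i = j" using inj_xi by (auto dest: injD)
lemma yi_eq [simp]: "yi i = yi j \<longleftrightarrow> i = j" using inj_yi by (auto dest: injD)

lemma sum_coords:
  fixes g :: "'N \<Rightarrow> 'b::comm_monoid_add"
  shows "(\<Sum>k\<in>UNIV. g k) = g tau + ((\<Sum>i\<in>UNIV. g (xi i)) + (\<Sum>i\<in>UNIV. g (yi i)))"
proof -
  have U: "UNIV = insert tau (range xi \<union> range yi)" using coord_cases by auto
  have "(\<Sum>k\<in>UNIV. g k) = g tau + (\<Sum>k\<in>range xi \<union> range yi. g k)"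
    unfolding U by (subst sum.insert) auto
  also have "(\<Sum>k\<in>range xi \<union> range yi. g k) = sum g (range xi) + sum g (range yi)"
    by (rule sum.union_disjoint) auto
  also have "sum g (range xi) = (\<Sum>i\<in>UNIV. g (xi i))"
    by (subst sum.reindex) (auto simp: inj_xi)
  also have "sum g (range yi) = (\<Sum>i\<in>UNIV. g (yi i))"
    by (subst sum.reindex) (auto simp: inj_yi)
  finally show ?thesis .
qed

text \<open>The standard symplectic form on the horizontal coordinates, signed as in the group
  law.\<close>

definition om :: "'N pt \<Rightarrow> 'N pt \<Rightarrow> real"
  where "om p q = (\<Sum>i\<in>UNIV. p $ yi i * q $ xi i - p $ xi i * q $ yi i)"

definition mul :: "'N pt \<Rightarrow> 'N pt \<Rightarrow> 'N pt"  (infixl "\<odot>" 68)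
  where "p \<odot> q = p + q + (2 * om p q) *\<^sub>R axis tau 1"

definition hor :: "'N pt \<Rightarrow> 'N pt"
  where "hor p = (\<chi> k. if k = tau then 0 else p $ k)"

definition dil :: "real \<Rightarrow> 'N pt \<Rightarrow> 'N pt"
  where "dil s p = (\<chi> k. if k = tau then s\<^sup>2 * p $ k else s * p $ k)"

definition nrm :: "'N pt \<Rightarrow> real"
  where "nrm p = norm (hor p) + sqrt \<bar>p $ tau\<bar>"

lemma om_add_left: "om (p + q) r = om p r + om q r"
  by (simp add: om_def sum.distrib[symmetric] sum_subtractf[symmetric] algebra_simps)
lemma om_add_right: "om r (p + q) = om r p + om r q"
  by (simp add: om_def sum.distrib[symmetric] algebra_simps)
lemma om_scale_left: "om (c *\<^sub>R p) r = c * om p r"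
  by (simp add: om_def sum_distrib_left algebra_simps)
lemma om_scale_right: "om r (c *\<^sub>R p) = c * om r p"
  by (simp add: om_def sum_distrib_left algebra_simps)
lemma om_swap: "om p q = - om q p"
  by (simp add: om_def sum_negf[symmetric] algebra_simps)
lemma om_self [simp]: "om p p = 0" using om_swap[of p p] by simp
lemma om_minus_left: "om (- p) r = - om p r" using om_scale_left[of "-1" p r] by simp
lemma om_minus_right: "om r (- p) = - om r p" using om_scale_right[of r "-1" p] by simp
lemma om_diff_left: "om (p - q) r = om p r - om q r"
  using om_add_left[of p "-q" r] by (simp add: om_minus_left)
lemma om_diff_right: "om r (p - q) = om r p - om r q"
  using om_add_right[of r p "-q"] by (simp add: om_minus_right)
lemma om_zero [simp]: "om 0 p = 0" "om p 0 = 0" by (simp_all add: om_def)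
lemma om_tau [simp]: "om (axis tau c) p = 0" "om p (axis tau c) = 0"
  by (simp_all add: om_def axis_def)
lemma om_hor [simp]: "om (hor p) q = om p q" "om p (hor q) = om p q"
  by (simp_all add: om_def hor_def)
lemma om_dil: "om (dil s p) (dil s q) = s\<^sup>2 * om p q"
  by (simp add: om_def dil_def sum_distrib_left power2_eq_square algebra_simps)

lemmas om_simps = om_add_left om_add_right om_scale_left om_scale_right om_minus_left
  om_minus_right om_diff_left om_diff_right

lemma bounded_bilinear_om: "bounded_bilinear om"
proof -
  have "bilinear om"
    unfolding bilinear_def by (auto intro!: linearI simp: om_simps)
  then show ?thesis by (simp add: bilinear_conv_bounded_bilinear)
qed

lemma continuous_on_om [continuous_intros]:
  "continuous_on S f \<Longrightarrow> continuous_on S g \<Longrightarrow> continuous_on S (\<lambda>x. om (f x) (g x))"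
  by (rule bounded_bilinear.continuous_on[OF bounded_bilinear_om])

text \<open>Multiplication by i on the horizontal part, read as x + i y, and zero on the vertical
  axis. It expresses \<open>om\<close> by the inner product and later serves to speak of
  complex-linear maps.\<close>

definition Jop :: "'N pt \<Rightarrow> 'N pt"
  where "Jop q = (\<Sum>i\<in>UNIV. q $ xi i *\<^sub>R axis (yi i) 1 - q $ yi i *\<^sub>R axis (xi i) 1)"

lemma Jop_nth [simp]: "Jop q $ xi i = - q $ yi i" "Jop q $ yi i = q $ xi i" "Jop q $ tau = 0"
  by (simp_all add: Jop_def axis_def if_distrib[of "(*) _"] if_distrib[of uminus] sum_negf sum.delta
      cong: if_cong)

lemma vec_eqI:
  "p $ tau = q $ tau \<Longrightarrow> (\<And>i. p $ xi i = q $ xi i) \<Longrightarrow> (\<And>i. p $ yi i = q $ yi i) \<Longrightarrow> p = q"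
  for p q :: "('b,'N) vec"
  unfolding vec_eq_iff by (metis coord_cases rangeE)

lemma om_inner: "om p q = p \<bullet> Jop q"
  by (simp add: om_def inner_vec_def sum_coords sum.distrib sum_subtractf sum_negf)

lemma linear_Jop: "linear Jop"
  by (rule linearI) (auto intro!: vec_eqI)

lemma norm_Jop: "norm (Jop q) = norm (hor q)"
proof -
  have "(norm (Jop q))\<^sup>2 = (norm (hor q))\<^sup>2"
    by (simp add: power2_norm_eq_inner inner_vec_def sum_coords hor_def)
  then show ?thesis by simp
qed

lemma hor_nth [simp]: "hor p $ tau = 0" "k \<noteq> tau \<Longrightarrow> hor p $ k = p $ k"
  by (simp_all add: hor_def)
lemma linear_hor: "linear hor"
  by (rule linearI) (auto simp: vec_eq_iff hor_def)
lemma hor_add: "hor (p + q) = hor p + hor q" by (simp add: linear_add[OF linear_hor])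
lemma hor_diff: "hor (p - q) = hor p - hor q" by (simp add: linear_diff[OF linear_hor])
lemma hor_minus: "hor (- p) = - hor p" by (simp add: linear_neg[OF linear_hor])
lemma hor_scale: "hor (c *\<^sub>R p) = c *\<^sub>R hor p" by (simp add: linear_scale[OF linear_hor])
lemma hor_0 [simp]: "hor 0 = 0" by (simp add: linear_0[OF linear_hor])
lemma hor_tau [simp]: "hor (axis tau c) = 0" by (simp add: vec_eq_iff hor_def axis_def)
lemma hor_hor [simp]: "hor (hor p) = hor p" by (simp add: vec_eq_iff hor_def)
lemma hor_decomp: "p = hor p + axis tau (p $ tau)" by (simp add: vec_eq_iff hor_def axis_def)
lemma scale_axis: "c *\<^sub>R axis k d = axis k (c * d :: real)" for c d :: real
  by (simp add: vec_eq_iff axis_def)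
lemma norm_hor_le: "norm (hor p) \<le> norm p"
  by (rule norm_le_componentwise_cart) (simp add: hor_def)
lemma norm_le_hor: "norm p \<le> norm (hor p) + \<bar>p $ tau\<bar>"
  using norm_triangle_ineq[of "hor p" "axis tau (p $ tau)"] hor_decomp[of p] scale_axis[of "p $ tau" tau 1]
  by (metis mult.right_neutral norm_axis_1 norm_scaleR mult.right_neutral real_norm_def)

lemma om_bound: "\<bar>om p q\<bar> \<le> norm (hor p) * norm (hor q)"
  using Cauchy_Schwarz_ineq2[of "hor p" "Jop q"] om_inner[of "hor p" q] by (simp add: norm_Jop)

lemma mul_tau [simp]: "(p \<odot> q) $ tau = p $ tau + q $ tau + 2 * om p q"
  by (simp add: mul_def)
lemma mul_nth [simp]: "k \<noteq> tau \<Longrightarrow> (p \<odot> q) $ k = p $ k + q $ k"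
  by (simp add: mul_def axis_def)
lemma hor_mul [simp]: "hor (p \<odot> q) = hor p + hor q"
  by (simp add: vec_eq_iff hor_def)
lemma mul_assoc: "(p \<odot> q) \<odot> r = p \<odot> (q \<odot> r)"
  by (simp add: mul_def om_simps algebra_simps)
lemma mul_0 [simp]: "p \<odot> 0 = p" "0 \<odot> p = p" by (simp_all add: mul_def)
lemma mul_minus [simp]: "p \<odot> (- p) = 0" "(- p) \<odot> p = 0"
  by (simp_all add: mul_def om_simps)
lemma mul_cancel [simp]: "p \<odot> ((- p) \<odot> q) = q" "(- p) \<odot> (p \<odot> q) = q"
  by (simp_all add: mul_assoc[symmetric])
lemma minus_mul: "- (p \<odot> q) = (- q) \<odot> (- p)"
  using om_swap[of q p] by (simp add: mul_def om_simps algebra_simps)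

lemma dil_nth [simp]: "dil s p $ tau = s\<^sup>2 * p $ tau" "k \<noteq> tau \<Longrightarrow> dil s p $ k = s * p $ k"
  by (simp_all add: dil_def)
lemma linear_dil: "linear (dil s)"
  by (rule linearI) (auto simp: vec_eq_iff dil_def algebra_simps)
lemma dil_0 [simp]: "dil s 0 = 0" by (simp add: linear_0[OF linear_dil])
lemma dil_minus: "dil s (- p) = - dil s p" by (simp add: linear_neg[OF linear_dil])
lemma dil_mul: "dil s (p \<odot> q) = dil s p \<odot> dil s q"
  by (simp add: vec_eq_iff dil_def) (simp add: mul_def om_dil[unfolded dil_def] axis_def algebra_simps)
lemma dil_dil: "dil s (dil r p) = dil (s * r) p"
  by (simp add: vec_eq_iff dil_def power_mult_distrib)
lemma dil_1 [simp]: "dil 1 p = p" by (simp add: vec_eq_iff dil_def)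
lemma dil_inverse [simp]: "s \<noteq> 0 \<Longrightarrow> dil (1/s) (dil s p) = p" "s \<noteq> 0 \<Longrightarrow> dil s (dil (1/s) p) = p"
  by (simp_all add: dil_dil)
lemma hor_dil: "hor (dil s p) = s *\<^sub>R hor p"
  by (simp add: vec_eq_iff hor_def dil_def)
lemma nrm_dil: "nrm (dil s p) = \<bar>s\<bar> * nrm p"
  by (simp add: nrm_def hor_dil abs_mult real_sqrt_mult algebra_simps)
lemma norm_dil_le: "0 \<le> s \<Longrightarrow> s \<le> 1 \<Longrightarrow> norm (dil s p) \<le> s * norm p"
proof -
  assume s: "0 \<le> s" "s \<le> 1"
  have "norm (dil s p) \<le> norm (s *\<^sub>R p)"
  proof (rule norm_le_componentwise_cart)
    fix k
    show "norm (dil s p $ k) \<le> norm ((s *\<^sub>R p) $ k)"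
      using s mult_right_mono[of "s * s" s "\<bar>p $ k\<bar>"] mult_left_le[of s s]
      by (auto simp: dil_def abs_mult power2_eq_square)
  qed
  then show ?thesis using s by simp
qed
lemma nrm_0 [simp]: "nrm 0 = 0" by (simp add: nrm_def)
lemma nrm_nonneg: "0 \<le> nrm p" by (simp add: nrm_def)
lemma nrm_tau: "\<bar>p $ tau\<bar> \<le> (nrm p)\<^sup>2"
proof -
  have "sqrt \<bar>p $ tau\<bar> \<le> nrm p" by (simp add: nrm_def)
  then have "(sqrt \<bar>p $ tau\<bar>)\<^sup>2 \<le> (nrm p)\<^sup>2" by (intro power_mono) auto
  then show ?thesis by simp
qed
lemma nrm_hor: "norm (hor p) \<le> nrm p" by (simp add: nrm_def)
lemma bounded_linear_hor: "bounded_linear hor" by (simp add: linear_hor linear_conv_bounded_linear[symmetric])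
lemma continuous_on_hor [continuous_intros]: "continuous_on S f \<Longrightarrow> continuous_on S (\<lambda>x. hor (f x))"
  by (rule bounded_linear.continuous_on[OF bounded_linear_hor])
lemma continuous_on_mul [continuous_intros]:
  "continuous_on S f \<Longrightarrow> continuous_on S g \<Longrightarrow> continuous_on S (\<lambda>x. f x \<odot> g x)"
  unfolding mul_def by (intro continuous_intros)
lemma bounded_linear_dil: "bounded_linear (dil s)" by (simp add: linear_dil linear_conv_bounded_linear[symmetric])
lemma continuous_on_dil [continuous_intros]: "continuous_on S f \<Longrightarrow> continuous_on S (\<lambda>x. dil s (f x))"
  by (rule bounded_linear.continuous_on[OF bounded_linear_dil])
lemma continuous_on_nrm [continuous_intros]: "continuous_on S f \<Longrightarrow> continuous_on S (\<lambda>x. nrm (f x))"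
  unfolding nrm_def by (intro continuous_intros)

section \<open>Lipschitz maps for the homogeneous norm, and their blow-ups\<close>

definition hlip :: "real \<Rightarrow> ('N pt \<Rightarrow> 'N pt) \<Rightarrow> bool"
  where "hlip L F \<longleftrightarrow> 0 \<le> L \<and> (\<forall>p q. nrm (- F p \<odot> F q) \<le> L * nrm (- p \<odot> q))"

lemma hlip_hor: "hlip L F \<Longrightarrow> norm (hor (F q) - hor (F p)) \<le> L * nrm (- p \<odot> q)"
  unfolding hlip_def using nrm_hor[of "- F p \<odot> F q"] by (auto simp: hor_minus intro: order_trans)

text \<open>An integrated contact condition: up to a quadratic error, the vertical increment is
  prescribed by the horizontal parts.\<close>

lemma hlip_tau: assumes "hlip L F"
  shows "\<bar>F q $ tau - F p $ tau - 2 * om (F p) (F q)\<bar> \<le> (L * nrm (- p \<odot> q))\<^sup>2"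
proof -
  have "\<bar>(- F p \<odot> F q) $ tau\<bar> \<le> (nrm (- F p \<odot> F q))\<^sup>2" by (rule nrm_tau)
  also have "\<dots> \<le> (L * nrm (- p \<odot> q))\<^sup>2"
    using assms unfolding hlip_def by (intro power_mono) (auto simp: nrm_nonneg)
  finally show ?thesis by (simp add: om_simps)
qed

text \<open>Since \<open>om (F p) (F q) = om (F p) (F q - F p)\<close>, the twisting term is linear
  in the displacement, so a bound on \<open>hor (F p)\<close> is enough for a Euclidean modulus of
  continuity.\<close>

lemma hlip_dist: assumes "hlip L F"
  shows "norm (F q - F p) \<le> (L * nrm (- p \<odot> q)) * (1 + 2 * norm (hor (F p))) + (L * nrm (- p \<odot> q))\<^sup>2"
proof -
  let ?r = "L * nrm (- p \<odot> q)"
  have h: "norm (hor (F q - F p)) \<le> ?r" using hlip_hor[OF assms] by (simp add: hor_diff)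
  have "om (F p) (F q) = om (F p) (F q - F p)" by (simp add: om_simps)
  then have "\<bar>om (F p) (F q)\<bar> \<le> norm (hor (F p)) * ?r"
    using om_bound[of "F p" "F q - F p"] mult_left_mono[OF h, of "norm (hor (F p))"] by simp
  then have "\<bar>(F q - F p) $ tau\<bar> \<le> ?r\<^sup>2 + 2 * (norm (hor (F p)) * ?r)"
    using hlip_tau[OF assms, where p = p and q = q] by (simp add: abs_le_iff)
  then show ?thesis using norm_le_hor[of "F q - F p"] h by (simp add: algebra_simps)
qed

lemma hlip_continuous: assumes "hlip L F" shows "continuous_on UNIV F"
  unfolding continuous_on_eq_continuous_within
proof
  fix p
  have nrm_lim: "((\<lambda>q. nrm (- p \<odot> q)) \<longlongrightarrow> nrm (- p \<odot> p)) (at p)"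
    using continuous_on_nrm[OF continuous_on_mul[OF continuous_on_const continuous_on_id], of UNIV "- p"]
    unfolding continuous_on_def by blast
  have "((\<lambda>q. (L * nrm (- p \<odot> q)) * (1 + 2 * norm (hor (F p))) + (L * nrm (- p \<odot> q))\<^sup>2) \<longlongrightarrow>
      (L * nrm (- p \<odot> p)) * (1 + 2 * norm (hor (F p))) + (L * nrm (- p \<odot> p))\<^sup>2) (at p)"
    using nrm_lim
    by (intro tendsto_intros nrm_lim)
  then have "((\<lambda>q. (L * nrm (- p \<odot> q)) * (1 + 2 * norm (hor (F p))) + (L * nrm (- p \<odot> q))\<^sup>2) \<longlongrightarrow> 0) (at p)"
    by simp
  then have "((\<lambda>q. F q - F p) \<longlongrightarrow> 0) (at p)"
    by (rule Lim_null_comparison[rotated]) (auto intro!: always_eventually hlip_dist[OF assms])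
  then show "continuous (at p) F" by (simp add: continuous_within LIM_zero_iff)
qed

text \<open>Pansu's difference quotient of \<open>F\<close> at \<open>p\<close>: the translations
  and dilations on both sides are those of the group, so the Lipschitz constant does not change with
  the scale.\<close>

definition blow :: "('N pt \<Rightarrow> 'N pt) \<Rightarrow> real \<Rightarrow> 'N pt \<Rightarrow> 'N pt \<Rightarrow> 'N pt"
  where "blow F s p w = dil (1/s) (- F p \<odot> F (p \<odot> dil s w))"

lemma blow_0 [simp]: "blow F s p 0 = 0" by (simp add: blow_def)

lemma hlip_blow: assumes "hlip L F" "s > 0" shows "hlip L (blow F s p)"
  unfolding hlip_def
proof (intro conjI allI)
  fix v w
  have "- blow F s p v \<odot> blow F s p w = dil (1/s) (- F (p \<odot> dil s v) \<odot> F (p \<odot> dil s w))"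
    by (simp add: blow_def dil_minus[symmetric] dil_mul[symmetric] minus_mul mul_assoc)
  moreover have "- (p \<odot> dil s v) \<odot> (p \<odot> dil s w) = dil s (- v \<odot> w)"
    by (simp add: minus_mul mul_assoc dil_mul dil_minus)
  ultimately show "nrm (- blow F s p v \<odot> blow F s p w) \<le> L * nrm (- v \<odot> w)"
    using assms(1)[unfolded hlip_def, THEN conjunct2, rule_format, of "p \<odot> dil s v" "p \<odot> dil s w"] assms(2)
    by (simp add: nrm_dil field_simps)
qed (use assms hlip_def in auto)

lemma blow_inv: "s > 0 \<Longrightarrow> F (p \<odot> dil s w) = F p \<odot> dil s (blow F s p w)"
  by (simp add: blow_def)

end

section \<open>Conformally symplectic matrices\<close>

lemma continuous_on_det:
  fixes A :: "'a::topological_space \<Rightarrow> real^'n^'n"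
  assumes "\<And>i j. continuous_on S (\<lambda>x. A x $ i $ j)"
  shows "continuous_on S (\<lambda>x. det (A x))"
  unfolding det_def
  by (rule continuous_on_sum, rule continuous_on_mult[OF continuous_on_const], rule continuous_on_prod, rule assms)

text \<open>A continuous determinant that never vanishes keeps its sign; injectivity along the path
  is the form in which non-vanishing is available.\<close>

lemma det_pos_path:
  fixes f :: "real \<Rightarrow> real^'n \<Rightarrow> real^'n"
  assumes lin: "\<And>s. s \<in> {0..1} \<Longrightarrow> linear (f s)"
    and cont: "\<And>v. continuous_on {0..1} (\<lambda>s. f s v)"
    and inj: "\<And>s v. s \<in> {0..1} \<Longrightarrow> f s v = 0 \<Longrightarrow> v = 0"
    and pos: "det (matrix (f 0)) > 0"
  shows "det (matrix (f 1)) > 0"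
proof (rule ccontr)
  assume n: "\<not> ?thesis"
  have "continuous_on {0..1} (\<lambda>s. det (matrix (f s)))"
    using cont by (intro continuous_on_det) (simp add: matrix_def continuous_on_component)
  then obtain s where s: "s \<in> {0..1}" "det (matrix (f s)) = 0"
    using IVT2'[of "\<lambda>s. det (matrix (f s))" 1 0 0] n pos by auto
  have "inj (f s)"
    using inj[OF s(1)] lin[OF s(1)] by (simp add: linear_injective_0)
  then show False using det_nz_iff_inj[OF lin[OF s(1)]] s by simp
qed

text \<open>The segment from the identity to \<open>f\<close> stays injective, because pairing with
  \<open>v\<close> gives a positive number throughout.\<close>

lemma det_pos_of_pos:
  fixes f :: "real^'n \<Rightarrow> real^'n"
  assumes "linear f" and pos: "\<And>v. v \<noteq> 0 \<Longrightarrow> v \<bullet> f v > 0"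
  shows "det (matrix f) > 0"
proof -
  have "det (matrix (\<lambda>v. (1 - 1) *\<^sub>R v + (1::real) *\<^sub>R f v)) > 0"
  proof (rule det_pos_path[where f = "\<lambda>s v. (1 - s) *\<^sub>R v + s *\<^sub>R f v"])
    fix s v assume s: "s \<in> {0..1::real}" and 0: "(1 - s) *\<^sub>R v + s *\<^sub>R f v = 0"
    show "v = 0"
    proof (rule ccontr)
      assume v: "v \<noteq> 0"
      have "(1 - s) * (v \<bullet> v) + s * (v \<bullet> f v) = v \<bullet> ((1 - s) *\<^sub>R v + s *\<^sub>R f v)"
        by (simp add: inner_add_right)
      moreover have "(1 - s) * (v \<bullet> v) + s * (v \<bullet> f v) > 0"
      proof (cases "s = 0")
        case False
        then show ?thesis using s pos[OF v] by (intro add_nonneg_pos mult_nonneg_nonneg mult_pos_pos) auto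
      qed (use v in auto)
      ultimately show False using 0 by simp
    qed
  next
    fix s show "linear (\<lambda>v. (1 - s) *\<^sub>R v + s *\<^sub>R f v)"
      using assms(1) by (intro linear_compose_add linear_compose_scale_right linear_id[unfolded id_def])
  next
    have "matrix (\<lambda>v. v) = (mat 1 :: real^'n^'n)" using matrix_id_mat_1 by (simp add: id_def)
    then show "det (matrix (\<lambda>v. (1 - 0) *\<^sub>R v + (0::real) *\<^sub>R f v)) > 0" by simp
  qed (intro continuous_intros)
  then show ?thesis by simp
qed

text \<open>\<open>det (1 - x A)\<close> is a polynomial in \<open>x\<close> with value 1 at 0,
  hence nonzero, and the reciprocal of each nonzero eigenvalue is one of its roots.\<close>

lemma finite_eigenvalues:
  fixes A :: "complex^'n^'n"
  shows "finite {z. \<exists>w. w \<noteq> 0 \<and> A *v w = z *s w}"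
proof -
  define P :: "complex poly^'n^'n" where "P = (\<chi> i j. [:if i = j then 1 else 0, - (A $ i $ j):])"
  have pP: "poly (det P) x = det (mat 1 + (\<chi> i j. - x * A $ i $ j))" for x
    by (simp add: det_def P_def poly_sum poly_prod mat_def if_distrib algebra_simps)
       (rule sum.cong, auto simp: sign_def intro!: prod.cong)
  have "(mat 1 + (\<chi> i j. - 0 * A $ i $ j)) = (mat 1 :: complex^'n^'n)" by (simp add: vec_eq_iff)
  then have "poly (det P) 0 = 1" unfolding pP by simp
  then have "det P \<noteq> 0" by auto
  then have fin: "finite {x. poly (det P) x = 0}" by (rule poly_roots_finite)
  have "{z. \<exists>w. w \<noteq> 0 \<and> A *v w = z *s w} \<subseteq> insert 0 ((\<lambda>x. 1 / x) ` {x. poly (det P) x = 0})"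
  proof
    fix z assume "z \<in> {z. \<exists>w. w \<noteq> 0 \<and> A *v w = z *s w}"
    then obtain w where w: "w \<noteq> 0" "A *v w = z *s w" by blast
    show "z \<in> insert 0 ((\<lambda>x. 1 / x) ` {x. poly (det P) x = 0})"
    proof (cases "z = 0")
      case False
      let ?B = "mat 1 + (\<chi> i j. - (1/z) * A $ i $ j) :: complex^'n^'n"
      have "(\<chi> i j. - (1/z) * A $ i $ j) *v w = (- (1/z)) *s (A *v w)"
        by (simp add: vec_eq_iff matrix_vector_mult_def sum_distrib_left sum_negf mult.assoc)
      then have "?B *v w = 0"
        using w(2) False by (simp add: matrix_vector_mult_add_rdistrib vec_eq_iff)
      then have "\<not> invertible ?B"
        using w(1) unfolding invertible_left_inverse matrix_left_invertible_ker by blast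
      then have "poly (det P) (1/z) = 0" unfolding pP by (simp add: invertible_det_nz)
      then show ?thesis using False by (intro insertI2 image_eqI[of _ _ "1/z"]) auto
    qed simp
  qed
  then show ?thesis by (rule finite_subset) (use fin in auto)
qed

context heis_coords begin

text \<open>The classical reason is that the real determinant of a complex-linear map is the squared
  modulus of the complex one. The argument here runs through eigenvalues: were the determinant
  negative, adding a growing multiple of the rotation by any acute angle \<open>\<theta>\<close>
  would pass through a singular map before the determinant becomes positive, which gives an
  eigenvalue on the ray opposite to \<open>cis \<theta>\<close>. There are infinitely many such rays
  but only finitely many eigenvalues.\<close>

lemma linear_nonneg_det_of_commute:
  assumes M: "linear M"
    and comm: "\<And>v. v $ tau = 0 \<Longrightarrow> M (Jop v) = Jop (M v)"
    and tauM: "\<And>v. M v $ tau = c * v $ tau" and c: "c \<ge> 0"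
  shows "det (matrix M) \<ge> 0"
proof (rule ccontr)
  assume neg: "\<not> det (matrix M) \<ge> 0"
  \<comment> \<open>Multiplication by \<open>cis \<theta>\<close> on the horizontal part and by
    \<open>cos \<theta>\<close> on the vertical axis.\<close>
  define K where "K = (\<lambda>\<theta> v. cos \<theta> *\<^sub>R v + sin \<theta> *\<^sub>R Jop v)"
  define T where "T = {0<..<pi/2}"
  have linK: "linear (K \<theta>)" for \<theta>
    unfolding K_def by (intro linear_compose_add linear_compose_scale_right linear_id[unfolded id_def] linear_Jop)
  obtain B where B: "B > 0" "\<And>v. norm (M v) \<le> norm v * B"
    using bounded_linear.pos_bounded M linear_conv_bounded_linear by blast
  have JJ: "v \<bullet> Jop v = 0" for v using om_inner[of v v] by simp
  have ex: "\<exists>r>0. \<exists>v. v \<noteq> 0 \<and> M v + r *\<^sub>R K \<theta> v = 0" if "\<theta> \<in> T" for \<theta>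
  proof -
    have cpos: "cos \<theta> > 0" using that by (auto simp: T_def intro: cos_gt_zero)
    \<comment> \<open>With this \<open>r0\<close> the rotation contributes
      \<open>2 * B * (v \<bullet> v)\<close> to the pairing with \<open>v\<close>, twice what
      \<open>M\<close> can take away.\<close>
    define r0 where "r0 = 2 * B / cos \<theta>"
    have lin: "linear (\<lambda>v. M v + r *\<^sub>R K \<theta> v)" for r
      by (intro linear_compose_add M linear_compose_scale_right linK)
    have "det (matrix (\<lambda>v. M v + r0 *\<^sub>R K \<theta> v)) > 0"
    proof (rule det_pos_of_pos[OF lin])
      fix v :: "'N pt" assume v: "v \<noteq> 0"
      have "v \<bullet> (M v + r0 *\<^sub>R K \<theta> v) = v \<bullet> M v + 2 * B * (v \<bullet> v)"
        using cpos by (simp add: K_def inner_add_right JJ r0_def)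
      moreover have "\<bar>v \<bullet> M v\<bar> \<le> B * (v \<bullet> v)"
        using Cauchy_Schwarz_ineq2[of v "M v"] mult_left_mono[OF B(2)[of v], of "norm v"]
        by (simp add: power2_norm_eq_inner[symmetric] power2_eq_square algebra_simps)
      moreover have "B * (v \<bullet> v) > 0" using B v by simp
      ultimately show "v \<bullet> (M v + r0 *\<^sub>R K \<theta> v) > 0" by linarith
    qed
    moreover have "continuous_on {0..r0} (\<lambda>r. det (matrix (\<lambda>v. M v + r *\<^sub>R K \<theta> v)))"
      by (intro continuous_on_det) (simp add: matrix_def K_def, intro continuous_intros)
    moreover have "r0 \<ge> 0" using B cpos by (simp add: r0_def)
    ultimately obtain r where r: "r \<in> {0..r0}" "det (matrix (\<lambda>v. M v + r *\<^sub>R K \<theta> v)) = 0"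
      using IVT'[of "\<lambda>r. det (matrix (\<lambda>v. M v + r *\<^sub>R K \<theta> v))" 0 0 r0] neg
      by (simp add: not_le) (meson atLeastAtMost_iff less_imp_le)
    then have "\<not> inj (\<lambda>v. M v + r *\<^sub>R K \<theta> v)" using det_nz_iff_inj[OF lin] by blast
    then obtain v where "v \<noteq> 0" "M v + r *\<^sub>R K \<theta> v = 0"
      using linear_injective_0[OF lin] by blast
    moreover have "r \<noteq> 0"
    proof
      assume "r = 0"
      then show False using r(2) neg by simp
    qed
    moreover have "r > 0" using r(1) \<open>r \<noteq> 0\<close> by simp
    ultimately show ?thesis by blast
  qed
  define A :: "((complex,'N) vec,'N) vec" where "A = (\<chi> i j. of_real (matrix M $ i $ j))"
  define E where "E = {z. \<exists>w. w \<noteq> 0 \<and> A *v w = z *s w}"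
  have Av: "A *v (\<chi> k. of_real (v $ k)) = (\<chi> k. of_real (M v $ k))" for v
  proof -
    have "M v $ k = (\<Sum>j\<in>UNIV. matrix M $ k $ j * v $ j)" for k
      using fun_cong[OF matrix_vector_mul(2)[OF M], of v] by (simp add: matrix_vector_mult_def vec_eq_iff)
    then show ?thesis by (simp add: A_def vec_eq_iff matrix_vector_mult_def)
  qed
  have "\<exists>r>0. - (of_real r * cis \<theta>) \<in> E" if "\<theta> \<in> T" for \<theta>
  proof -
    have cpos: "cos \<theta> > 0" using that by (auto simp: T_def intro: cos_gt_zero)
    from ex[OF that] obtain r v where r: "r > 0" "v \<noteq> 0" and eq: "M v + r *\<^sub>R K \<theta> v = 0" by blast
    \<comment> \<open>The factor \<open>c + r * cos \<theta>\<close> is positive, so the kernel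
      vector is horizontal, where \<open>M\<close> commutes with \<open>Jop\<close>.\<close>
    have "(c + r * cos \<theta>) * v $ tau = (M v + r *\<^sub>R K \<theta> v) $ tau"
      by (simp add: K_def tauM algebra_simps)
    then have "(c + r * cos \<theta>) * v $ tau = 0" using eq by simp
    moreover have "c + r * cos \<theta> > 0" using c r cpos by (intro add_nonneg_pos) auto
    ultimately have vt: "v $ tau = 0" by simp
    then have J2: "Jop (Jop v) = - v" by (intro vec_eqI) auto
    \<comment> \<open>\<open>Jop\<close> acts on \<open>w\<close> as multiplication by i, so the
      equation \<open>M v = - r *\<^sub>R K \<theta> v\<close> becomes an eigenvalue equation for
      \<open>w\<close>.\<close>
    define w where "w = ((\<chi> k. of_real (v $ k) - \<i> * of_real (Jop v $ k)) :: (complex,'N) vec)"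
    have Mv: "M v = - (r * cos \<theta>) *\<^sub>R v - (r * sin \<theta>) *\<^sub>R Jop v"
    proof -
      have "M v = (M v + r *\<^sub>R K \<theta> v) - r *\<^sub>R K \<theta> v" by simp
      then show ?thesis unfolding eq by (simp add: K_def algebra_simps)
    qed
    have MJ: "M (Jop v) = - (r * cos \<theta>) *\<^sub>R Jop v + (r * sin \<theta>) *\<^sub>R v"
      unfolding comm[OF vt] Mv by (simp add: linear_diff[OF linear_Jop] linear_scale[OF linear_Jop] linear_neg[OF linear_Jop] J2)
    have w: "w = (\<chi> k. of_real (v $ k)) - \<i> *s (\<chi> k. of_real (Jop v $ k))"
      by (simp add: w_def vec_eq_iff)
    have "A *v w = A *v (\<chi> k. of_real (v $ k)) - \<i> *s (A *v (\<chi> k. of_real (Jop v $ k)))"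
      unfolding w by (simp add: matrix_vector_mult_diff_distrib vector_scalar_commute)
    also have "\<dots> = (- (of_real r * cis \<theta>)) *s w"
      unfolding Av Mv MJ w_def
      by (simp add: vec_eq_iff complex_eq_iff)
    finally have Aw: "A *v w = (- (of_real r * cis \<theta>)) *s w" .
    moreover have "w \<noteq> 0"
    proof
      assume "w = 0"
      then have "w $ k = 0" for k by simp
      then have "v $ k = 0" for k unfolding w_def by (simp add: complex_eq_iff)
      then show False using r(2) by (simp add: vec_eq_iff)
    qed
    ultimately show ?thesis using r(1) unfolding E_def by blast
  qed
  then have "\<forall>\<theta>\<in>T. \<exists>r. r > 0 \<and> - (of_real r * cis \<theta>) \<in> E" by blast
  from bchoice[OF this] obtain R
    where R: "\<And>\<theta>. \<theta> \<in> T \<Longrightarrow> R \<theta> > 0 \<and> - (of_real (R \<theta>) * cis \<theta>) \<in> E" by blast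
  have "inj_on (\<lambda>\<theta>. - (of_real (R \<theta>) * cis \<theta>)) T"
  proof (rule inj_onI)
    fix x y assume xy: "x \<in> T" "y \<in> T" "- (of_real (R x) * cis x) = - (of_real (R y) * cis y)"
    have "norm (of_real (R x) * cis x) = norm (of_real (R y) * cis y)" using xy(3) by simp
    then have "R x = R y" using R[OF xy(1)] R[OF xy(2)] by (simp add: norm_mult)
    then have "cis x = cis y" using xy(3) R[OF xy(1)] by simp
    then have "Im (cis x) = Im (cis y)" by simp
    then have "sin x = sin y" by simp
    then show "x = y" using xy(1,2) sin_inj_pi[of x y] by (auto simp: T_def)
  qed
  moreover have "finite ((\<lambda>\<theta>. - (of_real (R \<theta>) * cis \<theta>)) ` T)"
    by (rule finite_subset[of _ E]) (use R finite_eigenvalues[of A] in \<open>auto simp: E_def\<close>)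
  ultimately have "finite T" by (simp add: finite_image_iff)
  then show False unfolding T_def using infinite_Ioo[of 0 "pi/2"] by simp
qed

text \<open>\<open>D\<close> is joined by injective maps to the average of \<open>D\<close> and
  \<open>D'\<close>, which commutes with \<open>Jop\<close> on horizontal vectors and so has
  nonnegative determinant. On the horizontal part \<open>D'\<close> is \<open>lam\<close> times the
  inverse transpose of \<open>D\<close>; this is why \<open>D v \<bullet> D' v\<close> is positive
  and the segment never degenerates.\<close>

lemma conformal_det_pos:
  assumes D: "linear D" and om: "\<And>u v. om (D u) (D v) = lam * om u v"
    and tauD: "\<And>v. D v $ tau = lam * v $ tau" and lam: "lam > 0"
  shows "det (matrix D) \<ge> 0"
proof -
  define D' where "D' = (\<lambda>v. (lam * v $ tau) *\<^sub>R axis tau 1 - Jop (D (Jop v)))"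
  have linD': "linear D'"
    unfolding D'_def
    by (rule linearI) (simp_all add: linear_add[OF D] linear_add[OF linear_Jop] linear_scale[OF D]
        linear_scale[OF linear_Jop] algebra_simps)
  have JJh: "Jop (Jop v) = - hor v" for v
    by (rule vec_eqI) simp_all
  have ip: "D u \<bullet> D' v = lam * (u \<bullet> hor v) + lam\<^sup>2 * u $ tau * v $ tau" for u v
  proof -
    have "D u \<bullet> Jop (D (Jop v)) = lam * om u (Jop v)" by (simp add: om om_inner[symmetric])
    also have "\<dots> = - (lam * (u \<bullet> hor v))" by (simp add: om_inner JJh)
    finally show ?thesis
      by (simp add: D'_def inner_diff_right inner_axis tauD power2_eq_square algebra_simps)
  qed
  have vh: "v \<bullet> hor v + (v $ tau)\<^sup>2 = v \<bullet> v" for v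
    by (simp add: inner_vec_def sum_coords power2_eq_square)
  have ip_pos: "D v \<bullet> D' v > 0" if "v \<noteq> 0" for v
  proof -
    have "0 < v \<bullet> v" using that by simp
    have nn: "v \<bullet> hor v \<ge> 0" by (simp add: inner_vec_def sum_coords) (intro add_nonneg_nonneg sum_nonneg, auto)
    show ?thesis
    proof (cases "v $ tau = 0")
      case True
      then show ?thesis using vh[of v] \<open>0 < v \<bullet> v\<close> lam by (simp add: ip)
    next
      case False
      then have "lam\<^sup>2 * v $ tau * v $ tau > 0" using lam by (simp add: mult.assoc zero_less_mult_iff linorder_neq_iff) blast
      then show ?thesis using nn lam by (simp add: ip add_nonneg_pos)
    qed
  qed
  let ?f = "\<lambda>s v. (1 - s) *\<^sub>R D v + s *\<^sub>R D' v"
  have linf: "linear (?f s)" for s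
    by (intro linear_compose_add linear_compose_scale_right D linD')
  have injf: "v = 0" if s: "s \<in> {0..1}" and 0: "?f s v = 0" for s v
  proof (rule ccontr)
    assume v: "v \<noteq> 0"
    have "(1 - s) * (D v \<bullet> D v) + s * (D v \<bullet> D' v) = D v \<bullet> ?f s v" by (simp add: inner_add_right)
    moreover have "D v \<noteq> 0" using ip_pos[OF v] by auto
    then have "(1 - s) * (D v \<bullet> D v) + s * (D v \<bullet> D' v) > 0"
      using s ip_pos[OF v] by (cases "s = 0") (auto intro!: add_nonneg_pos)
    ultimately show False using 0 by simp
  qed
  define M where "M = ?f (1/2)"
  have Mdet: "det (matrix M) \<ge> 0"
  proof (rule linear_nonneg_det_of_commute[where c = lam])
    show "linear M" unfolding M_def by (rule linf)
    show "lam \<ge> 0" using lam by simp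
    show "M v $ tau = lam * v $ tau" for v
      by (simp add: M_def D'_def tauD)
    fix v :: "'N pt" assume v: "v $ tau = 0"
    then have hv: "hor v = v" by (simp add: vec_eq_iff hor_def)
    have hD: "hor (D (Jop v)) = D (Jop v)" by (simp add: vec_eq_iff hor_def tauD)
    show "M (Jop v) = Jop (M v)"
      by (simp add: M_def D'_def linear_add[OF linear_Jop] linear_scale[OF linear_Jop] linear_diff[OF linear_Jop]
          v JJh hv linear_neg[OF linear_Jop] linear_neg[OF D] hD algebra_simps)
  qed
  have "\<not> det (matrix D) < 0"
  proof
    assume neg: "det (matrix D) < 0"
    have "continuous_on {0..1/2} (\<lambda>s. det (matrix (?f s)))"
      by (intro continuous_on_det) (simp add: matrix_def, intro continuous_intros)
    then obtain s where s: "s \<in> {0..1/2}" "det (matrix (?f s)) = 0"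
      using IVT'[of "\<lambda>s. det (matrix (?f s))" 0 0 "1/2"] neg Mdet by (auto simp: M_def)
    have "s \<in> {0..1}" using s(1) by simp
    then have "inj (?f s)" using injf linear_injective_0[OF linf] by blast
    then show False using det_nz_iff_inj[OF linf] s(2) by blast
  qed
  then show ?thesis by simp
qed

text \<open>For negative \<open>lam\<close>, composing with \<open>R\<close>, the reflection of the
  x and t coordinates, makes the factor positive. \<open>R\<close> has determinant (-1)^(m+1), and
  this is where odd m enters. For \<open>lam = 0\<close> the vertical direction is missed and the
  determinant vanishes.\<close>

theorem conformal_det_nonneg:
  assumes odd: "odd CARD('m)"
    and D: "linear D" and om: "\<And>u v. om (D u) (D v) = lam * om u v"
    and tauD: "\<And>v. D v $ tau = lam * v $ tau"
  shows "det (matrix D) \<ge> 0"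
proof -
  consider "lam > 0" | "lam = 0" | "lam < 0" by linarith
  then show ?thesis
  proof cases
    case 1 then show ?thesis using conformal_det_pos[OF D om tauD] by blast
  next
    case 2
    have "\<not> surj D"
    proof
      assume "surj D"
      then obtain v where "D v = axis tau 1" by (metis surjD)
      then show False using tauD[of v] 2 by simp
    qed
    then have "\<not> inj D" using linear_injective_imp_surjective[OF D] by blast
    then show ?thesis using det_nz_iff_inj[OF D] by force
  next
    case 3
    define S where "S = insert tau (range xi)"
    define R where "R = (\<lambda>v::'N pt. \<chi> k. (if k \<in> S then -1 else 1) * v $ k)"
    have linR: "linear R" unfolding R_def by (rule linearI) (auto simp: vec_eq_iff algebra_simps)
    have S [simp]: "tau \<in> S" "xi i \<in> S" "yi i \<notin> S" for i by (auto simp: S_def)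
    have linDR: "linear (D \<circ> R)" using linear_compose[OF linR D] .
    have omR: "om (R u) (R v) = - om u v" for u v
      by (simp add: om_def R_def sum_negf[symmetric])
    have "det (matrix (D \<circ> R)) \<ge> 0"
    proof (rule conformal_det_pos[OF linDR, where lam = "- lam"])
      show "om ((D \<circ> R) u) ((D \<circ> R) v) = - lam * om u v" for u v by (simp add: om omR)
      show "(D \<circ> R) v $ tau = - lam * v $ tau" for v by (simp add: tauD) (simp add: R_def)
    qed (use 3 in simp)
    moreover have "det (matrix (D \<circ> R)) = det (matrix D) * det (matrix R)"
      by (simp add: matrix_compose[OF linR D] det_mul)
    moreover have "det (matrix R) = 1"
    proof -
      have "det (matrix R) = (\<Prod>k\<in>UNIV. matrix R $ k $ k)"
        by (rule det_diagonal) (simp add: matrix_def R_def axis_def)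
      also have "\<dots> = (\<Prod>k\<in>UNIV. if k \<in> S then -1 else 1)"
        by (simp add: matrix_def R_def axis_def)
      also have "\<dots> = (-1) ^ card S" by (simp add: prod.If_cases)
      also have "card S = Suc CARD('m)"
        unfolding S_def by (subst card_insert_disjoint) (auto simp: card_image inj_xi)
      finally show ?thesis using odd by simp
    qed
    ultimately show ?thesis by simp
  qed
qed

end

section \<open>Volume and the Jacobian determinant\<close>

text \<open>A solution of \<open>g x = y\<close> is a fixed point of
  \<open>x \<mapsto> y + (x - g x)\<close>, which maps the ball of radius \<open>B + 1\<close> about
  \<open>y\<close> into itself.\<close>

lemma surj_of_bounded_displacement:
  fixes g :: "'a::euclidean_space \<Rightarrow> 'a"
  assumes "continuous_on UNIV g" and "\<And>x. norm (g x - x) \<le> B"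
  shows "\<exists>x. g x = y"
proof -
  have "\<exists>x\<in>cball y (B + 1). g x = y"
  proof (rule brouwer_surjective_cball[where S = "{y}"])
    show "continuous_on (cball y (B + 1)) g" using assms(1) continuous_on_subset by blast
    have "0 \<le> B" using assms(2)[of y] norm_ge_zero order_trans by blast
    then show "B + 1 > 0" by simp
    fix x z assume "x \<in> {y}" "z \<in> cball y (B + 1)"
    then show "x + (z - g z) \<in> cball y (B + 1)"
      using assms(2)[of z] by (simp add: dist_norm norm_minus_commute)
  qed simp
  then show ?thesis by blast
qed

lemma continuous_compact_bound:
  fixes f :: "'a::topological_space \<Rightarrow> 'b::real_normed_vector"
  assumes "continuous_on UNIV f" "compact S"
  obtains b where "b \<ge> 0" "\<And>x. x \<in> S \<Longrightarrow> norm (f x) \<le> b"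
proof -
  have "compact (f ` S)"
    using assms by (meson compact_continuous_image continuous_on_subset subset_UNIV)
  then obtain c where "\<forall>y\<in>f ` S. norm y \<le> c"
    using compact_imp_bounded bounded_iff by blast
  then show ?thesis using that[of "max c 0"] by (simp add: le_max_iff_disj)
qed

lemma det_mat_plus_poly:
  fixes A :: "real^'n^'n"
  shows "det (mat 1 + s *\<^sub>R A) = (\<Sum>S\<in>Pow UNIV. s ^ card S *
    (\<Sum>p | p permutes UNIV. of_int (sign p) *
      ((\<Prod>i\<in>S. A $ i $ p i) * (\<Prod>i\<in>UNIV - S. mat 1 $ i $ p i))))"
proof -
  have "det (mat 1 + s *\<^sub>R A) = (\<Sum>p | p permutes UNIV. of_int (sign p) *
      (\<Prod>i\<in>UNIV. s * A $ i $ p i + mat 1 $ i $ p i))"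
    by (simp add: det_def add.commute)
  also have "\<dots> = (\<Sum>p | p permutes UNIV. of_int (sign p) *
      (\<Sum>S\<in>Pow UNIV. (\<Prod>i\<in>S. s * A $ i $ p i) * (\<Prod>i\<in>UNIV - S. mat 1 $ i $ p i)))"
    by (subst prod_add) simp_all
  also have "\<dots> = (\<Sum>p | p permutes UNIV. \<Sum>S\<in>Pow UNIV. s ^ card S * (of_int (sign p) *
      ((\<Prod>i\<in>S. A $ i $ p i) * (\<Prod>i\<in>UNIV - S. mat 1 $ i $ p i))))"
    by (simp add: sum_distrib_left prod.distrib mult_ac)
  also have "\<dots> = (\<Sum>S\<in>Pow UNIV. s ^ card S * (\<Sum>p | p permutes UNIV. of_int (sign p) *
      ((\<Prod>i\<in>S. A $ i $ p i) * (\<Prod>i\<in>UNIV - S. mat 1 $ i $ p i))))"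
    by (subst sum.swap) (simp add: sum_distrib_left)
  finally show ?thesis .
qed

lemma poly_eq_const_of_small:
  fixes c :: "nat \<Rightarrow> real"
  assumes "s0 > 0" and "\<And>s. 0 < s \<Longrightarrow> s < s0 \<Longrightarrow> (\<Sum>k\<le>n. c k * s ^ k) = v"
  shows "(\<Sum>k\<le>n. c k) = v"
proof -
  define p where "p = (\<Sum>k\<le>n. monom (c k) k) - [:v:]"
  have p: "poly p s = (\<Sum>k\<le>n. c k * s ^ k) - v" for s
    by (simp add: p_def poly_sum poly_monom)
  have "infinite {0<..<s0}" using assms(1) by simp
  moreover have "{0<..<s0} \<subseteq> {s. poly p s = 0}" using assms(2) p by auto
  ultimately have "p = 0" using poly_roots_finite finite_subset by blast
  then show ?thesis using p[of 1] by simp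
qed

text \<open>For small \<open>s\<close> the map \<open>x + s (g x - x)\<close> is a bijection of the box, and the integral of its
  Jacobian determinant is a polynomial in \<open>s\<close>.\<close>

lemma integral_det_eq_content:
  fixes g :: "(real,'n::{finite,wellorder}) vec \<Rightarrow> (real,'n) vec" and A :: "(real,'n) vec \<Rightarrow> ((real,'n) vec,'n) vec"
  assumes der: "\<And>x. (g has_derivative (*v) (A x)) (at x)"
    and cont: "\<And>i j. continuous_on UNIV (\<lambda>x. A x $ i $ j)"
    and out: "\<And>x. x \<notin> cbox a b \<Longrightarrow> g x = x"
  shows "integral (cbox a b) (\<lambda>x. det (A x)) = measure lebesgue (cbox a b)"
proof -
  let ?Q = "cbox a b"
  define U where "U x = g x - x" for x
  define B where "B x = A x - mat 1" for x
  have derU: "(U has_derivative (*v) (B x)) (at x)" for x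
    unfolding U_def B_def
    by (rule has_derivative_eq_rhs) (auto intro!: derivative_eq_intros der simp: matrix_vector_mult_diff_rdistrib)
  have contB: "continuous_on UNIV (\<lambda>x. B x $ i $ j)" for i j
    unfolding B_def by (simp, intro continuous_intros cont)
  have "continuous_on UNIV (\<lambda>x. \<Sum>i\<in>UNIV. \<Sum>j\<in>UNIV. \<bar>B x $ i $ j\<bar>)"
    by (intro continuous_intros contB)
  from continuous_compact_bound[OF this compact_cbox[of a b]] obtain K0
    where K0': "\<And>x. x \<in> ?Q \<Longrightarrow> norm (\<Sum>i\<in>UNIV. \<Sum>j\<in>UNIV. \<bar>B x $ i $ j\<bar>) \<le> K0" by blast
  have K0: "(\<Sum>i\<in>UNIV. \<Sum>j\<in>UNIV. \<bar>B x $ i $ j\<bar>) \<le> K0" if "x \<in> ?Q" for x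
    using K0'[OF that] by simp
  define K where "K = max K0 0"
  have on: "onorm ((*v) (B x)) \<le> K" for x
  proof (cases "x \<in> ?Q")
    case True
    then show ?thesis
      using order_trans[OF onorm_le_matrix_component_sum K0[OF True]] by (simp add: K_def)
  next
    case False
    have "(U has_derivative (\<lambda>_. 0)) (at x)"
    proof (rule has_derivative_transform_within_open[where s = "- ?Q" and f = "\<lambda>_. 0"])
      show "open (- ?Q)" by (simp add: closed_cbox open_Compl)
    qed (use False out in \<open>auto simp: U_def\<close>)
    then have "(*v) (B x) = (\<lambda>_. 0)" using has_derivative_unique derU by blast
    then show ?thesis by (simp add: onorm_zero K_def)
  qed
  have lip: "norm (U x - U y) \<le> K * norm (x - y)" for x y
    by (rule differentiable_bound[of UNIV]) (use derU on in auto)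
  have nB: "norm (B x *v v) \<le> K * norm v" for x v
    using onorm[of "(*v) (B x)" v] mult_right_mono[OF on norm_ge_zero, of x v] by simp
  have K: "K \<ge> 0" by (simp add: K_def)
  \<comment> \<open>Below \<open>s0\<close> the perturbation \<open>s U\<close> is a contraction,
    which yields injectivity and, through \<open>det_pos_of_pos\<close>, a positive
    determinant.\<close>
  define s0 where "s0 = 1 / (K + 1)"
  have s0: "s0 > 0" using K by (simp add: s0_def)
  have sK: "s * K < 1" if "0 < s" "s < s0" for s
  proof -
    have "s * (K + 1) < 1" using that K by (simp add: s0_def field_simps)
    then show ?thesis using that by (simp add: algebra_simps)
  qed
  obtain BU where BU: "\<And>x. norm (U x) \<le> BU"
  proof -
    have "continuous_on UNIV U"
      using has_derivative_continuous[OF derU] by (simp add: continuous_at_imp_continuous_on)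
    from continuous_compact_bound[OF this compact_cbox[of a b]]
    obtain b where "\<And>x. x \<in> ?Q \<Longrightarrow> norm (U x) \<le> b" by blast
    then have "norm (U x) \<le> max b 0" for x using out[of x] by (cases "x \<in> ?Q") (auto simp: U_def simp: le_max_iff_disj)
    then show ?thesis using that by blast
  qed
  have small: "integral ?Q (\<lambda>x. det (mat 1 + s *\<^sub>R B x)) = measure lebesgue ?Q"
    if s: "0 < s" "s < s0" for s
  proof -
    define h where "h x = x + s *\<^sub>R U x" for x
    have derh: "(h has_derivative (*v) (mat 1 + s *\<^sub>R B x)) (at x)" for x
      unfolding h_def
      by (rule has_derivative_eq_rhs)
        (auto intro!: derivative_eq_intros derU simp: matrix_vector_mult_add_rdistrib scaleR_matrix_vector_assoc)
    have injh: "x = y" if "h x = h y" for x y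
    proof (rule ccontr)
      assume ne: "x \<noteq> y"
      have "x - y = s *\<^sub>R (U y - U x)" using that by (simp add: h_def algebra_simps)
      then have "norm (x - y) = s * norm (U y - U x)" using s by simp
      also have "\<dots> \<le> s * (K * norm (x - y))"
        using lip[of y x] s by (intro mult_left_mono) (auto simp: norm_minus_commute)
      also have "\<dots> < norm (x - y)" using sK[OF s] ne by (simp add: mult.assoc[symmetric])
      finally show False by simp
    qed
    have surj: "\<exists>x. h x = y" for y
    proof (rule surj_of_bounded_displacement[where B = "s * BU"])
      show "continuous_on UNIV h"
        using has_derivative_continuous[OF derh] by (simp add: continuous_at_imp_continuous_on)
      show "norm (h x - x) \<le> s * BU" for x using BU[of x] s by (simp add: h_def)
    qed
    have outh: "h x = x" if "x \<notin> ?Q" for x using out[OF that] by (simp add: h_def U_def)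
    have "h ` ?Q = ?Q"
    proof (intro equalityI subsetI)
      fix y assume "y \<in> h ` ?Q"
      then obtain x where x: "x \<in> ?Q" "y = h x" by blast
      show "y \<in> ?Q"
      proof (rule ccontr)
        assume "y \<notin> ?Q"
        then have "h y = h x" using outh x by simp
        then have "y = x" by (rule injh)
        then show False using x \<open>y \<notin> ?Q\<close> by simp
      qed
    next
      fix y assume y: "y \<in> ?Q"
      obtain x where x: "h x = y" using surj by blast
      have "x \<in> ?Q"
      proof (rule ccontr)
        assume n: "x \<notin> ?Q"
        then show False using outh[OF n] x y by simp
      qed
      then show "y \<in> h ` ?Q" using x by blast
    qed
    have pos: "det (mat 1 + s *\<^sub>R B x) > 0" for x
    proof -
      have "det (matrix ((*v) (mat 1 + s *\<^sub>R B x))) > 0"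
      proof (rule det_pos_of_pos)
        fix v :: "(real,'n) vec" assume v: "v \<noteq> 0"
        have "\<bar>v \<bullet> (B x *v v)\<bar> \<le> norm v * (K * norm v)"
          using Cauchy_Schwarz_ineq2[of v "B x *v v"] nB[of x v]
          by (meson mult_left_mono norm_ge_zero order_trans)
        then have "s * \<bar>v \<bullet> (B x *v v)\<bar> \<le> (s * K) * (v \<bullet> v)"
          using s mult_left_mono[of "\<bar>v \<bullet> (B x *v v)\<bar>" "norm v * (K * norm v)" s]
          by (simp add: power2_norm_eq_inner[symmetric] power2_eq_square mult_ac)
        also have "\<dots> < v \<bullet> v" using sK[OF s] v by simp
        finally have "s * \<bar>v \<bullet> (B x *v v)\<bar> < v \<bullet> v" .
        then have "\<bar>s * (v \<bullet> (B x *v v))\<bar> < v \<bullet> v" using s by (simp add: abs_mult)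
        then show "v \<bullet> ((mat 1 + s *\<^sub>R B x) *v v) > 0"
          by (simp add: matrix_vector_mult_add_rdistrib inner_add_right scaleR_matrix_vector_assoc[symmetric])
      qed simp
      then show ?thesis by simp
    qed
    have cdet: "continuous_on ?Q (\<lambda>x. det (mat 1 + s *\<^sub>R B x))"
      by (rule continuous_on_det, simp, intro continuous_intros continuous_on_subset[OF contB]) simp
    have eq: "(\<lambda>x. \<bar>det (matrix ((*v) (mat 1 + s *\<^sub>R B x)))\<bar>) = (\<lambda>x. det (mat 1 + s *\<^sub>R B x))"
      using pos by (auto simp: abs_of_pos)
    have "measure lebesgue (h ` ?Q) = integral ?Q (\<lambda>x. \<bar>det (matrix ((*v) (mat 1 + s *\<^sub>R B x)))\<bar>)"
    proof (rule measure_differentiable_image_eq)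
      show "?Q \<in> sets lebesgue" by simp
      show "inj_on h ?Q" by (rule inj_onI) (rule injh)
      show "(\<lambda>x. \<bar>det (matrix ((*v) (mat 1 + s *\<^sub>R B x)))\<bar>) integrable_on ?Q"
        unfolding eq by (rule integrable_continuous[OF cdet])
      show "(h has_derivative (*v) (mat 1 + s *\<^sub>R B x)) (at x within ?Q)" for x
        by (rule has_derivative_at_withinI[OF derh])
    qed
    then show ?thesis unfolding eq using \<open>h ` ?Q = ?Q\<close> by simp
  qed
  define c where "c x S = (\<Sum>p | p permutes UNIV. of_int (sign p) *
      ((\<Prod>i\<in>S. B x $ i $ p i) * (\<Prod>i\<in>UNIV - S. (mat 1 :: ((real,'n) vec,'n) vec) $ i $ p i)))" for x S
  have detc: "det (mat 1 + s *\<^sub>R B x) = (\<Sum>S\<in>Pow UNIV. s ^ card S * c x S)" for s x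
    unfolding c_def by (rule det_mat_plus_poly)
  have intc: "(\<lambda>x. c x S) integrable_on ?Q" for S
    unfolding c_def
    by (intro integrable_continuous continuous_intros continuous_on_subset[OF contB]) simp
  define d where "d k = (\<Sum>S | S \<in> Pow (UNIV :: 'n set) \<and> card S = k. integral ?Q (\<lambda>x. c x S))" for k
  have expand: "integral ?Q (\<lambda>x. det (mat 1 + s *\<^sub>R B x)) = (\<Sum>k\<le>CARD('n). d k * s ^ k)" for s
  proof -
    have "integral ?Q (\<lambda>x. det (mat 1 + s *\<^sub>R B x)) = (\<Sum>S\<in>Pow UNIV. s ^ card S * integral ?Q (\<lambda>x. c x S))"
      unfolding detc by (subst integral_sum) (auto intro: integrable_on_mult_right intc)
    also have "\<dots> = (\<Sum>k\<le>CARD('n). \<Sum>S | S \<in> Pow UNIV \<and> card S = k. s ^ card S * integral ?Q (\<lambda>x. c x S))"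
      by (rule sum.group[symmetric]) (auto intro: card_mono)
    also have "\<dots> = (\<Sum>k\<le>CARD('n). d k * s ^ k)"
      unfolding d_def by (intro sum.cong refl) (simp add: sum_distrib_left mult.commute)
    finally show ?thesis .
  qed
  have "(\<Sum>k\<le>CARD('n). d k) = measure lebesgue ?Q"
    by (rule poly_eq_const_of_small[OF s0]) (use small expand in simp)
  then show ?thesis using expand[of 1] by (simp add: B_def)
qed

text \<open>The integrand is twice the negative part of the determinant. The area inequality,
  applied to \<open>V\<close> and to the rest of the box separately, shows that the absolute
  determinant integrates to at least the volume of \<open>W\<close> plus that of the box; the signed
  determinant integrates to exactly the latter.\<close>

lemma measure_le_integral_negative_part:
  fixes g :: "(real,'n::{finite,wellorder}) vec \<Rightarrow> (real,'n) vec" and A :: "(real,'n) vec \<Rightarrow> ((real,'n) vec,'n) vec"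
  assumes der: "\<And>x. (g has_derivative (*v) (A x)) (at x)"
    and cont: "\<And>i j. continuous_on UNIV (\<lambda>x. A x $ i $ j)"
    and out: "\<And>x. x \<notin> cbox a b \<Longrightarrow> g x = x"
    and V: "compact V" "V \<subseteq> cbox a b" and W: "W \<in> lmeasurable" "W \<subseteq> g ` V"
    and cover: "cbox a b \<subseteq> g ` (cbox a b - V)"
  shows "measure lebesgue W \<le> integral (cbox a b) (\<lambda>x. \<bar>det (A x)\<bar> - det (A x))"
proof -
  let ?Q = "cbox a b" and ?d = "\<lambda>x. \<bar>det (A x)\<bar>"
  have cdet: "continuous_on ?Q (\<lambda>x. det (A x))"
    by (rule continuous_on_det, rule continuous_on_subset[OF cont]) simp
  then have "?d absolutely_integrable_on ?Q"
    by (intro absolutely_integrable_continuous continuous_on_rabs)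
  then have int: "?d absolutely_integrable_on S" if "S \<in> sets lebesgue" "S \<subseteq> ?Q" for S
    using set_integrable_subset that by blast
  have V': "V \<in> sets lebesgue" using V(1) by (simp add: lmeasurable_compact fmeasurableD)
  have sub: "g ` S \<in> lmeasurable \<and> measure lebesgue (g ` S) \<le> integral S ?d"
    if S: "S \<in> sets lebesgue" "S \<subseteq> ?Q" for S
  proof -
    have i: "(\<lambda>x. \<bar>det (matrix ((*v) (A x)))\<bar>) integrable_on S"
      using int[OF S] by (simp add: absolutely_integrable_on_def)
    have d: "(g has_derivative (*v) (A x)) (at x within S)" for x
      by (rule has_derivative_at_withinI[OF der])
    show ?thesis
      using measurable_differentiable_image[OF S(1) d i] measure_differentiable_image[OF S(1) d i] by simp
  qed
  have "measure lebesgue W \<le> integral V ?d"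
    using sub[OF V' V(2)] measure_mono_fmeasurable[OF W(2) fmeasurableD[OF W(1)]] by simp
  moreover have "measure lebesgue ?Q \<le> integral (?Q - V) ?d"
    using sub[of "?Q - V"] sets.Diff[OF fmeasurableD[OF lmeasurable_cbox] V', of a b] measure_mono_fmeasurable[OF cover, of lebesgue] by simp
  moreover have "integral (V \<union> (?Q - V)) ?d = integral V ?d + integral (?Q - V) ?d"
    using int[OF V' V(2)] int[of "?Q - V"] V'
    by (intro integral_Un) (auto simp: absolutely_integrable_on_def sets.Diff)
  moreover have "V \<union> (?Q - V) = ?Q" using V(2) by blast
  moreover have "integral ?Q (\<lambda>x. det (A x)) = measure lebesgue ?Q"
    by (rule integral_det_eq_content[OF der cont out])
  moreover have "integral ?Q (\<lambda>x. ?d x - det (A x)) = integral ?Q ?d - integral ?Q (\<lambda>x. det (A x))"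
    by (intro integral_diff integrable_continuous continuous_on_rabs cdet)
  ultimately show ?thesis by simp
qed

section \<open>Difference quotients in \<open>L\<^sup>2\<close>\<close>

definition csupp :: "('a::topological_space \<Rightarrow> real) \<Rightarrow> bool"
  where "csupp f \<longleftrightarrow> continuous_on UNIV f \<and> (\<exists>K. compact K \<and> (\<forall>x. x \<notin> K \<longrightarrow> f x = 0))"

lemma csupp_continuous: "csupp f \<Longrightarrow> continuous_on UNIV f" by (simp add: csupp_def)

lemma csuppI: "continuous_on UNIV f \<Longrightarrow> compact K \<Longrightarrow> (\<And>x. x \<notin> K \<Longrightarrow> f x = 0) \<Longrightarrow> csupp f"
  unfolding csupp_def by (intro conjI exI[of _ K]) simp_all

lemma csupp_combine:
  assumes f: "csupp f" and g: "csupp g" and h: "continuous_on UNIV (\<lambda>x. h (f x) (g x))" "h 0 0 = 0"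
  shows "csupp (\<lambda>x. h (f x) (g x))"
proof -
  obtain K1 K2 where "compact K1" "\<And>x. x \<notin> K1 \<Longrightarrow> f x = 0" "compact K2" "\<And>x. x \<notin> K2 \<Longrightarrow> g x = 0"
    using f g unfolding csupp_def by blast
  then show ?thesis using h by (intro csuppI[of _ "K1 \<union> K2"]) (auto simp: compact_Un)
qed

lemma csupp_add: "csupp f \<Longrightarrow> csupp g \<Longrightarrow> csupp (\<lambda>x. f x + g x)"
  using csupp_combine[of f g "(+)"] by (simp add: csupp_continuous continuous_on_add)
lemma csupp_diff: "csupp f \<Longrightarrow> csupp g \<Longrightarrow> csupp (\<lambda>x. f x - g x)"
  using csupp_combine[of f g "(-)"] by (simp add: csupp_continuous continuous_on_diff)
lemma csupp_mult: "csupp f \<Longrightarrow> csupp g \<Longrightarrow> csupp (\<lambda>x. f x * g x)"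
  using csupp_combine[of f g "(*)"] by (simp add: csupp_continuous continuous_on_mult)
lemma csupp_scale: "csupp f \<Longrightarrow> csupp (\<lambda>x. c * f x)"
  using csupp_combine[of f f "\<lambda>x y. c * x"]
  by (simp add: csupp_continuous continuous_on_mult continuous_on_const)
lemma csupp_divide: "csupp f \<Longrightarrow> csupp (\<lambda>x. f x / c)"
  using csupp_scale[of f "inverse c"] by (simp add: field_simps)
lemma csupp_square: "csupp f \<Longrightarrow> csupp (\<lambda>x. (f x)\<^sup>2)"
  using csupp_mult[of f f] by (simp add: power2_eq_square)
lemma csupp_zero: "csupp (\<lambda>x. 0)" by (rule csuppI[of _ "{}"]) auto
lemma csupp_sum: "finite I \<Longrightarrow> (\<And>i. i \<in> I \<Longrightarrow> csupp (f i)) \<Longrightarrow> csupp (\<lambda>x. \<Sum>i\<in>I. f i x)"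
proof (induction I rule: finite_induct)
  case empty
  show ?case by (simp add: csupp_zero)
next
  case (insert i I)
  have "csupp (\<lambda>x. f i x + (\<Sum>i\<in>I. f i x))"
    by (rule csupp_add) (use insert in auto)
  then show ?case using insert.hyps by simp
qed

lemma csupp_integrable:
  fixes f :: "'a::euclidean_space \<Rightarrow> real"
  assumes "csupp f" shows "f integrable_on UNIV"
proof -
  obtain K where K: "compact K" "\<And>x. x \<notin> K \<Longrightarrow> f x = 0" using assms unfolding csupp_def by blast
  obtain a where ab: "K \<subseteq> cbox (- a) a"
    using bounded_subset_cbox_symmetric[OF compact_imp_bounded[OF K(1)]] by blast
  have "f integrable_on cbox (- a) a"
    by (rule integrable_continuous, rule continuous_on_subset[OF csupp_continuous[OF assms]]) simp
  then show ?thesis by (rule integrable_on_superset) (use K(2) ab in auto)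
qed

lemma csupp_absolutely_integrable:
  fixes f :: "'a::euclidean_space \<Rightarrow> real"
  assumes "csupp f" shows "f absolutely_integrable_on UNIV"
proof -
  have "csupp (\<lambda>x. \<bar>f x\<bar>)"
    using csupp_combine[OF assms assms, of "\<lambda>x y. \<bar>x\<bar>"] csupp_continuous[OF assms]
    by (simp add: continuous_on_rabs)
  then show ?thesis using assms by (simp add: absolutely_integrable_on_def csupp_integrable)
qed

lemma csupp_integral_bound:
  fixes f :: "'a::euclidean_space \<Rightarrow> real"
  assumes f: "csupp f" and K: "compact K" "\<And>x. x \<notin> K \<Longrightarrow> f x = 0" and c: "\<And>x. f x \<le> c"
  shows "integral UNIV f \<le> c * measure lebesgue K"
proof -
  have Kl: "K \<in> lmeasurable" using K(1) by (rule lmeasurable_compact)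
  have "integral UNIV f \<le> integral UNIV (\<lambda>x. c * indicator K x)"
  proof (rule integral_le[OF csupp_integrable[OF f]])
    show "(\<lambda>x. c * indicator K x :: real) integrable_on UNIV"
      using Kl by (intro integrable_on_mult_right) (simp add: integrable_on_indicator)
    show "f x \<le> c * indicator K x" for x using c[of x] K(2)[of x] by (auto simp: indicator_def)
  qed
  also have "\<dots> = c * measure lebesgue K"
    using lmeasure_integral_UNIV[OF Kl] by simp
  finally show ?thesis .
qed

lemma csupp_integral_mono:
  fixes f :: "'a::euclidean_space \<Rightarrow> real"
  shows "csupp f \<Longrightarrow> csupp g \<Longrightarrow> (\<And>x. f x \<le> g x) \<Longrightarrow> integral UNIV f \<le> integral UNIV g"
  by (rule integral_le) (auto intro: csupp_integrable)

lemma integral_affine_invariant: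
  fixes f :: "(real, 'n::{finite,wellorder}) vec \<Rightarrow> real"
  assumes f: "csupp f" and der: "\<And>x. (g has_derivative g') (at x)" and det: "\<bar>det (matrix g')\<bar> = 1"
    and inj: "inj g" and surj: "surj g"
  shows "integral UNIV (\<lambda>x. f (g x)) = integral UNIV f"
proof -
  have "(\<lambda>x. vec (f x) :: real^1) absolutely_integrable_on g ` UNIV"
    using csupp_absolutely_integrable[OF f] surj by (simp add: absolutely_integrable_on_1_iff)
  then have "integral (g ` UNIV) (\<lambda>x. vec (f x) :: real^1) =
      integral UNIV (\<lambda>x. \<bar>det (matrix g')\<bar> *\<^sub>R (vec (f (g x)) :: real^1))"
    by (intro integral_change_of_variables) (use der inj in auto)
  then show ?thesis using det surj by (simp add: integral_on_1_eq vec_eq_iff)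
qed

context heis_coords begin

text \<open>Conjugation by \<open>dil 2\<close> turns the shear \<open>f 1\<close> into
  \<open>f 2\<close>, the composition of \<open>f 1\<close> with itself, so the nonzero determinant
  of \<open>f 1\<close> equals its own square.\<close>

lemma det_shear: "det (matrix (\<lambda>h. h + om h a *\<^sub>R axis tau 1)) = 1"
proof -
  define f where "f s h = h + (s * om h a) *\<^sub>R axis tau 1" for s :: real and h
  have lin: "linear (f s)" for s
    unfolding f_def by (rule linearI) (simp_all add: om_simps algebra_simps)
  have ff: "f s \<circ> f t = f (s + t)" for s t
    by (rule ext) (simp add: f_def om_simps algebra_simps)
  have fd: "dil 2 \<circ> f 1 = f 2 \<circ> dil 2"
  proof
    fix h
    have "om (dil 2 h) a = 2 * om h a"
      using om_hor(1)[of "dil 2 h" a] by (simp only: hor_dil om_scale_left om_hor)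
    then show "(dil 2 \<circ> f 1) h = (f 2 \<circ> dil 2) h"
      by (simp add: f_def vec_eq_iff dil_def axis_def)
  qed
  have "inj (dil 2)" by (rule inj_on_inverseI[of _ "dil (1/2)"]) simp
  then have d: "det (matrix (dil 2)) \<noteq> 0" using det_nz_iff_inj[OF linear_dil] by blast
  have "inj (f 1)"
  proof (rule injI)
    fix x y assume "f 1 x = f 1 y"
    then have "(f (-1) \<circ> f 1) x = (f (-1) \<circ> f 1) y" by simp
    then show "x = y" unfolding ff by (simp add: f_def)
  qed
  then have d1: "det (matrix (f 1)) \<noteq> 0" using det_nz_iff_inj[OF lin] by blast
  have "det (matrix (dil 2)) * det (matrix (f 1)) = det (matrix (f 2)) * det (matrix (dil 2))"
    using arg_cong[OF fd, of "\<lambda>f. det (matrix f)"]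
    by (simp add: matrix_compose[OF lin linear_dil] matrix_compose[OF linear_dil lin] det_mul)
  moreover have "det (matrix (f 2)) = det (matrix (f 1)) * det (matrix (f 1))"
    using arg_cong[OF ff[of 1 1], of "\<lambda>f. det (matrix f)"] by (simp add: matrix_compose[OF lin lin] det_mul)
  ultimately have "det (matrix (f 1)) = 1" using d d1 by simp
  then show ?thesis by (simp add: f_def[abs_def])
qed

lemma integral_right_translation:
  assumes "csupp f" shows "integral UNIV (\<lambda>p. f (p \<odot> a)) = integral UNIV f"
proof (rule integral_affine_invariant[OF assms, where g' = "\<lambda>h. h + om h (2 *\<^sub>R a) *\<^sub>R axis tau 1"])
  show "((\<lambda>p. p \<odot> a) has_derivative (\<lambda>h. h + om h (2 *\<^sub>R a) *\<^sub>R axis tau 1)) (at x)" for x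
    unfolding mul_def om_scale_right
    by (rule has_derivative_eq_rhs)
      (auto intro!: derivative_eq_intros bounded_bilinear.FDERIV[OF bounded_bilinear_om])
  show "inj (\<lambda>p. p \<odot> a)" by (rule inj_on_inverseI[of _ "\<lambda>p. p \<odot> (- a)"]) (simp add: mul_assoc)
  show "surj (\<lambda>p. p \<odot> a)" by (rule surjI[of _ "\<lambda>p. p \<odot> (- a)"]) (simp add: mul_assoc)
qed (simp add: det_shear)

lemma csupp_translate: assumes "csupp f" shows "csupp (\<lambda>p. f (p \<odot> a))"
proof -
  obtain K where K: "compact K" "\<And>x. x \<notin> K \<Longrightarrow> f x = 0" using assms unfolding csupp_def by blast
  show ?thesis
  proof (rule csuppI[where K = "(\<lambda>p. p \<odot> (- a)) ` K"])
    show "continuous_on UNIV (\<lambda>p. f (p \<odot> a))"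
      by (rule continuous_on_compose2[OF csupp_continuous[OF assms]]) (intro continuous_intros, simp)
    show "compact ((\<lambda>p. p \<odot> (- a)) ` K)"
      by (rule compact_continuous_image[OF _ K(1)]) (intro continuous_intros)
    fix x assume "x \<notin> (\<lambda>p. p \<odot> (- a)) ` K"
    moreover have "x = (\<lambda>p. p \<odot> (- a)) (x \<odot> a)" by (simp add: mul_assoc)
    ultimately have "x \<odot> a \<notin> K" by (metis image_eqI)
    then show "f (x \<odot> a) = 0" by (rule K(2))
  qed
qed

lemma translates_vanish:
  assumes "compact K" "compact T"
  obtains K' where "compact K'" "\<And>p a. a \<in> T \<Longrightarrow> p \<notin> K' \<Longrightarrow> p \<odot> a \<notin> K"
proof
  show "compact ((\<lambda>(p, a). p \<odot> (- a)) ` (K \<times> T))"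
    by (rule compact_continuous_image[OF _ compact_Times[OF assms]])
      (simp add: case_prod_unfold, intro continuous_intros)
  fix p a assume "a \<in> T" "p \<notin> (\<lambda>(p, a). p \<odot> (- a)) ` (K \<times> T)"
  moreover have "(\<lambda>(p, a). p \<odot> (- a)) (p \<odot> a, a) = p" by (simp add: mul_assoc)
  ultimately show "p \<odot> a \<notin> K" using imageI[of "(p \<odot> a, a)" "K \<times> T"] by (metis SigmaI)
qed

end

section \<open>Telescoping difference quotients and the loss of energy\<close>

lemma sum_pairwise_diff_squared:
  fixes x :: "nat \<Rightarrow> real"
  shows "(\<Sum>i<n. \<Sum>j<n. (x i - x j)\<^sup>2) = 2 * real n * (\<Sum>i<n. (x i)\<^sup>2) - 2 * (\<Sum>i<n. x i)\<^sup>2"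
proof -
  have "(\<Sum>i<n. \<Sum>j<n. (x i - x j)\<^sup>2) = (\<Sum>i<n. \<Sum>j<n. ((x i)\<^sup>2 + (x j)\<^sup>2) - 2 * (x i * x j))"
    by (intro sum.cong refl) (simp add: power2_diff algebra_simps)
  also have "\<dots> = 2 * real n * (\<Sum>i<n. (x i)\<^sup>2) - 2 * (\<Sum>i<n. \<Sum>j<n. x i * x j)"
    by (simp add: sum_subtractf sum.distrib sum_distrib_left[symmetric])
  finally show ?thesis by (simp add: power2_eq_square sum_product)
qed

lemma sum_squared_le_card:
  fixes x :: "nat \<Rightarrow> real"
  shows "(\<Sum>i<n. x i)\<^sup>2 \<le> real n * (\<Sum>i<n. (x i)\<^sup>2)"
proof -
  have "0 \<le> (\<Sum>i<n. \<Sum>j<n. (x i - x j)\<^sup>2)" by (intro sum_nonneg) auto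
  then show ?thesis unfolding sum_pairwise_diff_squared by simp
qed

lemma integral_csupp_sum:
  fixes f :: "'i \<Rightarrow> 'a::euclidean_space \<Rightarrow> real"
  shows "finite I \<Longrightarrow> (\<And>i. i \<in> I \<Longrightarrow> csupp (f i)) \<Longrightarrow>
    integral UNIV (\<lambda>x. \<Sum>i\<in>I. f i x) = (\<Sum>i\<in>I. integral UNIV (f i))"
  by (rule integral_sum) (auto intro: csupp_integrable)

context heis_coords begin

text \<open>Taken along right translations: these preserve integrals and, for horizontal
  \<open>e\<close>, follow the left-invariant horizontal fields.\<close>

definition dq :: "('N pt \<Rightarrow> real) \<Rightarrow> 'N pt \<Rightarrow> real \<Rightarrow> 'N pt \<Rightarrow> real"
  where "dq u e r p = (u (p \<odot> r *\<^sub>R e) - u p) / r"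

lemma mul_same_direction: "(p \<odot> a *\<^sub>R e) \<odot> b *\<^sub>R e = p \<odot> (a + b) *\<^sub>R e"
proof -
  have "a *\<^sub>R e \<odot> b *\<^sub>R e = (a + b) *\<^sub>R e" by (simp add: mul_def om_simps algebra_simps)
  then show ?thesis by (simp add: mul_assoc)
qed

lemma csupp_dq: "csupp u \<Longrightarrow> csupp (dq u e r)"
  unfolding dq_def[abs_def] by (intro csupp_divide csupp_diff csupp_translate)

definition energy :: "('N pt \<Rightarrow> real) \<Rightarrow> 'N pt \<Rightarrow> real \<Rightarrow> real"
  where "energy u e r = integral UNIV (\<lambda>p. (dq u e r p)\<^sup>2)"

lemma sum_dq:
  assumes "r > 0"
  shows "(\<Sum>i<n. dq u e r (p \<odot> (real i * r) *\<^sub>R e)) = real n * dq u e (real n * r) p"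
proof -
  have "dq u e r (p \<odot> (real i * r) *\<^sub>R e) =
      u (p \<odot> (real (Suc i) * r) *\<^sub>R e) / r - u (p \<odot> (real i * r) *\<^sub>R e) / r" for i
    by (simp add: dq_def mul_same_direction diff_divide_distrib algebra_simps)
  then have "(\<Sum>i<n. dq u e r (p \<odot> (real i * r) *\<^sub>R e)) =
      (\<Sum>i<n. u (p \<odot> (real (Suc i) * r) *\<^sub>R e) / r - u (p \<odot> (real i * r) *\<^sub>R e) / r)"
    by (simp only:)
  also have "\<dots> = u (p \<odot> (real n * r) *\<^sub>R e) / r - u p / r"
    by (subst sum_lessThan_telescope) simp
  also have "\<dots> = real n * dq u e (real n * r) p"
    using assms by (cases "n = 0") (auto simp: dq_def field_simps)
  finally show ?thesis .
qed

text \<open>Averages of translates lose energy, and the loss controls the distance to the average.\<close>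

lemma integral_dq_diff_le:
  assumes u: "csupp u" and r: "r > 0" and M: "M \<ge> (1::nat)"
  shows "integral UNIV (\<lambda>p. (dq u e (real M * r) p - dq u e r p)\<^sup>2)
    \<le> 8 * (energy u e r - energy u e (2 * real M * r))"
proof -
  define x where "x i p = dq u e r (p \<odot> (real i * r) *\<^sub>R e)" for i p
  have cx: "csupp (x i)" for i
    unfolding x_def[abs_def] by (intro csupp_translate csupp_dq u)
  have x_shift: "x i (p \<odot> (real k * r) *\<^sub>R e) = x (k + i) p" for i k p
    by (simp add: x_def mul_same_direction algebra_simps)
  have x0: "x 0 p = dq u e r p" for p by (simp add: x_def)
  have E: "integral UNIV (\<lambda>p. (x i p)\<^sup>2) = energy u e r" for i
    unfolding x_def energy_def
    by (rule integral_right_translation[where f = "\<lambda>p. (dq u e r p)\<^sup>2"]) (intro csupp_square csupp_dq u)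
  define a where "a k = integral UNIV (\<lambda>p. (x k p - x 0 p)\<^sup>2)" for k
  have ca: "csupp (\<lambda>p. (x i p - x j p)\<^sup>2)" for i j by (intro csupp_square csupp_diff cx)
  have a: "integral UNIV (\<lambda>p. (x (i + k) p - x i p)\<^sup>2) = a k" for i k
    using integral_right_translation[OF ca[of k 0], of "(real i * r) *\<^sub>R e"] by (simp add: a_def x_shift)
  have a0: "a k \<ge> 0" for k unfolding a_def by (rule integral_nonneg) (auto intro: csupp_integrable ca)
  let ?n = "2 * M"
  have "(\<Sum>i<?n. \<Sum>j<?n. integral UNIV (\<lambda>p. (x i p - x j p)\<^sup>2)) =
      integral UNIV (\<lambda>p. \<Sum>i<?n. \<Sum>j<?n. (x i p - x j p)\<^sup>2)"
    by (subst integral_csupp_sum, simp, intro csupp_sum ca, simp)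
      (intro sum.cong refl, subst integral_csupp_sum, auto intro: ca)
  also have "\<dots> = integral UNIV (\<lambda>p. 2 * real ?n * (\<Sum>i<?n. (x i p)\<^sup>2) - 2 * (\<Sum>i<?n. x i p)\<^sup>2)"
    by (simp only: sum_pairwise_diff_squared)
  also have "\<dots> = integral UNIV (\<lambda>p. 2 * real ?n * (\<Sum>i<?n. (x i p)\<^sup>2)) - integral UNIV (\<lambda>p. 2 * (\<Sum>i<?n. x i p)\<^sup>2)"
    by (intro integral_diff csupp_integrable csupp_scale csupp_sum csupp_square cx finite_lessThan)
  also have "integral UNIV (\<lambda>p. 2 * real ?n * (\<Sum>i<?n. (x i p)\<^sup>2)) = 2 * real ?n * (real ?n * energy u e r)"
    by (simp add: integral_csupp_sum csupp_square cx E)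
  also have "(\<lambda>p. 2 * (\<Sum>i<?n. x i p)\<^sup>2) = (\<lambda>p. 2 * (real ?n)\<^sup>2 * (dq u e (real ?n * r) p)\<^sup>2)"
    unfolding x_def sum_dq[OF r] by (simp add: power_mult_distrib mult.assoc)
  also have "integral UNIV \<dots> = 2 * (real ?n)\<^sup>2 * energy u e (2 * real M * r)"
    by (simp add: energy_def)
  finally have double: "(\<Sum>i<?n. \<Sum>j<?n. integral UNIV (\<lambda>p. (x i p - x j p)\<^sup>2)) =
      8 * (real M)\<^sup>2 * (energy u e r - energy u e (2 * real M * r))"
    by (simp add: power2_eq_square algebra_simps)
  \<comment> \<open>By translation invariance each pair \<open>(i, i + k)\<close> contributes
    \<open>a k\<close>, and these pairs are among those counted in the double sum.\<close>
  have "real M * (\<Sum>k<M. a k) = (\<Sum>i<M. \<Sum>k<M. a k)" by simp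
  also have "\<dots> \<le> (\<Sum>i<M. \<Sum>j<?n. integral UNIV (\<lambda>p. (x i p - x j p)\<^sup>2))"
  proof (rule sum_mono)
    fix i assume i: "i \<in> {..<M}"
    have "(\<Sum>k<M. a k) = (\<Sum>k\<in>{..<M}. integral UNIV (\<lambda>p. (x i p - x (i + k) p)\<^sup>2))"
    proof (rule sum.cong[OF refl])
      fix k
      have "(\<lambda>p. (x i p - x (i + k) p)\<^sup>2) = (\<lambda>p. (x (i + k) p - x i p)\<^sup>2)"
        by (rule ext) (rule power2_commute)
      then show "a k = integral UNIV (\<lambda>p. (x i p - x (i + k) p)\<^sup>2)" using a[of i k] by simp
    qed
    also have "\<dots> = (\<Sum>j\<in>(+) i ` {..<M}. integral UNIV (\<lambda>p. (x i p - x j p)\<^sup>2))"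
      by (subst sum.reindex) auto
    also have "\<dots> \<le> (\<Sum>j<?n. integral UNIV (\<lambda>p. (x i p - x j p)\<^sup>2))"
      by (rule sum_mono2) (use i in \<open>auto intro!: integral_nonneg csupp_integrable ca\<close>)
    finally show "(\<Sum>k<M. a k) \<le> (\<Sum>j<?n. integral UNIV (\<lambda>p. (x i p - x j p)\<^sup>2))" .
  qed
  also have "\<dots> \<le> (\<Sum>i<?n. \<Sum>j<?n. integral UNIV (\<lambda>p. (x i p - x j p)\<^sup>2))"
    by (rule sum_mono2) (auto intro!: sum_nonneg integral_nonneg csupp_integrable ca)
  finally have B: "real M * (\<Sum>k<M. a k) \<le> 8 * (real M)\<^sup>2 * (energy u e r - energy u e (2 * real M * r))"
    unfolding double .
  then have A: "(\<Sum>k<M. a k) \<le> 8 * real M * (energy u e r - energy u e (2 * real M * r))"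
  proof -
    have "real M * (\<Sum>k<M. a k) \<le> real M * (8 * real M * (energy u e r - energy u e (2 * real M * r)))"
      using B by (simp add: power2_eq_square mult_ac)
    then show ?thesis using M by (subst (asm) mult_le_cancel_left_pos) auto
  qed
  have "integral UNIV (\<lambda>p. (dq u e (real M * r) p - dq u e r p)\<^sup>2) \<le>
      integral UNIV (\<lambda>p. 1 / real M * (\<Sum>k<M. (x k p - x 0 p)\<^sup>2))"
  proof (rule csupp_integral_mono)
    show "csupp (\<lambda>p. (dq u e (real M * r) p - dq u e r p)\<^sup>2)"
      by (intro csupp_square csupp_diff csupp_dq u)
    show "csupp (\<lambda>p. 1 / real M * (\<Sum>k<M. (x k p - x 0 p)\<^sup>2))"
      by (intro csupp_scale csupp_sum ca finite_lessThan)
    fix p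
    have "real M * dq u e (real M * r) p = (\<Sum>k<M. x k p)" unfolding x_def sum_dq[OF r] ..
    then have "real M * (dq u e (real M * r) p - dq u e r p) = (\<Sum>k<M. x k p - x 0 p)"
      by (simp add: sum_subtractf x0 algebra_simps)
    then have B2: "(real M)\<^sup>2 * (dq u e (real M * r) p - dq u e r p)\<^sup>2 \<le> real M * (\<Sum>k<M. (x k p - x 0 p)\<^sup>2)"
      using sum_squared_le_card[of "\<lambda>k. x k p - x 0 p" M] by (simp add: power_mult_distrib[symmetric])
    show "(dq u e (real M * r) p - dq u e r p)\<^sup>2 \<le> 1 / real M * (\<Sum>k<M. (x k p - x 0 p)\<^sup>2)"
    proof -
      have "real M * (real M * (dq u e (real M * r) p - dq u e r p)\<^sup>2) \<le> real M * (\<Sum>k<M. (x k p - x 0 p)\<^sup>2)"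
        using B2 by (simp add: power2_eq_square mult.assoc)
      then have "real M * (dq u e (real M * r) p - dq u e r p)\<^sup>2 \<le> (\<Sum>k<M. (x k p - x 0 p)\<^sup>2)"
        using M by (subst (asm) mult_le_cancel_left_pos) auto
      then show ?thesis using M by (simp add: pos_le_divide_eq mult.commute)
    qed
  qed
  also have "\<dots> = 1 / real M * (\<Sum>k<M. a k)"
    by (simp add: integral_csupp_sum ca a_def)
  also have "\<dots> \<le> 1 / real M * (8 * real M * (energy u e r - energy u e (2 * real M * r)))"
    by (intro mult_left_mono A) simp
  finally show ?thesis using M by simp
qed

section \<open>Convergence in L^2 of the horizontal difference quotients of a Lipschitz
  function\<close>

context
  fixes u :: "'N pt \<Rightarrow> real" and e :: "'N pt" and L :: real
  assumes u: "csupp u" and L: "L \<ge> 0" and lip: "\<And>p q. \<bar>u (p \<odot> q) - u p\<bar> \<le> L * nrm q"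
    and e: "hor e = e"
begin

lemma nrm_horizontal: "r \<ge> 0 \<Longrightarrow> nrm (r *\<^sub>R e) = r * norm e"
proof -
  assume r: "r \<ge> 0"
  have "e $ tau = 0" using hor_nth(1)[of e] e by simp
  then show ?thesis using r e by (simp add: nrm_def hor_scale)
qed

lemma dq_bound: "r > 0 \<Longrightarrow> \<bar>dq u e r p\<bar> \<le> L * norm e"
  using lip[of p "r *\<^sub>R e"] nrm_horizontal[of r] by (simp add: dq_def field_simps)

text \<open>The quotient at \<open>s\<close> is a weighted mean of the quotient at \<open>s'\<close>
  and one over the remaining length, both bounded by \<open>L * norm e\<close>. Only the relative
  change of scale counts, which absorbs the rounding of one scale to a multiple of another.\<close>

lemma dq_close:
  assumes "0 < s'" "s' \<le> s"
  shows "\<bar>dq u e s p - dq u e s' p\<bar> \<le> 2 * (L * norm e) * (s - s') / s"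
proof -
  have "u (p \<odot> s *\<^sub>R e) - u (p \<odot> s' *\<^sub>R e) = u ((p \<odot> s' *\<^sub>R e) \<odot> (s - s') *\<^sub>R e) - u (p \<odot> s' *\<^sub>R e)"
    by (simp add: mul_same_direction)
  then have 1: "\<bar>u (p \<odot> s *\<^sub>R e) - u (p \<odot> s' *\<^sub>R e)\<bar> \<le> L * norm e * (s - s')"
    using lip[of "p \<odot> s' *\<^sub>R e" "(s - s') *\<^sub>R e"] nrm_horizontal[of "s - s'"] assms by (simp add: mult_ac)
  have 2: "\<bar>(s - s') * dq u e s' p\<bar> \<le> L * norm e * (s - s')"
    using dq_bound[of s' p] assms mult_left_mono[of "\<bar>dq u e s' p\<bar>" "L * norm e" "s - s'"]
    by (simp add: abs_mult mult_ac)
  have "s * (dq u e s p - dq u e s' p) = (u (p \<odot> s *\<^sub>R e) - u (p \<odot> s' *\<^sub>R e)) - (s - s') * dq u e s' p"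
    using assms by (simp add: dq_def field_simps)
  then have "\<bar>s * (dq u e s p - dq u e s' p)\<bar> \<le> 2 * (L * norm e) * (s - s')" using 1 2 by linarith
  then have "s * \<bar>dq u e s p - dq u e s' p\<bar> \<le> 2 * (L * norm e) * (s - s')"
    using assms by (simp only: abs_mult)
  then show ?thesis using assms by (simp add: pos_le_divide_eq mult.commute)
qed

lemma dq_support:
  obtains K where "compact K" "\<And>r p. 0 < r \<Longrightarrow> r \<le> 1 \<Longrightarrow> p \<notin> K \<Longrightarrow> dq u e r p = 0"
proof -
  obtain K where K: "compact K" "\<And>x. x \<notin> K \<Longrightarrow> u x = 0" using u unfolding csupp_def by blast
  have "compact ((\<lambda>r. r *\<^sub>R e) ` {0..1::real})"
    by (rule compact_continuous_image) (auto intro!: continuous_intros)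
  from translates_vanish[OF K(1) this] obtain K' where K': "compact K'"
    "\<And>p a. a \<in> (\<lambda>r. r *\<^sub>R e) ` {0..1::real} \<Longrightarrow> p \<notin> K' \<Longrightarrow> p \<odot> a \<notin> K" by blast
  have "dq u e r p = 0" if "0 < r" "r \<le> 1" "p \<notin> K'" for r p
  proof -
    have "p \<odot> t *\<^sub>R e \<notin> K" if "t \<in> {0..1}" for t
      by (rule K'(2)[OF imageI[OF that] \<open>p \<notin> K'\<close>])
    from this[of r] this[of 0] have "p \<odot> r *\<^sub>R e \<notin> K" "p \<notin> K" using that by simp_all
    then show ?thesis using K(2) by (simp add: dq_def)
  qed
  then show ?thesis using that K'(1) by blast
qed

text \<open>The energy is bounded, so some scale \<open>r1\<close> almost attains its supremum. For
  small \<open>r\<close> a multiple \<open>2 * real M * r\<close> is close to \<open>r1\<close>,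
  hence passing from \<open>r\<close> to it loses almost no energy, and
  \<open>integral_dq_diff_le\<close> brings the quotients at \<open>r\<close> and at
  \<open>real M * r\<close>, about half of \<open>r1\<close>, close together.\<close>

lemma dq_L2_Cauchy:
  assumes "\<epsilon> > 0"
  obtains \<rho> \<delta> where "0 < \<rho>" "\<rho> \<le> 1" "0 < \<delta>" "\<delta> \<le> 1"
    "\<And>r. 0 < r \<Longrightarrow> r < \<delta> \<Longrightarrow> integral UNIV (\<lambda>p. (dq u e r p - dq u e \<rho> p)\<^sup>2) \<le> \<epsilon>"
proof -
  obtain K where K: "compact K" "\<And>r p. 0 < r \<Longrightarrow> r \<le> 1 \<Longrightarrow> p \<notin> K \<Longrightarrow> dq u e r p = 0"
    using dq_support by blast
  define V where "V = measure lebesgue K"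
  define C where "C = L * norm e"
  have C: "C \<ge> 0" using L by (simp add: C_def)
  have V: "V \<ge> 0" by (simp add: V_def)
  have cs: "csupp (\<lambda>p. (dq u e r p)\<^sup>2)" for r by (intro csupp_square csupp_dq u)
  have cs2: "csupp (\<lambda>p. (dq u e r p - dq u e s p)\<^sup>2)" for r s by (intro csupp_square csupp_diff csupp_dq u)
  have Ebd: "energy u e r \<le> C\<^sup>2 * V" if "0 < r" "r \<le> 1" for r
    unfolding energy_def V_def
  proof (rule csupp_integral_bound[OF cs K(1)])
    show "(dq u e r p)\<^sup>2 \<le> C\<^sup>2" for p
      using dq_bound[OF that(1), of p] C unfolding C_def[symmetric] by (simp add: abs_le_square_iff[symmetric])
  qed (use K(2) that in auto)
  define S where "S = (SUP r\<in>{0<..1}. energy u e r)"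
  have bdd: "bdd_above (energy u e ` {0<..1})" using Ebd by (auto intro!: bdd_aboveI2)
  have ES: "energy u e r \<le> S" if "0 < r" "r \<le> 1" for r
    unfolding S_def by (rule cSUP_upper[OF _ bdd]) (use that in auto)
  \<comment> \<open>One share of \<open>\<epsilon> / 64\<close> for the supremum and one for the
    rounding of scales; multiplied by the factor 8 of \<open>integral_dq_diff_le\<close> they make
    \<open>\<epsilon> / 4\<close>.\<close>
  have "\<exists>x\<in>energy u e ` {0<..1}. S - \<epsilon> / 64 < x"
    unfolding S_def by (rule less_cSupD) (use assms in \<open>auto intro!: exI[of _ "1::real"]\<close>)
  then obtain r1 where r1: "0 < r1" "r1 \<le> 1" "energy u e r1 > S - \<epsilon> / 64" by auto
  \<comment> \<open>Half of \<open>r1\<close>, since the energy estimate for the quotient over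
    \<open>M\<close> steps involves the energy over \<open>2 * M\<close> steps.\<close>
  define \<rho> where "\<rho> = r1 / 2"
  have \<rho>: "0 < \<rho>" "\<rho> \<le> 1" using r1 by (auto simp: \<rho>_def)
  define H where "H = 4 * C\<^sup>2 * V + 1"
  have H: "H > 0" using V by (simp add: H_def add_nonneg_pos)
  \<comment> \<open>Rounding \<open>\<rho>\<close> down to a multiple of \<open>r < \<delta>\<close>
    is a relative change of at most \<open>\<epsilon> / (64 * H)\<close>; the constant
    \<open>H\<close> converts relative changes of scale into changes of energy and of squared L^2
    distance.\<close>
  define \<delta> where "\<delta> = \<rho> * min 1 (\<epsilon> / (64 * H))"
  have \<delta>: "0 < \<delta>" "\<delta> \<le> \<rho>" using \<rho> assms H by (auto simp: \<delta>_def mult_le_cancel_left1 mult_le_cancel_left2)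
  have close: "integral UNIV (\<lambda>p. (dq u e s p - dq u e s' p)\<^sup>2) \<le> H * ((s - s') / s)"
    if "0 < s'" "s' \<le> s" "s \<le> 1" for s s'
  proof -
    define t where "t = (s - s') / s"
    have t: "0 \<le> t" "t \<le> 1" using that by (auto simp: t_def field_simps)
    have "integral UNIV (\<lambda>p. (dq u e s p - dq u e s' p)\<^sup>2) \<le> (4 * C\<^sup>2 * t) * V"
      unfolding V_def
    proof (rule csupp_integral_bound[OF cs2 K(1)])
      fix p
      have "\<bar>dq u e s p - dq u e s' p\<bar> \<le> 2 * C * t"
        using dq_close[OF that(1,2), of p] by (simp add: C_def t_def)
      then have "(dq u e s p - dq u e s' p)\<^sup>2 \<le> (2 * C * t)\<^sup>2"
        using C t by (simp add: abs_le_square_iff[symmetric])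
      also have "\<dots> = 4 * C\<^sup>2 * (t * t)" by (simp add: power2_eq_square)
      also have "\<dots> \<le> 4 * C\<^sup>2 * t" using t mult_left_le[of t t] by (intro mult_left_mono) auto
      finally show "(dq u e s p - dq u e s' p)\<^sup>2 \<le> 4 * C\<^sup>2 * t" .
    qed (use K(2) that in auto)
    also have "\<dots> \<le> H * t" using t by (simp add: H_def algebra_simps)
    finally show ?thesis by (simp add: t_def)
  qed
  have closeE: "\<bar>energy u e s - energy u e s'\<bar> \<le> H * ((s - s') / s)"
    if "0 < s'" "s' \<le> s" "s \<le> 1" for s s'
  proof -
    define t where "t = (s - s') / s"
    have t: "0 \<le> t" using that by (auto simp: t_def field_simps)
    have pt: "\<bar>(dq u e s p)\<^sup>2 - (dq u e s' p)\<^sup>2\<bar> \<le> 4 * C\<^sup>2 * t" for p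
    proof -
      have 1: "\<bar>dq u e s p - dq u e s' p\<bar> \<le> 2 * C * t"
        using dq_close[OF that(1,2), of p] by (simp add: C_def t_def)
      have 2: "\<bar>dq u e s p + dq u e s' p\<bar> \<le> 2 * C"
        using dq_bound[of s p] dq_bound[of s' p] that by (simp add: C_def)
      have "\<bar>(dq u e s p)\<^sup>2 - (dq u e s' p)\<^sup>2\<bar> = \<bar>dq u e s p - dq u e s' p\<bar> * \<bar>dq u e s p + dq u e s' p\<bar>"
        by (simp add: abs_mult[symmetric] power2_eq_square algebra_simps)
      also have "\<dots> \<le> (2 * C * t) * (2 * C)" using 1 2 C t by (intro mult_mono) auto
      finally show ?thesis by (simp add: power2_eq_square mult_ac)
    qed
    have d: "integral UNIV (\<lambda>p. (dq u e a p)\<^sup>2 - (dq u e b p)\<^sup>2) = energy u e a - energy u e b" for a b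
      unfolding energy_def by (rule integral_diff) (auto intro: csupp_integrable cs)
    have "energy u e s - energy u e s' \<le> (4 * C\<^sup>2 * t) * V" "energy u e s' - energy u e s \<le> (4 * C\<^sup>2 * t) * V"
      unfolding d[symmetric] V_def
      by (rule csupp_integral_bound[OF csupp_diff[OF cs cs] K(1)];
          use K(2) that pt in \<open>auto simp: abs_le_iff\<close>)+
    moreover have "(4 * C\<^sup>2 * t) * V \<le> H * t" using t by (simp add: H_def algebra_simps)
    ultimately show ?thesis unfolding t_def by linarith
  qed
  have "integral UNIV (\<lambda>p. (dq u e r p - dq u e \<rho> p)\<^sup>2) \<le> \<epsilon>" if r: "0 < r" "r < \<delta>" for r
  proof -
    define M where "M = nat \<lfloor>\<rho> / r\<rfloor>"
    have q: "\<rho> / r \<ge> 1" using r \<delta> by simp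
    have M1: "M \<ge> 1" using q unfolding M_def by (simp add: le_nat_floor)
    have Mle: "real M \<le> \<rho> / r" unfolding M_def using q by (simp add: of_nat_floor)
    have Mge: "real M > \<rho> / r - 1" unfolding M_def using q by linarith
    have Mr: "real M * r \<le> \<rho>" "real M * r > \<rho> - r" "0 < real M * r"
      using Mle Mge r M1 by (auto simp: field_simps)
    have gap: "(\<rho> - real M * r) / \<rho> \<le> \<epsilon> / (64 * H)"
    proof -
      have "\<rho> - real M * r \<le> \<delta>" using Mr r by linarith
      also have "\<delta> \<le> \<rho> * (\<epsilon> / (64 * H))" unfolding \<delta>_def by (rule mult_left_mono) (use \<rho> in simp_all)
      finally show ?thesis using \<rho> by (simp add: pos_divide_le_eq mult.commute)
    qed
    have H1: "H * ((\<rho> - real M * r) / \<rho>) \<le> \<epsilon> / 64"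
      using mult_left_mono[OF gap, of H] H by simp
    have "\<bar>energy u e r1 - energy u e (2 * real M * r)\<bar> \<le> H * ((r1 - 2 * real M * r) / r1)"
    proof (rule closeE)
      have "2 * real M * r = 2 * (real M * r)" "r1 = 2 * \<rho>" by (simp_all add: \<rho>_def)
      then show "0 < 2 * real M * r" "2 * real M * r \<le> r1" using Mr by linarith+
    qed (rule r1)
    also have "(r1 - 2 * real M * r) / r1 = (\<rho> - real M * r) / \<rho>"
      using r1 by (simp add: \<rho>_def field_simps)
    finally have "energy u e (2 * real M * r) \<ge> S - \<epsilon> / 32" using H1 r1 by linarith
    moreover have "energy u e r \<le> S" using ES r \<delta> \<rho> by simp
    ultimately have "energy u e r - energy u e (2 * real M * r) \<le> \<epsilon> / 32" by (simp add: algebra_simps)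
    then have "8 * (energy u e r - energy u e (2 * real M * r)) \<le> \<epsilon> / 4" by simp
    then have A: "integral UNIV (\<lambda>p. (dq u e (real M * r) p - dq u e r p)\<^sup>2) \<le> \<epsilon> / 4"
      by (rule order_trans[OF integral_dq_diff_le[OF u r(1) M1]])
    have B: "integral UNIV (\<lambda>p. (dq u e \<rho> p - dq u e (real M * r) p)\<^sup>2) \<le> \<epsilon> / 64"
      by (rule order_trans[OF close[OF Mr(3,1) \<rho>(2)]]) (use H1 in linarith)
    have "integral UNIV (\<lambda>p. (dq u e r p - dq u e \<rho> p)\<^sup>2) \<le>
      integral UNIV (\<lambda>p. 2 * (dq u e (real M * r) p - dq u e r p)\<^sup>2 + 2 * (dq u e \<rho> p - dq u e (real M * r) p)\<^sup>2)"
    proof (rule csupp_integral_mono)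
      show "(dq u e r p - dq u e \<rho> p)\<^sup>2 \<le>
        2 * (dq u e (real M * r) p - dq u e r p)\<^sup>2 + 2 * (dq u e \<rho> p - dq u e (real M * r) p)\<^sup>2" for p
        using sum_squares_ge_zero[of "dq u e r p + dq u e \<rho> p - 2 * dq u e (real M * r) p" 0]
        by (simp add: power2_eq_square algebra_simps)
    qed (intro csupp_add csupp_scale cs2)+
    also have "\<dots> = 2 * integral UNIV (\<lambda>p. (dq u e (real M * r) p - dq u e r p)\<^sup>2)
        + 2 * integral UNIV (\<lambda>p. (dq u e \<rho> p - dq u e (real M * r) p)\<^sup>2)"
      by (subst integral_add) (auto intro!: csupp_integrable csupp_scale cs2)
    finally show ?thesis using A B assms by linarith
  qed
  moreover have "\<delta> \<le> 1" using \<delta> \<rho> by linarith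
  ultimately show ?thesis using that[OF \<rho> \<delta>(1)] by blast
qed

text \<open>The difference quotients at scale \<open>r\<close> are compared with those at a fixed scale \<open>\<rho>\<close>, which
  are uniformly continuous.\<close>

lemma dq_translation_L2_tendsto:
  assumes "\<epsilon> > 0"
  obtains \<delta> where "0 < \<delta>" "\<And>r. 0 < r \<Longrightarrow> r < \<delta> \<Longrightarrow>
    integral UNIV (\<lambda>p. (dq u e r (p \<odot> dil r w) - dq u e r p)\<^sup>2) \<le> \<epsilon>"
proof -
  have "\<epsilon> / 12 > 0" using assms by simp
  from dq_L2_Cauchy[OF this] obtain \<rho> \<delta>1 where \<rho>: "0 < \<rho>" "\<rho> \<le> 1" "0 < \<delta>1" "\<delta>1 \<le> 1" and
    \<delta>1: "\<And>r. 0 < r \<Longrightarrow> r < \<delta>1 \<Longrightarrow> integral UNIV (\<lambda>p. (dq u e r p - dq u e \<rho> p)\<^sup>2) \<le> \<epsilon> / 12"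
    by blast
  obtain K where K: "compact K" "\<And>r p. 0 < r \<Longrightarrow> r \<le> 1 \<Longrightarrow> p \<notin> K \<Longrightarrow> dq u e r p = 0"
    using dq_support by blast
  have "compact ((\<lambda>r. dil r w) ` {0..1::real})"
  proof (rule compact_continuous_image)
    have "continuous_on {0..1} (\<lambda>r. if k = tau then r\<^sup>2 * w $ k else r * w $ k)" for k
      by (cases "k = tau") (auto intro!: continuous_intros)
    then show "continuous_on {0..1} (\<lambda>r. dil r w)"
      unfolding dil_def by (rule continuous_on_vec_lambda)
  qed simp
  from translates_vanish[OF K(1) this] obtain K' where K': "compact K'"
    "\<And>p a. a \<in> (\<lambda>r. dil r w) ` {0..1::real} \<Longrightarrow> p \<notin> K' \<Longrightarrow> p \<odot> a \<notin> K" by blast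
  define V where "V = measure lebesgue K'"
  have V: "V \<ge> 0" by (simp add: V_def)
  define N1 where "N1 = sqrt \<bar>w $ tau\<bar> + sqrt (4 * \<rho> * \<bar>om w e\<bar>)"
  define c where "c r = (L * (sqrt r * (norm (hor w) + N1)) + L * (r * nrm w)) / \<rho>" for r
  have c_lim: "((\<lambda>r. 3 * (c r)\<^sup>2 * V) \<longlongrightarrow> 3 * (c 0)\<^sup>2 * V) (at_right 0)"
    unfolding c_def by (intro tendsto_intros) (use \<rho> in simp_all)
  then have "((\<lambda>r. 3 * (c r)\<^sup>2 * V) \<longlongrightarrow> 0) (at_right 0)" by (simp add: c_def)
  then have "\<forall>\<^sub>F r in at_right 0. 3 * (c r)\<^sup>2 * V < \<epsilon> / 2"
    using assms by (intro order_tendstoD(2)) auto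
  then obtain \<delta>2 where \<delta>2: "\<delta>2 > 0" "\<And>r. 0 < r \<Longrightarrow> r < \<delta>2 \<Longrightarrow> 3 * (c r)\<^sup>2 * V < \<epsilon> / 2"
    unfolding eventually_at_right_field by auto
  have "integral UNIV (\<lambda>p. (dq u e r (p \<odot> dil r w) - dq u e r p)\<^sup>2) \<le> \<epsilon>"
    if r: "0 < r" "r < min \<delta>1 \<delta>2" for r
  proof -
    have r1: "r \<le> 1" using r \<rho> by linarith
    let ?g = "\<lambda>p. (dq u e r p - dq u e \<rho> p)\<^sup>2"
    have cg: "csupp ?g" by (intro csupp_square csupp_diff csupp_dq u)
    let ?h = "\<lambda>p. (dq u e \<rho> (p \<odot> dil r w) - dq u e \<rho> p)\<^sup>2"
    have ch: "csupp ?h" by (intro csupp_square csupp_diff csupp_translate csupp_dq u)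
    have ig: "integral UNIV ?g \<le> \<epsilon> / 12" using \<delta>1 r by simp
    have ig': "integral UNIV (\<lambda>p. ?g (p \<odot> dil r w)) \<le> \<epsilon> / 12"
      using integral_right_translation[OF cg, of "dil r w"] ig by simp
    have sq: "r \<le> sqrt r" using r r1 real_sqrt_le_mono[of "r * r" r] by (simp add: mult_left_le)
    have hpt: "\<bar>dq u e \<rho> (p \<odot> dil r w) - dq u e \<rho> p\<bar> \<le> c r" for p
    proof -
      \<comment> \<open>Moving the translation past the step \<open>\<rho> *\<^sub>R e\<close>
        conjugates it. The conjugate has a vertical coordinate of order \<open>r\<close> instead of
        \<open>r\<^sup>2\<close>, so its \<open>nrm\<close> is only of order \<open>sqrt r\<close>,
        which still tends to zero as \<open>\<rho>\<close> is fixed.\<close>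
      define q where "q = - (\<rho> *\<^sub>R e) \<odot> (dil r w \<odot> \<rho> *\<^sub>R e)"
      have et: "e $ tau = 0" using hor_nth(1)[of e] e by simp
      have hq: "hor q = r *\<^sub>R hor w" by (simp add: q_def hor_minus hor_dil)
      have dw: "om (dil r w) e = r * om w e"
        using om_hor(1)[of "dil r w" e] by (simp only: hor_dil om_scale_left om_hor)
      have "q $ tau = r\<^sup>2 * w $ tau + 4 * \<rho> * r * om w e"
        unfolding q_def using om_swap[of e "dil r w"]
        by (simp add: et om_simps mul_def dw algebra_simps)
      then have "\<bar>q $ tau\<bar> \<le> r\<^sup>2 * \<bar>w $ tau\<bar> + 4 * \<rho> * r * \<bar>om w e\<bar>"
        using r \<rho> abs_triangle_ineq[of "r\<^sup>2 * w $ tau" "4 * \<rho> * r * om w e"] by (simp add: abs_mult)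
      also have "\<dots> \<le> r * \<bar>w $ tau\<bar> + r * (4 * \<rho> * \<bar>om w e\<bar>)"
        using r r1 mult_left_le[of r r] by (intro add_mono mult_right_mono) (auto simp: power2_eq_square)
      finally have "sqrt \<bar>q $ tau\<bar> \<le> sqrt (r * \<bar>w $ tau\<bar> + r * (4 * \<rho> * \<bar>om w e\<bar>))" by simp
      also have "\<dots> \<le> sqrt (r * \<bar>w $ tau\<bar>) + sqrt (r * (4 * \<rho> * \<bar>om w e\<bar>))"
        using r \<rho> by (intro sqrt_add_le_add_sqrt) auto
      also have "\<dots> = sqrt r * N1" by (simp add: N1_def real_sqrt_mult algebra_simps)
      finally have st: "sqrt \<bar>q $ tau\<bar> \<le> sqrt r * N1" .
      have "nrm q \<le> sqrt r * (norm (hor w) + N1)"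
        unfolding nrm_def hq using st r mult_right_mono[OF sq, of "norm (hor w)"] by (simp add: algebra_simps)
      then have 1: "\<bar>u ((p \<odot> \<rho> *\<^sub>R e) \<odot> q) - u (p \<odot> \<rho> *\<^sub>R e)\<bar> \<le> L * (sqrt r * (norm (hor w) + N1))"
        using lip[of "p \<odot> \<rho> *\<^sub>R e" q] L by (meson mult_left_mono order_trans)
      have 2: "\<bar>u (p \<odot> dil r w) - u p\<bar> \<le> L * (r * nrm w)"
        using lip[of p "dil r w"] r by (simp add: nrm_dil)
      have "(p \<odot> \<rho> *\<^sub>R e) \<odot> q = p \<odot> dil r w \<odot> \<rho> *\<^sub>R e" by (simp add: q_def mul_assoc)
      then have "\<rho> * (dq u e \<rho> (p \<odot> dil r w) - dq u e \<rho> p) =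
          (u ((p \<odot> \<rho> *\<^sub>R e) \<odot> q) - u (p \<odot> \<rho> *\<^sub>R e)) - (u (p \<odot> dil r w) - u p)"
        using \<rho> by (simp add: dq_def field_simps)
      then have "\<bar>\<rho> * (dq u e \<rho> (p \<odot> dil r w) - dq u e \<rho> p)\<bar> \<le> \<rho> * c r"
        using 1 2 \<rho> by (simp add: c_def)
      then show ?thesis using \<rho> by (simp add: abs_mult)
    qed
    have ih: "integral UNIV ?h \<le> (c r)\<^sup>2 * V"
      unfolding V_def
    proof (rule csupp_integral_bound[OF ch K'(1)])
      show "?h p \<le> (c r)\<^sup>2" for p
        using power_mono[OF hpt[of p] abs_ge_zero, of 2] by simp
      fix p assume p: "p \<notin> K'"
      have Kt: "p \<odot> dil t w \<notin> K" if "t \<in> {0..1}" for t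
        by (rule K'(2)[OF imageI[OF that] p])
      have "dil 0 w = 0" by (simp add: dil_def vec_eq_iff)
      then have "p \<odot> dil r w \<notin> K" "p \<notin> K" using Kt[of r] Kt[of 0] r r1 by simp_all
      then show "?h p = 0" using K(2) \<rho> by simp
    qed
    have "integral UNIV (\<lambda>p. (dq u e r (p \<odot> dil r w) - dq u e r p)\<^sup>2) \<le>
        integral UNIV (\<lambda>p. 3 * ?g (p \<odot> dil r w) + 3 * ?h p + 3 * ?g p)"
    proof (rule csupp_integral_mono)
      show "csupp (\<lambda>p. (dq u e r (p \<odot> dil r w) - dq u e r p)\<^sup>2)"
        by (intro csupp_square csupp_diff csupp_translate csupp_dq u)
      show "csupp (\<lambda>p. 3 * ?g (p \<odot> dil r w) + 3 * ?h p + 3 * ?g p)"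
        by (intro csupp_add csupp_scale ch cg csupp_translate[OF cg])
      fix p
      have three: "(a + b + c)\<^sup>2 \<le> 3 * a\<^sup>2 + 3 * b\<^sup>2 + 3 * c\<^sup>2" for a b c :: real
        using sum_squares_ge_zero[of "a - b" "b - c"] zero_le_square[of "a - c"]
        by (simp add: power2_eq_square algebra_simps)
      show "(dq u e r (p \<odot> dil r w) - dq u e r p)\<^sup>2 \<le> 3 * ?g (p \<odot> dil r w) + 3 * ?h p + 3 * ?g p"
        using three[of "dq u e r (p \<odot> dil r w) - dq u e \<rho> (p \<odot> dil r w)"
          "dq u e \<rho> (p \<odot> dil r w) - dq u e \<rho> p" "dq u e \<rho> p - dq u e r p"]
        by (simp add: power2_commute[of "dq u e \<rho> p"])
    qed
    also have "\<dots> = 3 * integral UNIV (\<lambda>p. ?g (p \<odot> dil r w)) + 3 * integral UNIV ?h + 3 * integral UNIV ?g"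
    proof -
      note i = csupp_integrable[OF csupp_scale[of _ 3]]
      have "integral UNIV (\<lambda>p. 3 * ?g (p \<odot> dil r w) + 3 * ?h p + 3 * ?g p) =
        integral UNIV (\<lambda>p. 3 * ?g (p \<odot> dil r w) + 3 * ?h p) + integral UNIV (\<lambda>p. 3 * ?g p)"
        by (rule integral_add[OF csupp_integrable i]) (intro csupp_add csupp_scale ch cg csupp_translate[OF cg])+
      also have "integral UNIV (\<lambda>p. 3 * ?g (p \<odot> dil r w) + 3 * ?h p) =
        integral UNIV (\<lambda>p. 3 * ?g (p \<odot> dil r w)) + integral UNIV (\<lambda>p. 3 * ?h p)"
        by (rule integral_add[OF i i]) (intro ch csupp_translate[OF cg])+
      finally show ?thesis by simp
    qed
    finally show ?thesis using ig ig' ih \<delta>2(2)[of r] r by linarith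
  qed
  then show ?thesis using that[of "min \<delta>1 \<delta>2"] \<delta>2 \<rho> by auto
qed

end
end

section \<open>Mollification\<close>

context heis_coords begin

text \<open>The square makes the profile continuously differentiable, with an explicit derivative
  that \<open>kernel\<close> records.\<close>

definition bump :: "'N pt \<Rightarrow> real"
  where "bump w = (max 0 (1 - w \<bullet> w))\<^sup>2"

definition eta :: "'N pt \<Rightarrow> real"
  where "eta w = bump w / integral UNIV bump"

text \<open>The derivative at \<open>v = 0\<close>, in the coordinate direction \<open>j\<close>, of
  \<open>eta (- q \<odot> v)\<close>; the term with \<open>om\<close> comes from the group
  law.\<close>

definition kernel :: "'N \<Rightarrow> 'N pt \<Rightarrow> real"
  where "kernel j q = 4 / integral UNIV bump * max 0 (1 - q \<bullet> q) *
    (q $ j - 2 * om q (axis j 1) * q $ tau)"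

definition avg :: "('N pt \<Rightarrow> 'N pt) \<Rightarrow> 'N pt"
  where "avg g = (\<chi> i. integral UNIV (\<lambda>w. eta w * g w $ i))"

text \<open>The differential at 0 of the mollification of \<open>G\<close>. Written as an integral
  against \<open>kernel\<close>, it makes sense for continuous \<open>G\<close> and passes to
  dominated pointwise limits.\<close>

definition Mat :: "('N pt \<Rightarrow> 'N pt) \<Rightarrow> ((real,'N) vec,'N) vec"
  where "Mat G = (\<chi> i j. integral UNIV (\<lambda>q. kernel j q * G q $ i))"

lemma bump_zero: "norm w > 1 \<Longrightarrow> max 0 (1 - w \<bullet> w) = 0"
proof -
  assume "norm w > 1"
  then have "1 < (norm w)\<^sup>2" by (simp add: one_less_power)
  then show ?thesis by (simp add: power2_norm_eq_inner)
qed

lemma csupp_bump: "csupp bump"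
  by (rule csuppI[where K = "cball 0 1"]) (auto simp: bump_def bump_zero intro!: continuous_intros)

lemma csupp_kernel: "csupp (kernel j)"
proof (rule csuppI[where K = "cball 0 1"])
  show "continuous_on UNIV (kernel j)" unfolding kernel_def[abs_def] by (intro continuous_intros)
  show "kernel j q = 0" if "q \<notin> cball 0 1" for q
    using that bump_zero[of q] by (simp add: kernel_def)
qed simp

lemma integral_bump_pos: "integral UNIV bump > 0"
proof -
  have "0 < integral UNIV bump \<longleftrightarrow> integral UNIV bump \<noteq> 0"
    using integral_nonneg[OF csupp_integrable[OF csupp_bump]] by (auto simp: bump_def less_le)
  moreover have "integral UNIV bump \<noteq> 0"
  proof
    assume z: "integral UNIV bump = 0"
    have int: "bump integrable_on UNIV" by (rule csupp_integrable[OF csupp_bump])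
    have int': "bump integrable_on cbox (- One) One"
      by (rule integrable_continuous, rule continuous_on_subset[OF csupp_continuous[OF csupp_bump]]) simp
    have "integral (cbox (- One) One) bump \<le> integral UNIV bump"
      by (rule integral_subset_le[OF _ int' int]) (auto simp: bump_def)
    moreover have "integral (cbox (- One) One) bump \<ge> 0"
      by (rule integral_nonneg[OF int']) (simp add: bump_def)
    ultimately have "integral (cbox (- One) One) bump = 0" using z by simp
    then have "(bump has_integral 0) (cbox (- One) One)" using int' by (metis integrable_integral)
    then have "bump 0 = 0"
    proof (rule has_integral_0_cbox_imp_0[rotated 2])
      show "continuous_on (cbox (- One) One) bump"
        by (rule continuous_on_subset[OF csupp_continuous[OF csupp_bump]]) simp
      show "(0::'N pt) \<in> cbox (- One) One" "box (- One) (One::'N pt) \<noteq> {}"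
        by (auto simp: mem_box box_ne_empty)
    qed (simp add: bump_def)
    then show False by (simp add: bump_def)
  qed
  ultimately show ?thesis by blast
qed

lemma csupp_eta: "csupp eta"
  unfolding eta_def[abs_def] by (rule csupp_divide[OF csupp_bump])
lemma integral_eta: "integral UNIV eta = 1"
  using integral_bump_pos unfolding eta_def[abs_def] by simp
lemma eta_nonneg: "eta w \<ge> 0"
  using integral_bump_pos by (simp add: eta_def bump_def)
lemma eta_zero: "norm w > 1 \<Longrightarrow> eta w = 0"
  by (simp add: eta_def bump_def bump_zero)
lemma eta_minus: "eta (- w) = eta w" by (simp add: eta_def bump_def)

lemma csupp_mult_continuous: "csupp f \<Longrightarrow> continuous_on UNIV g \<Longrightarrow> csupp (\<lambda>x. f x * g x)"
  unfolding csupp_def by (auto intro!: continuous_on_mult)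

lemma csupp_eta_mult:
  "continuous_on UNIV g \<Longrightarrow> csupp (\<lambda>w. eta w * g w $ i)"
  by (rule csupp_mult_continuous[OF csupp_eta]) (rule continuous_on_component)

lemma avg_const [simp]: "avg (\<lambda>w. a) = a"
  using integral_eta by (simp add: avg_def vec_eq_iff)

lemma avg_add: "continuous_on UNIV f \<Longrightarrow> continuous_on UNIV g \<Longrightarrow> avg (\<lambda>w. f w + g w) = avg f + avg g"
  by (simp add: avg_def vec_eq_iff distrib_left integral_add csupp_integrable csupp_eta_mult)

lemma avg_linear:
  assumes T: "linear T" and g: "continuous_on UNIV g"
  shows "avg (\<lambda>w. T (g w)) = T (avg g)"
proof -
  have Tx: "T x $ i = (\<Sum>k\<in>UNIV. matrix T $ i $ k * x $ k)" for x i
    using fun_cong[OF matrix_vector_mul(2)[OF T], of x] by (simp add: matrix_vector_mult_def vec_eq_iff)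
  have "integral UNIV (\<lambda>w. eta w * T (g w) $ i) = (\<Sum>k\<in>UNIV. matrix T $ i $ k * integral UNIV (\<lambda>w. eta w * g w $ k))" for i
  proof -
    have "integral UNIV (\<lambda>w. eta w * T (g w) $ i) =
        integral UNIV (\<lambda>w. \<Sum>k\<in>UNIV. matrix T $ i $ k * (eta w * g w $ k))"
      by (simp add: Tx sum_distrib_left mult_ac)
    also have "\<dots> = (\<Sum>k\<in>UNIV. integral UNIV (\<lambda>w. matrix T $ i $ k * (eta w * g w $ k)))"
      by (rule integral_csupp_sum) (simp, rule csupp_scale, rule csupp_eta_mult[OF g])
    finally show ?thesis by simp
  qed
  then show ?thesis by (simp add: avg_def vec_eq_iff Tx)
qed

lemma linear_uminus: "linear (uminus :: 'N pt \<Rightarrow> 'N pt)" by (rule linearI) auto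

lemma det_uminus: "det (matrix (uminus :: 'N pt \<Rightarrow> 'N pt)) = (-1) ^ CARD('N)"
proof -
  have "det (matrix (uminus :: 'N pt \<Rightarrow> 'N pt)) = (\<Prod>k\<in>UNIV. matrix (uminus :: 'N pt \<Rightarrow> 'N pt) $ k $ k)"
    by (rule det_diagonal) (simp add: matrix_def axis_def)
  then show ?thesis by (simp add: matrix_def axis_def)
qed

lemma avg_odd:
  assumes g: "continuous_on UNIV g" and odd: "\<And>w. g (- w) = - g w"
  shows "avg g = 0"
proof -
  have "integral UNIV (\<lambda>w. eta w * g w $ i) = 0" for i
  proof -
    have d: "\<bar>det (matrix (uminus :: 'N pt \<Rightarrow> 'N pt))\<bar> = 1" by (simp add: det_uminus)
    have "integral UNIV (\<lambda>w. eta (- w) * g (- w) $ i) = integral UNIV (\<lambda>w. eta w * g w $ i)"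
    proof (rule integral_affine_invariant[OF csupp_eta_mult[OF g] _ d])
      show "(uminus has_derivative uminus) (at x)" for x :: "'N pt"
        by (auto intro!: derivative_eq_intros)
    qed (auto simp: surj_def intro!: exI[of _ "- _"] injI)
    then show ?thesis by (simp add: eta_minus odd)
  qed
  then show ?thesis by (simp add: avg_def vec_eq_iff)
qed

text \<open>The estimate is made coordinate by coordinate and then summed, whence the factor
  \<open>CARD('N)\<close>.\<close>

lemma avg_close:
  assumes g: "continuous_on UNIV g" and c: "\<And>w. norm w \<le> 1 \<Longrightarrow> norm (g w - a) \<le> c"
  shows "norm (avg g - a) \<le> real CARD('N) * c"
proof -
  have "\<bar>(avg g - a) $ i\<bar> \<le> c" for i
  proof -
    have "(avg g - a) $ i = integral UNIV (\<lambda>w. eta w * g w $ i) - integral UNIV (\<lambda>w. eta w * a $ i)"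
      using integral_eta by (simp add: avg_def)
    also have "\<dots> = integral UNIV (\<lambda>w. eta w * g w $ i - eta w * a $ i)"
      by (rule integral_diff[symmetric]) (intro csupp_integrable csupp_mult_continuous csupp_eta continuous_intros g)+
    finally have eq: "(avg g - a) $ i = integral UNIV (\<lambda>w. eta w * g w $ i - eta w * a $ i)" .
    have pt: "\<bar>eta w * g w $ i - eta w * a $ i\<bar> \<le> c * eta w" for w
    proof (cases "norm w \<le> 1")
      case True
      have "\<bar>(g w - a) $ i\<bar> \<le> c" using component_le_norm_cart[of "g w - a" i] c[OF True] by simp
      then have "eta w * \<bar>(g w - a) $ i\<bar> \<le> eta w * c" using eta_nonneg mult_left_mono by blast
      then show ?thesis using eta_nonneg[of w] by (simp add: right_diff_distrib[symmetric] abs_mult mult.commute)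
    qed (simp add: eta_zero)
    have "norm (integral UNIV (\<lambda>w. eta w * g w $ i - eta w * a $ i)) \<le> integral UNIV (\<lambda>w. c * eta w)"
    proof (rule integral_norm_bound_integral)
      show "(\<lambda>w. eta w * g w $ i - eta w * a $ i) integrable_on UNIV"
        by (intro csupp_integrable csupp_diff csupp_mult_continuous csupp_eta continuous_intros g)
      show "(\<lambda>w. c * eta w) integrable_on UNIV" by (intro csupp_integrable csupp_scale csupp_eta)
    qed (use pt in simp)
    then show ?thesis using integral_eta by (simp add: eq del: vector_minus_component)
  qed
  then show ?thesis
    using norm_le_l1_cart[of "avg g - a"] sum_bounded_above[of UNIV "\<lambda>i. \<bar>(avg g - a) $ i\<bar>" c] by fastforce
qed

definition smooth :: "('N pt \<Rightarrow> 'N pt) \<Rightarrow> 'N pt \<Rightarrow> 'N pt"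
  where "smooth G v = avg (\<lambda>w. G (v \<odot> (- w)))"

lemma continuous_on_compose_UNIV:
  "continuous_on UNIV G \<Longrightarrow> continuous_on S f \<Longrightarrow> continuous_on S (\<lambda>x. G (f x))"
  by (rule continuous_on_compose2[where t = UNIV]) auto

text \<open>The substitution \<open>w \<mapsto> v \<odot> - w\<close>, whose derivative is minus a
  shear, moves the dependence on \<open>v\<close> from \<open>G\<close> to \<open>eta\<close>;
  differentiability in \<open>v\<close> then asks no more of \<open>G\<close> than
  continuity.\<close>

lemma smooth_kernel_form:
  assumes G: "continuous_on UNIV G"
  shows "smooth G v $ i = integral UNIV (\<lambda>q. eta (- q \<odot> v) * G q $ i)"
proof -
  let ?g = "\<lambda>w. v \<odot> (- w)"
  let ?f = "\<lambda>q. eta (- q \<odot> v) * G q $ i"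
  have inv: "- (v \<odot> - w) \<odot> v = w" for w by (simp add: minus_mul mul_assoc)
  have inv': "v \<odot> - (- w \<odot> v) = w" for w by (simp add: minus_mul)
  have cs: "csupp ?f"
  proof (rule csupp_mult_continuous)
    obtain K where K: "compact K" "\<And>x. x \<notin> K \<Longrightarrow> eta x = 0" using csupp_eta unfolding csupp_def by blast
    show "csupp (\<lambda>q. eta (- q \<odot> v))"
    proof (rule csuppI[where K = "?g ` K"])
      show "continuous_on UNIV (\<lambda>q. eta (- q \<odot> v))"
        by (rule continuous_on_compose_UNIV[OF csupp_continuous[OF csupp_eta]]) (intro continuous_intros)
      show "compact (?g ` K)" by (rule compact_continuous_image[OF _ K(1)]) (intro continuous_intros)
      fix x assume "x \<notin> ?g ` K"
      then have "- x \<odot> v \<notin> K" using inv'[of x] by (metis image_eqI)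
      then show "eta (- x \<odot> v) = 0" by (rule K(2))
    qed
  qed (intro continuous_intros G)
  let ?g' = "\<lambda>h. - (h + om h ((-2) *\<^sub>R v) *\<^sub>R axis tau 1)"
  have "integral UNIV (\<lambda>w. ?f (?g w)) = integral UNIV ?f"
  proof (rule integral_affine_invariant[OF cs, where g' = ?g'])
    show "(?g has_derivative ?g') (at x)" for x
      unfolding mul_def om_scale_right
      by (rule has_derivative_eq_rhs)
        (auto intro!: derivative_eq_intros bounded_bilinear.FDERIV[OF bounded_bilinear_om]
          simp: om_swap[of v] om_simps algebra_simps)
    have lin: "linear (\<lambda>h. h + om h ((-2) *\<^sub>R v) *\<^sub>R axis tau 1)"
      by (rule linearI) (simp_all add: om_simps algebra_simps)
    have "?g' = uminus \<circ> (\<lambda>h. h + om h ((-2) *\<^sub>R v) *\<^sub>R axis tau 1)" by (simp add: o_def)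
    then have "det (matrix ?g') = (-1) ^ CARD('N) * 1"
      by (simp only: matrix_compose[OF lin linear_uminus] det_mul det_shear det_uminus)
    then show "\<bar>det (matrix ?g')\<bar> = 1" by simp
    show "inj ?g" by (rule inj_on_inverseI[of _ "\<lambda>q. - q \<odot> v"]) (rule inv)
    show "surj ?g" by (rule surjI[of _ "\<lambda>q. - q \<odot> v"]) (rule inv')
  qed
  then show ?thesis by (simp add: smooth_def avg_def inv)
qed

text \<open>A first-order Taylor estimate for \<open>(max 0 t)\<^sup>2\<close>, whose derivative
  \<open>2 * max 0 t\<close> is Lipschitz with constant 2.\<close>

lemma max_square_expansion:
  fixes t s :: real
  shows "\<bar>(max 0 (t + s))\<^sup>2 - (max 0 t)\<^sup>2 - 2 * max 0 t * s\<bar> \<le> s\<^sup>2"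
proof -
  consider "t \<ge> 0" "t + s \<ge> 0" | "t \<ge> 0" "t + s < 0" | "t < 0" "t + s \<ge> 0" | "t < 0" "t + s < 0" by linarith
  then show ?thesis
  proof cases
    case 1 then show ?thesis by (simp add: power2_eq_square algebra_simps)
  next
    case 2
    have "t\<^sup>2 + 2 * t * s + s\<^sup>2 = (t + s)\<^sup>2" by (simp add: power2_eq_square algebra_simps)
    moreover have "- (2 * t * s) \<ge> t * t" 
      using 2 mult_left_mono[of t "- s" t] mult_nonneg_nonneg[of t "-s"] by simp
    ultimately show ?thesis using 2 by (simp add: power2_eq_square abs_le_iff) (smt (verit) mult_nonneg_nonneg zero_le_square)
  next
    case 3
    then have "(t + s)\<^sup>2 \<le> s\<^sup>2" by (intro power_mono) auto
    then show ?thesis using 3 by simp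
  next
    case 4 then show ?thesis by simp
  qed
qed


lemma norm_mul_le: "norm (p \<odot> q) \<le> norm p + norm q + 2 * (norm p * norm q)"
proof -
  have "norm (p \<odot> q) \<le> norm p + norm q + norm ((2 * om p q) *\<^sub>R axis tau (1::real))"
    unfolding mul_def by (meson add_mono norm_triangle_ineq order_refl order_trans)
  moreover have "\<bar>om p q\<bar> \<le> norm p * norm q"
    using om_bound[of p q] mult_mono[OF norm_hor_le norm_hor_le, of p q] by simp
  ultimately show ?thesis by simp
qed

lemma sum_kernel:
  "(\<Sum>j\<in>UNIV. kernel j q * v $ j) = 4 / integral UNIV bump * max 0 (1 - q \<bullet> q) * (q \<bullet> v - 2 * om q v * q $ tau)"
proof -
  have v: "v = (\<Sum>j\<in>UNIV. v $ j *\<^sub>R axis j 1)"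
    by (simp add: vec_eq_iff axis_def if_distrib cong: if_cong)
  have sum_om: "om q (\<Sum>j\<in>A. v $ j *\<^sub>R axis j 1) = (\<Sum>j\<in>A. om q (axis j 1) * v $ j)" if "finite A" for A
    using that by (induction A rule: finite_induct) (simp_all add: om_simps)
  have om: "om q v = (\<Sum>j\<in>UNIV. om q (axis j 1) * v $ j)"
    by (rule trans[OF arg_cong[OF v, of "om q"] sum_om[OF finite]])
  define K where "K = 4 / integral UNIV bump * max 0 (1 - q \<bullet> q)"
  have "kernel j q * v $ j = K * (q $ j * v $ j) - K * (2 * q $ tau) * (om q (axis j 1) * v $ j)" for j
    by (simp add: kernel_def K_def algebra_simps)
  then have "(\<Sum>j\<in>UNIV. kernel j q * v $ j) = K * (\<Sum>j\<in>UNIV. q $ j * v $ j)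
      - K * (2 * q $ tau) * (\<Sum>j\<in>UNIV. om q (axis j 1) * v $ j)"
    by (simp only: sum_subtractf sum_distrib_left)
  also have "\<dots> = K * (q \<bullet> v) - K * (2 * q $ tau) * om q v"
    unfolding om by (simp add: inner_vec_def)
  also have "\<dots> = K * (q \<bullet> v - 2 * om q v * q $ tau)" by (simp add: right_diff_distrib)
  finally show ?thesis unfolding K_def .
qed

text \<open>The radius 4 covers every \<open>q\<close> at which one of the terms is nonzero. The
  constants arise from \<open>norm l \<le> (1 + 2 * 4) * norm v\<close>,
  \<open>\<bar>s\<bar> \<le> (2 * 36 + 81) * norm v\<close> and
  \<open>153\<^sup>2 + 2 * 81 \<le> 30000\<close>.\<close>

lemma bump_expansion:
  assumes "norm q \<le> 4" "norm v \<le> 1"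
  shows "\<bar>eta (- q \<odot> v) - eta (- q) - (\<Sum>j\<in>UNIV. kernel j q * v $ j)\<bar> \<le> 30000 / integral UNIV bump * (norm v)\<^sup>2"
proof -
  define l where "l = v - (2 * om q v) *\<^sub>R axis tau 1"
  define t where "t = 1 - q \<bullet> q"
  define s where "s = 2 * (q \<bullet> l) - l \<bullet> l"
  define I where "I = integral UNIV bump"
  have I: "I > 0" using integral_bump_pos by (simp add: I_def)
  have mul: "- q \<odot> v = l - q" by (simp add: mul_def l_def om_simps)
  have ql: "q \<bullet> l = q \<bullet> v - 2 * om q v * q $ tau"
    by (simp add: l_def inner_diff_right inner_axis)
  have "1 - (l - q) \<bullet> (l - q) = t + s" by (simp add: t_def s_def inner_diff_left inner_diff_right inner_commute)
  then have b1: "bump (- q \<odot> v) = (max 0 (t + s))\<^sup>2" by (simp add: bump_def mul)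
  have b0: "bump (- q) = (max 0 t)\<^sup>2" by (simp add: bump_def t_def)
  have eq: "eta (- q \<odot> v) - eta (- q) - (\<Sum>j\<in>UNIV. kernel j q * v $ j) =
      ((max 0 (t + s))\<^sup>2 - (max 0 t)\<^sup>2 - 2 * max 0 t * s - 2 * max 0 t * (l \<bullet> l)) / I"
    unfolding sum_kernel ql[symmetric] eta_def b1 b0 I_def[symmetric] t_def[symmetric]
    using I by (simp add: s_def field_simps)
  have "\<bar>om q v\<bar> \<le> norm q * norm v"
    using om_bound[of q v] mult_mono[OF norm_hor_le norm_hor_le, of q v] by simp
  also have "\<dots> \<le> 4 * norm v" using assms(1) by (intro mult_right_mono) auto
  finally have "\<bar>om q v\<bar> \<le> 4 * norm v" .
  then have l: "norm l \<le> 9 * norm v"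
    using norm_triangle_ineq4[of v "(2 * om q v) *\<^sub>R axis tau 1"] by (simp add: l_def)
  have ll: "l \<bullet> l \<le> 81 * (norm v)\<^sup>2"
    using power_mono[OF l norm_ge_zero, of 2] by (simp add: power2_norm_eq_inner power_mult_distrib)
  have "(norm v)\<^sup>2 \<le> norm v" using assms(2) by (simp add: power2_eq_square mult_left_le)
  then have ll1: "l \<bullet> l \<le> 81 * norm v" using ll by linarith
  have "\<bar>q \<bullet> l\<bar> \<le> 4 * (9 * norm v)"
    using Cauchy_Schwarz_ineq2[of q l] mult_mono[OF assms(1) l] by simp
  then have "\<bar>s\<bar> \<le> 153 * norm v" using ll1 inner_ge_zero[of l] unfolding s_def by linarith
  then have "\<bar>s\<bar>\<^sup>2 \<le> (153 * norm v)\<^sup>2" by (intro power_mono) auto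
  then have s2: "s\<^sup>2 \<le> 23409 * (norm v)\<^sup>2" by (simp add: power_mult_distrib)
  have m: "0 \<le> max 0 t" "max 0 t \<le> 1" by (auto simp: t_def)
  have "\<bar>2 * max 0 t * (l \<bullet> l)\<bar> \<le> 2 * (l \<bullet> l)"
    using m mult_right_mono[of "max 0 t" 1 "l \<bullet> l"] by (simp add: abs_mult)
  then have "\<bar>(max 0 (t + s))\<^sup>2 - (max 0 t)\<^sup>2 - 2 * max 0 t * s - 2 * max 0 t * (l \<bullet> l)\<bar> \<le> 30000 * (norm v)\<^sup>2"
    using max_square_expansion[of t s] s2 ll by linarith
  then show ?thesis unfolding eq I_def[symmetric] using I by (simp add: divide_right_mono)
qed

lemma smooth_has_derivative:
  assumes G: "continuous_on UNIV G"
  shows "(smooth G has_derivative (*v) (Mat G)) (at 0)"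
proof -
  obtain B where B: "B \<ge> 0" "\<And>x. x \<in> cball 0 4 \<Longrightarrow> norm (G x) \<le> B"
    using continuous_compact_bound[OF G compact_cball] by blast
  define c where "c = 30000 / integral UNIV bump"
  have c: "c > 0" using integral_bump_pos by (simp add: c_def)
  define C where "C = real CARD('N) * (c * B * measure lebesgue (cball (0::'N pt) 4))"
  have main: "norm (smooth G v - smooth G 0 - Mat G *v v) \<le> C * (norm v)\<^sup>2" if v: "norm v \<le> 1" for v
  proof -
    define f where "f i q = (eta (- q \<odot> v) - eta (- q) - (\<Sum>j\<in>UNIV. kernel j q * v $ j)) * G q $ i" for i q
    have f0: "f i q = 0" if q: "q \<notin> cball 0 4" for i q
    proof -
      have "norm (- q \<odot> v) > 1"
      proof (rule ccontr)
        assume "\<not> ?thesis"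
        then have "norm (v \<odot> - (- q \<odot> v)) \<le> 1 + 1 + 2 * (1 * 1)"
          using v by (intro order_trans[OF norm_mul_le] add_mono mult_mono) auto
        moreover have "v \<odot> - (- q \<odot> v) = q" by (simp add: minus_mul)
        ultimately show False using q by simp
      qed
      moreover have "norm (- q) > 1" "max 0 (1 - q \<bullet> q) = 0" using q bump_zero[of q] by auto
      ultimately show ?thesis by (simp add: f_def eta_zero kernel_def)
    qed
    have ce: "csupp (\<lambda>q. eta (- q \<odot> w))" for w
    proof -
      obtain K where K: "compact K" "\<And>x. x \<notin> K \<Longrightarrow> eta x = 0" using csupp_eta unfolding csupp_def by blast
      show ?thesis
      proof (rule csuppI[where K = "(\<lambda>x. w \<odot> - x) ` K"])
        show "continuous_on UNIV (\<lambda>q. eta (- q \<odot> w))"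
          by (rule continuous_on_compose_UNIV[OF csupp_continuous[OF csupp_eta]]) (intro continuous_intros)
        show "compact ((\<lambda>x. w \<odot> - x) ` K)" by (rule compact_continuous_image[OF _ K(1)]) (intro continuous_intros)
        fix x assume "x \<notin> (\<lambda>x. w \<odot> - x) ` K"
        moreover have "w \<odot> - (- x \<odot> w) = x" by (simp add: minus_mul)
        ultimately have "- x \<odot> w \<notin> K" by (metis image_eqI)
        then show "eta (- x \<odot> w) = 0" by (rule K(2))
      qed
    qed
    have Gi: "continuous_on UNIV (\<lambda>q. G q $ i)" for i by (intro continuous_intros G)
    have cs1: "csupp (\<lambda>q. eta (- q \<odot> w) * G q $ i)" for w i by (rule csupp_mult_continuous[OF ce Gi])
    have cs2: "csupp (\<lambda>q. kernel j q * G q $ i)" for i j by (rule csupp_mult_continuous[OF csupp_kernel Gi])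
    have cs3: "csupp (\<lambda>q. \<Sum>j\<in>UNIV. v $ j * (kernel j q * G q $ i))" for i
      by (intro csupp_sum csupp_scale cs2) simp
    have feq: "f i = (\<lambda>q. eta (- q \<odot> v) * G q $ i - eta (- q \<odot> 0) * G q $ i - (\<Sum>j\<in>UNIV. v $ j * (kernel j q * G q $ i)))" for i
    proof (rule ext)
      fix q
      have "(\<Sum>j\<in>UNIV. v $ j * (kernel j q * G q $ i)) = (\<Sum>j\<in>UNIV. kernel j q * v $ j) * G q $ i"
        by (simp add: sum_distrib_right sum_distrib_left mult_ac)
      then show "f i q = eta (- q \<odot> v) * G q $ i - eta (- q \<odot> 0) * G q $ i - (\<Sum>j\<in>UNIV. v $ j * (kernel j q * G q $ i))"
        by (simp add: f_def left_diff_distrib)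
    qed
    have cf: "csupp (f i)" for i unfolding feq by (intro csupp_diff cs1 cs3)
    have comp: "(smooth G v - smooth G 0 - Mat G *v v) $ i = integral UNIV (f i)" for i
    proof -
      have "(Mat G *v v) $ i = (\<Sum>j\<in>UNIV. integral UNIV (\<lambda>q. v $ j * (kernel j q * G q $ i)))"
        by (simp add: matrix_vector_mult_def Mat_def mult.commute)
      also have "\<dots> = integral UNIV (\<lambda>q. \<Sum>j\<in>UNIV. v $ j * (kernel j q * G q $ i))"
        by (rule integral_csupp_sum[symmetric]) (simp, rule csupp_scale, rule cs2)
      finally show ?thesis
        unfolding feq
        by (simp only: integral_diff[OF csupp_integrable[OF csupp_diff[OF cs1 cs1]] csupp_integrable[OF cs3]]
            integral_diff[OF csupp_integrable[OF cs1] csupp_integrable[OF cs1]]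
            smooth_kernel_form[OF G] vector_minus_component)
    qed
    have bd: "\<bar>f i q\<bar> \<le> c * B * (norm v)\<^sup>2" for i q
    proof (cases "q \<in> cball 0 4")
      case True
      then have 1: "\<bar>eta (- q \<odot> v) - eta (- q) - (\<Sum>j\<in>UNIV. kernel j q * v $ j)\<bar> \<le> c * (norm v)\<^sup>2"
        unfolding c_def by (intro bump_expansion) (use v in auto)
      have 2: "\<bar>G q $ i\<bar> \<le> B" using component_le_norm_cart[of "G q" i] B(2)[OF True] by simp
      have "\<bar>f i q\<bar> \<le> (c * (norm v)\<^sup>2) * B"
        unfolding f_def abs_mult by (rule mult_mono[OF 1 2]) (use c in auto)
      then show ?thesis by (simp add: mult_ac)
    next
      case False
      then show ?thesis using f0[of q i] c B by simp
    qed
    have "\<bar>integral UNIV (f i)\<bar> \<le> c * B * (norm v)\<^sup>2 * measure lebesgue (cball (0::'N pt) 4)" for i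
    proof -
      have "integral UNIV (f i) \<le> c * B * (norm v)\<^sup>2 * measure lebesgue (cball (0::'N pt) 4)"
        by (rule csupp_integral_bound[OF cf]) (use f0 bd in \<open>auto simp: abs_le_iff\<close>)
      moreover have "integral UNIV (\<lambda>q. (-1) * f i q) \<le> c * B * (norm v)\<^sup>2 * measure lebesgue (cball (0::'N pt) 4)"
        by (rule csupp_integral_bound[OF csupp_scale[OF cf]]) (use f0 bd in \<open>auto simp: abs_le_iff\<close>)
      ultimately show ?thesis by (simp add: abs_le_iff)
    qed
    then have "\<bar>(smooth G v - smooth G 0 - Mat G *v v) $ i\<bar> \<le> c * B * (norm v)\<^sup>2 * measure lebesgue (cball (0::'N pt) 4)" for i
      unfolding comp .
    then have "(\<Sum>i\<in>UNIV. \<bar>(smooth G v - smooth G 0 - Mat G *v v) $ i\<bar>) \<le>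
        real CARD('N) * (c * B * (norm v)\<^sup>2 * measure lebesgue (cball (0::'N pt) 4))"
      using sum_bounded_above[of UNIV "\<lambda>i. \<bar>(smooth G v - smooth G 0 - Mat G *v v) $ i\<bar>"] by blast
    then have "norm (smooth G v - smooth G 0 - Mat G *v v) \<le>
        real CARD('N) * (c * B * (norm v)\<^sup>2 * measure lebesgue (cball (0::'N pt) 4))"
      using norm_le_l1_cart order_trans by blast
    then show ?thesis by (simp add: C_def mult_ac)
  qed
  show ?thesis
  proof (rule has_derivativeI_sandwich[where e = 1 and H = "\<lambda>v. C * norm v"])
    show "bounded_linear ((*v) (Mat G))" by simp
    show "((\<lambda>v. C * norm v) \<longlongrightarrow> 0) (at 0)"
      by (rule tendsto_eq_intros refl | simp)+
    fix v :: "'N pt" assume v: "v \<noteq> 0" "dist v 0 < 1"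
    have "norm (smooth G v - smooth G 0 - Mat G *v v) \<le> (C * norm v) * norm v"
      using main[of v] v by (simp add: power2_eq_square mult.assoc)
    then show "norm (smooth G v - smooth G 0 - Mat G *v (v - 0)) / norm (v - 0) \<le> C * norm v"
      using v by (simp add: pos_divide_le_eq)
  qed simp
qed

text \<open>Mollification reproduces linear maps, since \<open>v \<odot> - w\<close> is
  \<open>v\<close> plus an odd function of \<open>w\<close>; uniqueness of the derivative at 0 then
  identifies \<open>Mat\<close>.\<close>

lemma Mat_linear:
  assumes "linear D"
  shows "Mat D = matrix D"
proof -
  have cD: "continuous_on UNIV D" using assms by (simp add: linear_continuous_on linear_conv_bounded_linear)
  have "smooth D v = D v" for v
  proof -
    have "D (v \<odot> - w) = D v + D (- w - (2 * om v w) *\<^sub>R axis tau 1)" for w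
    proof -
      have "v \<odot> - w = v + (- w - (2 * om v w) *\<^sub>R axis tau 1)" by (simp add: mul_def om_simps)
      then show ?thesis by (simp only: linear_add[OF assms])
    qed
    then have "smooth D v = avg (\<lambda>w. D v + D (- w - (2 * om v w) *\<^sub>R axis tau 1))" by (simp add: smooth_def)
    also have "\<dots> = avg (\<lambda>w. D v) + avg (\<lambda>w. D (- w - (2 * om v w) *\<^sub>R axis tau 1))"
      by (rule avg_add) (intro continuous_intros continuous_on_compose_UNIV[OF cD])+
    also have "avg (\<lambda>w. D (- w - (2 * om v w) *\<^sub>R axis tau 1)) = 0"
    proof (rule avg_odd)
      show "D (- (- w) - (2 * om v (- w)) *\<^sub>R axis tau 1) = - D (- w - (2 * om v w) *\<^sub>R axis tau 1)" for w
        by (simp add: linear_neg[OF assms, symmetric] om_simps add.commute)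
    qed (intro continuous_intros continuous_on_compose_UNIV[OF cD])
    finally show ?thesis by simp
  qed
  then have "smooth D = D" by (rule ext)
  then have "(D has_derivative (*v) (Mat D)) (at 0)" using smooth_has_derivative[OF cD] by simp
  moreover have "(D has_derivative D) (at 0)" by (rule linear_imp_has_derivative[OF assms])
  ultimately have "(*v) (Mat D) = D" by (rule has_derivative_unique)
  then show ?thesis using matrix_of_matrix_vector_mul[of "Mat D"] by simp
qed

section \<open>Mollification at a given scale, and its Jacobian matrix\<close>

definition fsm :: "('N pt \<Rightarrow> 'N pt) \<Rightarrow> real \<Rightarrow> 'N pt \<Rightarrow> 'N pt"
  where "fsm F s p = avg (\<lambda>w. F (p \<odot> dil s (- w)))"

text \<open>The linear part of left translation by \<open>a\<close>, a shear of determinant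
  one.\<close>

definition ltr :: "'N pt \<Rightarrow> 'N pt \<Rightarrow> 'N pt"
  where "ltr a h = h + om h ((-2) *\<^sub>R a) *\<^sub>R axis tau 1"

lemma linear_ltr: "linear (ltr a)"
  unfolding ltr_def by (rule linearI) (simp_all add: om_simps algebra_simps)

lemma continuous_on_ltr [continuous_intros]:
  "continuous_on S f \<Longrightarrow> continuous_on S g \<Longrightarrow> continuous_on S (\<lambda>x. ltr (f x) (g x))"
  unfolding ltr_def by (intro continuous_intros)

lemma det_ltr: "det (matrix (ltr a)) = 1"
  unfolding ltr_def[abs_def] by (rule det_shear)

lemma mul_eq_ltr: "a \<odot> h = a + ltr a h"
  unfolding mul_def ltr_def using om_swap[of a h] by (simp add: om_simps)

text \<open>The chain rule for the mollified map, seen as translation, inverse dilation, mollified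
  blow-up, dilation, translation. The shears have determinant one and the dilations cancel, so the
  determinant is that of the blow-up.\<close>

definition jac :: "('N pt \<Rightarrow> 'N pt) \<Rightarrow> real \<Rightarrow> 'N pt \<Rightarrow> ((real,'N) vec,'N) vec"
  where "jac F s p = matrix (ltr (F p)) ** matrix (dil s) ** Mat (blow F s p) ** matrix (dil (1/s)) ** matrix (ltr (- p))"

lemma continuous_on_blow: assumes "continuous_on UNIV F" shows "continuous_on UNIV (blow F s p)"
proof -
  have "continuous_on UNIV (\<lambda>w. F (p \<odot> dil s w))"
    by (rule continuous_on_compose_UNIV[OF assms]) (intro continuous_intros)
  then show ?thesis unfolding blow_def[abs_def] by (intro continuous_intros)
qed

lemma det_jac: assumes "s > 0" shows "det (jac F s p) = det (Mat (blow F s p))"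
proof -
  have "det (matrix (dil s)) * det (matrix (dil (1/s))) = det (matrix (dil s \<circ> dil (1/s)))"
    by (simp add: matrix_compose[OF linear_dil linear_dil] det_mul)
  also have "dil s \<circ> dil (1/s) = id" using assms by auto
  finally have "det (matrix (dil s)) * det (matrix (dil (1/s))) = 1" by (simp only: matrix_id_mat_1 det_I)
  then show ?thesis by (simp add: jac_def det_mul det_ltr mult.commute mult.left_commute)
qed

lemma fsm_has_derivative:
  assumes F: "continuous_on UNIV F" and s: "s > 0"
  shows "(fsm F s has_derivative (*v) (jac F s p)) (at p)"
proof -
  let ?G = "blow F s p"
  have cG: "continuous_on UNIV ?G" by (rule continuous_on_blow[OF F])
  let ?T = "ltr (F p) \<circ> dil s"
  have lT: "linear ?T" by (rule linear_compose[OF linear_dil linear_ltr])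
  have *: "fsm F s (p \<odot> dil s v) = F p + ?T (smooth ?G v)" for v
  proof -
    have "F ((p \<odot> dil s v) \<odot> dil s (- w)) = F p + ?T (?G (v \<odot> - w))" for w
    proof -
      have "(p \<odot> dil s v) \<odot> dil s (- w) = p \<odot> dil s (v \<odot> - w)" by (simp only: mul_assoc dil_mul)
      then have "F ((p \<odot> dil s v) \<odot> dil s (- w)) = F p \<odot> dil s (?G (v \<odot> - w))"
        using blow_inv[OF s, of F p "v \<odot> - w"] by (simp only:)
      then show ?thesis by (simp only: mul_eq_ltr[of "F p"] o_def)
    qed
    then have "fsm F s (p \<odot> dil s v) = avg (\<lambda>w. F p + ?T (?G (v \<odot> - w)))" by (simp add: fsm_def)
    also have "\<dots> = avg (\<lambda>w. F p) + avg (\<lambda>w. ?T (?G (v \<odot> - w)))"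
      by (rule avg_add) (intro continuous_intros continuous_on_compose_UNIV[OF linear_continuous_on[OF lT[unfolded linear_conv_bounded_linear]]]
          continuous_on_compose_UNIV[OF cG])+
    also have "avg (\<lambda>w. ?T (?G (v \<odot> - w))) = ?T (smooth ?G v)"
      unfolding smooth_def by (rule avg_linear[OF lT]) (intro continuous_intros continuous_on_compose_UNIV[OF cG])
    finally show ?thesis by simp
  qed
  have eq: "fsm F s = (\<lambda>x. F p + ?T (smooth ?G (dil (1/s) (ltr (- p) (x - p)))))"
  proof
    fix x
    have z: "ltr (- p) (x - p) = - p \<odot> x"
      unfolding ltr_def mul_def using om_swap[of x p] by (simp add: om_simps)
    have "p \<odot> dil s (dil (1/s) (ltr (- p) (x - p))) = x" using s by (simp add: z)
    then show "fsm F s x = F p + ?T (smooth ?G (dil (1/s) (ltr (- p) (x - p))))"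
      using *[of "dil (1/s) (ltr (- p) (x - p))"] by simp
  qed
  let ?h = "\<lambda>x. dil (1/s) (ltr (- p) (x - p))"
  have dh: "(?h has_derivative (\<lambda>x. dil (1/s) (ltr (- p) x))) (at p)"
  proof -
    have "bounded_linear (\<lambda>x. dil (1/s) (ltr (- p) x))"
      using linear_compose[OF linear_ltr[of "- p"] linear_dil[of "1/s"]]
      by (simp add: linear_conv_bounded_linear o_def)
    moreover have "((\<lambda>x. x - p) has_derivative (\<lambda>x. x)) (at p)"
      by (auto intro!: derivative_eq_intros)
    ultimately show ?thesis by (rule bounded_linear.has_derivative)
  qed
  have h0: "?h p = 0" by (simp add: linear_0[OF linear_ltr])
  have "((\<lambda>x. smooth ?G (?h x)) has_derivative (\<lambda>x. Mat ?G *v dil (1/s) (ltr (- p) x))) (at p)"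
    using has_derivative_compose[OF dh, of "smooth ?G" "(*v) (Mat ?G)"] smooth_has_derivative[OF cG] h0 by simp
  then have "((\<lambda>x. F p + ?T (smooth ?G (?h x))) has_derivative (\<lambda>x. ?T (Mat ?G *v dil (1/s) (ltr (- p) x)))) (at p)"
    using has_derivative_add[OF has_derivative_const[of "F p"]
      bounded_linear.has_derivative[OF lT[unfolded linear_conv_bounded_linear]]] by simp
  moreover have "(\<lambda>x. ?T (Mat ?G *v dil (1/s) (ltr (- p) x))) = (*v) (jac F s p)"
    using fun_cong[OF matrix_vector_mul(2)[OF linear_ltr]] fun_cong[OF matrix_vector_mul(2)[OF linear_dil]]
    by (simp add: jac_def matrix_vector_mul_assoc[symmetric] fun_eq_iff)
  ultimately show ?thesis unfolding eq by simp
qed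

lemma continuous_on_matrix_mult:
  fixes A B :: "'a::topological_space \<Rightarrow> ((real,'N) vec,'N) vec"
  assumes "\<And>i j. continuous_on S (\<lambda>x. A x $ i $ j)" "\<And>i j. continuous_on S (\<lambda>x. B x $ i $ j)"
  shows "continuous_on S (\<lambda>x. (A x ** B x) $ i $ j)"
  by (simp add: matrix_matrix_mult_def) (intro continuous_on_sum continuous_on_mult assms)

lemma continuous_on_jac:
  assumes F: "continuous_on UNIV F"
  shows "continuous_on UNIV (\<lambda>p. jac F s p $ i $ j)"
proof -
  have 1: "continuous_on UNIV (\<lambda>p. matrix (ltr (g p)) $ i $ j)" if "continuous_on UNIV g" for g :: "'N pt \<Rightarrow> 'N pt" and i j
    by (simp add: matrix_def ltr_def) (intro continuous_intros that)
  have 2: "continuous_on UNIV (\<lambda>p. Mat (blow F s p) $ i $ j)" for i j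
  proof -
    have m: "Mat (blow F s p) $ i $ j = integral (cbox (- One) One) (\<lambda>q. kernel j q * blow F s p q $ i)" for p
    proof -
      have "integral (cbox (- One) One) (\<lambda>q. kernel j q * blow F s p q $ i) =
        integral UNIV (\<lambda>q. if q \<in> cbox (- One) One then kernel j q * blow F s p q $ i else 0)"
        by (rule integral_restrict_UNIV[symmetric])
      also have "\<dots> = integral UNIV (\<lambda>q. kernel j q * blow F s p q $ i)"
      proof (rule arg_cong[where f = "integral UNIV"], rule ext)
        fix q
        have "kernel j q = 0" if "q \<notin> cbox (- One) One"
        proof -
          have "\<not> norm q \<le> 1"
          proof
            assume "norm q \<le> 1"
            then have "\<bar>q \<bullet> b\<bar> \<le> 1" if "b \<in> Basis" for b using Basis_le_norm[OF that, of q] by linarith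
            then have "q \<in> cbox (- One) One" by (simp add: mem_box abs_le_iff)
            then show False using that by simp
          qed
          then show ?thesis using bump_zero[of q] by (simp add: kernel_def)
        qed
        then show "(if q \<in> cbox (- One) One then kernel j q * blow F s p q $ i else 0) = kernel j q * blow F s p q $ i" by auto
      qed
      finally show ?thesis by (simp add: Mat_def)
    qed
    show ?thesis
      unfolding m
    proof (rule integral_continuous_on_param)
      have "continuous_on (UNIV \<times> cbox (- One) One) (\<lambda>x. kernel j (snd x) * blow F s (fst x) (snd x) $ i)"
        unfolding blow_def kernel_def
        by (intro continuous_intros continuous_on_compose_UNIV[OF F])
      then show "continuous_on (UNIV \<times> cbox (- One) One) (\<lambda>(p, q). kernel j q * blow F s p q $ i)"
        by (simp add: case_prod_unfold)
    qed
  qed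
  have 3: "continuous_on UNIV (\<lambda>p. matrix (ltr (- p)) $ i $ j)" for i j
    by (rule 1) (intro continuous_intros)
  show ?thesis unfolding jac_def
    by (intro continuous_on_matrix_mult) (rule 1[OF F] 2 3 continuous_on_const)+
qed

lemma fsm_close:
  assumes F: "continuous_on UNIV F" and "\<And>w. norm w \<le> 1 \<Longrightarrow> norm (F (p \<odot> dil s w) - F p) \<le> c"
  shows "norm (fsm F s p - F p) \<le> real CARD('N) * c"
  unfolding fsm_def
proof (rule avg_close)
  show "continuous_on UNIV (\<lambda>w. F (p \<odot> dil s (- w)))"
    by (rule continuous_on_compose_UNIV[OF F]) (intro continuous_intros)
qed (use assms(2) in simp)

lemma avg_cong: "(\<And>w. norm w \<le> 1 \<Longrightarrow> f w = g w) \<Longrightarrow> avg f = avg g"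
proof -
  assume *: "\<And>w. norm w \<le> 1 \<Longrightarrow> f w = g w"
  have "eta w * f w $ i = eta w * g w $ i" for w i
    using *[of w] eta_zero[of w] by (cases "norm w \<le> 1") auto
  then show ?thesis by (simp only: avg_def)
qed

text \<open>Left translation is affine and \<open>eta\<close> is even, so group averages of the
  identity are exact: where \<open>F\<close> is locally the identity, the mollified map equals it
  and is not merely close to it.\<close>

lemma fsm_id:
  assumes "\<And>w. norm w \<le> 1 \<Longrightarrow> F (p \<odot> dil s w) = p \<odot> dil s w"
  shows "fsm F s p = p"
proof -
  have "fsm F s p = avg (\<lambda>w. p + ltr p (dil s (- w)))"
    unfolding fsm_def by (rule avg_cong) (use assms in \<open>simp add: mul_eq_ltr\<close>)
  also have "\<dots> = avg (\<lambda>w. p) + avg (\<lambda>w. ltr p (dil s (- w)))"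
    by (rule avg_add) (intro continuous_intros)+
  also have "avg (\<lambda>w. ltr p (dil s (- w))) = 0"
    by (rule avg_odd) (intro continuous_intros, simp add: dil_minus linear_neg[OF linear_ltr])
  finally show ?thesis by simp
qed

end

section \<open>Homogeneous homomorphisms and compactness\<close>

text \<open>Tychonoff's theorem in a countable product, where compactness is sequential, takes the
  place of a diagonal argument.\<close>

lemma pointwise_convergent_subsequence:
  fixes f :: "nat \<Rightarrow> nat \<Rightarrow> 'a::euclidean_space"
  assumes "\<And>n i. norm (f n i) \<le> R i"
  obtains r l where "strict_mono (r::nat \<Rightarrow> nat)" "\<And>i. (\<lambda>n. f (r n) i) \<longlonglongrightarrow> l i"
proof -
  let ?K = "PiE UNIV (\<lambda>i. cball (0::'a) (R i))"
  have "compactin (product_topology (\<lambda>i::nat. euclidean) UNIV) ?K"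
    by (simp add: compactin_PiE)
  then have "compact ?K" by (simp add: euclidean_product_topology)
  then have "seq_compact ?K" by (rule compact_imp_seq_compact)
  moreover have "\<forall>n. f n \<in> ?K" using assms by auto
  ultimately obtain l r where r: "strict_mono r" "(f \<circ> r) \<longlonglongrightarrow> l"
    unfolding seq_compact_def by blast
  have "(\<lambda>n. f (r n) i) \<longlonglongrightarrow> l i" for i
    using continuous_on_tendsto_compose[where f = "\<lambda>x. x i", OF continuous_on_product_coordinates r(2)] by simp
  then show ?thesis using that r(1) by blast
qed

text \<open>The deviation \<open>g\<close> from homogeneity is additive and zero at the integers,
  hence periodic and therefore bounded; a bounded additive function vanishes.\<close>

lemma additive_bounded_imp_linear:
  fixes f :: "'a::real_normed_vector \<Rightarrow> 'b::real_normed_vector"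
  assumes add: "\<And>x y. f (x + y) = f x + f y" and bd: "\<And>x. norm (f x) \<le> K * norm x"
  shows "linear f"
proof (rule linearI[OF add])
  fix c x
  define g where "g c = f (c *\<^sub>R x) - c *\<^sub>R f x" for c :: real
  have gadd: "g (b + c) = g b + g c" for b c by (simp add: g_def scaleR_add_left add algebra_simps)
  have g1: "g 1 = 0" by (simp add: g_def)
  have g0: "g 0 = 0" using gadd[of 0 0] by simp
  have gneg: "g (- b) = - g b" for b using gadd[of b "- b"] g0 by (simp add: add_eq_0_iff2)
  have gn: "g (real n * b) = real n *\<^sub>R g b" for n b
    by (induction n) (simp_all add: g0 gadd algebra_simps)
  have gint: "g (of_int k) = 0" for k
  proof (cases k)
    case (nonneg n) then show ?thesis using gn[of n 1] g1 by simp
  next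
    case (neg n) then show ?thesis using gn[of "Suc n" 1] g1 gneg[of "real (Suc n)"] by (simp del: of_nat_Suc)
  qed
  define M where "M = \<bar>K\<bar> * norm x + norm (f x)"
  have gM: "norm (g b) \<le> M" for b
  proof -
    have "g b = g (frac b)" using gadd[of "frac b" "of_int \<lfloor>b\<rfloor>"] gint by (simp add: frac_def)
    moreover have "norm (f (frac b *\<^sub>R x)) \<le> \<bar>K\<bar> * norm x"
    proof -
      have "norm (f (frac b *\<^sub>R x)) \<le> K * norm (frac b *\<^sub>R x)" by (rule bd)
      also have "\<dots> \<le> \<bar>K\<bar> * norm (frac b *\<^sub>R x)" by (intro mult_right_mono) auto
      also have "\<dots> \<le> \<bar>K\<bar> * norm x"
        using frac_ge_0[of b] frac_lt_1[of b] by (intro mult_left_mono) (auto simp: mult_left_le_one_le)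
      finally show ?thesis .
    qed
    moreover have "norm (frac b *\<^sub>R f x) \<le> norm (f x)"
      using frac_ge_0[of b] frac_lt_1[of b] by (simp add: mult_left_le_one_le)
    ultimately show ?thesis
      using norm_triangle_ineq4[of "f (frac b *\<^sub>R x)" "frac b *\<^sub>R f x"] by (simp add: g_def M_def)
  qed
  have "norm (g c) = 0"
  proof (rule ccontr)
    assume "norm (g c) \<noteq> 0"
    then have p: "norm (g c) > 0" by simp
    obtain n :: nat where "M < real n * norm (g c)" using reals_Archimedean3[OF p] by blast
    then show False using gM[of "real n * c"] by (simp add: gn)
  qed
  then show "f (c *\<^sub>R x) = c *\<^sub>R f x" by (simp add: g_def)
qed

context heis_coords begin

lemma om_mul: "om (p \<odot> q) r = om p r + om q r" "om r (p \<odot> q) = om r p + om r q"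
  by (simp_all add: mul_def om_simps)

text \<open>Horizontal elements generate the centre through commutators; this is how the vertical
  direction is reached from assumptions on horizontal ones.\<close>

lemma commutator:
  assumes "hor e = e" "hor e' = e'"
  shows "(((w \<odot> e) \<odot> e') \<odot> (- e)) \<odot> (- e') = w \<odot> axis tau (4 * om e e')"
proof -
  have t: "e $ tau = 0" "e' $ tau = 0" using hor_nth(1)[of e] hor_nth(1)[of e'] assms by simp_all
  show ?thesis
    using om_swap[of e' e]
    by (intro vec_eqI) (simp_all add: om_mul om_simps t, simp_all add: axis_def)
qed

lemma hlip_norm_bound:
  assumes "hlip L G" "G 0 = 0"
  shows "norm (G w) \<le> L * nrm w + (L * nrm w)\<^sup>2"
  using hlip_dist[OF assms(1), of w 0] assms(2) by simp

text \<open>Only the horizontal part of \<open>G\<close> is assumed additive, and only under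
  horizontal right factors, since this is what the L^2 estimate gives in the limit. The behaviour of
  the vertical coordinate is derived from it and the Lipschitz bound.\<close>

context
  fixes G :: "'N pt \<Rightarrow> 'N pt" and L :: real
  assumes G: "hlip L G" and G0: "G 0 = 0"
    and add: "\<And>w e. hor e = e \<Longrightarrow> hor (G (w \<odot> e)) = hor (G w) + hor (G e)"
begin

lemma hom_neg: "hor e = e \<Longrightarrow> hor (G (- e)) = - hor (G e)"
  using add[of "- e" e] G0 by (simp add: hor_minus add_eq_0_iff)

lemma ex_commutator:
  obtains e e' where "hor e = e" "hor e' = e'" "om e e' = c"
proof -
  obtain i :: 'm where True by blast
  have "om (axis (yi i) c) (axis (xi i) 1) = c"
    by (simp add: om_def axis_def if_distrib[of "(*) _"] cong: if_cong)
  moreover have "hor (axis (yi i) c) = axis (yi i) c" "hor (axis (xi i) 1) = axis (xi i) (1::real)"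
    by (auto simp: hor_def axis_def vec_eq_iff)
  ultimately show ?thesis using that by blast
qed

text \<open>A vertical translation is a commutator of horizontal ones, whose contributions to the
  additive horizontal part cancel.\<close>

lemma hom_central: "hor (G (w \<odot> axis tau c)) = hor (G w)"
proof -
  obtain e e' where e: "hor e = e" "hor e' = e'" "om e e' = c / 4" by (rule ex_commutator)
  have n: "hor (- e) = - e" "hor (- e') = - e'" using e by (simp_all add: hor_minus)
  have "w \<odot> axis tau c = (((w \<odot> e) \<odot> e') \<odot> (- e)) \<odot> (- e')" using commutator[OF e(1,2), of w] e(3) by simp
  then show ?thesis by (simp add: add e n hom_neg)
qed

lemma hor_mul_tau: "w = hor w \<odot> axis tau (w $ tau)"
  by (simp add: mul_def) (rule hor_decomp)

lemma hom_hor: "hor (G w) = hor (G (hor w))"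
  using hom_central[of "hor w" "w $ tau"] hor_mul_tau[of w] by simp

lemma hom_additive: "hor (G (v + w)) = hor (G v) + hor (G w)"
proof -
  have "hor v + hor w = (hor v \<odot> hor w) \<odot> axis tau (- 2 * om v w)"
    by (simp add: mul_def scale_axis) (simp add: axis_def vec_eq_iff)
  then have "hor (G (hor v + hor w)) = hor (G (hor v)) + hor (G (hor w))"
    by (simp add: hom_central add)
  then show ?thesis using hom_hor[of "v + w"] hom_hor[of v] hom_hor[of w] by (simp add: hor_add)
qed

lemma linear_hor_hom: "linear (\<lambda>w. hor (G w))"
proof (rule additive_bounded_imp_linear[OF hom_additive])
  fix w
  have "norm (hor (G (hor w))) \<le> L * nrm (hor w)"
    using hlip_hor[OF G, of "hor w" 0] G0 by simp
  also have "\<dots> \<le> L * norm w"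
    using G norm_hor_le[of w] by (intro mult_left_mono) (auto simp: hlip_def nrm_def)
  finally show "norm (hor (G w)) \<le> L * norm w" by (simp add: hom_hor[symmetric])
qed

text \<open>Subdividing the segment from \<open>w\<close> to \<open>w \<odot> e\<close> makes the quadratic error in the contact
  condition disappear.\<close>

lemma hom_tau_step:
  assumes e: "hor e = e"
  shows "G (w \<odot> e) $ tau = G w $ tau + 2 * om (G w) (G e)"
proof -
  define a where "a = hor (G e)"
  define A where "A = hor (G w)"
  have scale: "hor (G (c *\<^sub>R e)) = c *\<^sub>R a" for c
    using linear_scale[OF linear_hor_hom, of c e] by (simp add: a_def)
  have hs: "hor (c *\<^sub>R e) = c *\<^sub>R e" for c using e by (simp add: hor_scale)
  have bd: "\<bar>G (w \<odot> e) $ tau - G w $ tau - 2 * om (G w) (G e)\<bar> \<le> (L * norm e)\<^sup>2 / real n" if n: "n \<ge> 1" for n :: nat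
  proof -
    define t where "t k = G (w \<odot> (real k / real n) *\<^sub>R e) $ tau" for k
    have step: "\<bar>t (Suc k) - t k - 2 / real n * om A a\<bar> \<le> (L * norm e)\<^sup>2 / (real n)\<^sup>2" for k
    proof -
      let ?p = "w \<odot> (real k / real n) *\<^sub>R e" and ?q = "w \<odot> (real (Suc k) / real n) *\<^sub>R e"
      have "?q = ?p \<odot> (1 / real n) *\<^sub>R e"
        by (simp only: mul_same_direction) (simp add: add_divide_distrib add.commute)
      then have "- ?p \<odot> ?q = (1 / real n) *\<^sub>R e" by simp
      moreover have "nrm ((1 / real n) *\<^sub>R e) = norm e / real n"
      proof -
        have "e $ tau = 0" using hor_nth(1)[of e] e by simp
        then show ?thesis by (simp add: nrm_def hs)
      qed
      ultimately have 1: "\<bar>t (Suc k) - t k - 2 * om (G ?p) (G ?q)\<bar> \<le> (L * (norm e / real n))\<^sup>2"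
        using hlip_tau[OF G, of ?q ?p] by (simp add: t_def)
      have "om (G ?p) (G ?q) = om (hor (G ?p)) (hor (G ?q))" by simp
      also have "\<dots> = om (A + (real k / real n) *\<^sub>R a) (A + (real (Suc k) / real n) *\<^sub>R a)"
        by (simp only: add[OF hs] scale A_def)
      \<comment> \<open>Because \<open>om a a = 0\<close>, each of the \<open>n\<close> steps
        contributes the same amount; the errors, of order \<open>1 / n\<^sup>2\<close> each, add up
        to order \<open>1 / n\<close>.\<close>
      also have "\<dots> = (real (Suc k) / real n) * om A a + (real k / real n) * om a A"
        by (simp only: om_simps om_self) simp
      also have "\<dots> = (real (Suc k) / real n - real k / real n) * om A a"
        using om_swap[of a A] by (simp add: algebra_simps)
      also have "\<dots> = 1 / real n * om A a" by (simp add: diff_divide_distrib[symmetric])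
      finally show ?thesis using 1 by (simp add: power_divide power_mult_distrib)
    qed
    have "(\<Sum>k<n. t (Suc k) - t k - 2 / real n * om A a) = t n - t 0 - 2 * om A a"
      using n sum_lessThan_telescope[of t n] by (simp add: sum_subtractf)
    moreover have "\<bar>\<Sum>k<n. t (Suc k) - t k - 2 / real n * om A a\<bar> \<le> (\<Sum>k<n. (L * norm e)\<^sup>2 / (real n)\<^sup>2)"
      by (rule order_trans[OF sum_abs sum_mono]) (rule step)
    moreover have "(\<Sum>k<n. (L * norm e)\<^sup>2 / (real n)\<^sup>2) = (L * norm e)\<^sup>2 / real n"
      using n by (simp add: power2_eq_square)
    moreover have "t n = G (w \<odot> e) $ tau" "t 0 = G w $ tau" using n by (simp_all add: t_def)
    moreover have "om A a = om (G w) (G e)" by (simp add: A_def a_def)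
    ultimately show ?thesis by simp
  qed
  have "((\<lambda>n. (L * norm e)\<^sup>2 / real n) \<longlongrightarrow> 0) sequentially" by (rule lim_const_over_n)
  then have "\<bar>G (w \<odot> e) $ tau - G w $ tau - 2 * om (G w) (G e)\<bar> \<le> 0"
    by (rule tendsto_lowerbound) (auto intro!: eventually_sequentiallyI[of 1] bd)
  then show ?thesis by simp
qed

text \<open>Four applications of \<open>hom_tau_step\<close> along the commutator. The left side
  sees only the number \<open>om e e'\<close>, and this will force \<open>om (G e) (G e')\<close> to
  be proportional to it.\<close>

lemma hom_tau_commutator:
  assumes e: "hor e = e" "hor e' = e'"
  shows "G (w \<odot> axis tau (4 * om e e')) $ tau = G w $ tau + 4 * om (G e) (G e')"
proof -
  have n: "hor (- e) = - e" "hor (- e') = - e'" using e by (simp_all add: hor_minus)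
  define A a b where "A = hor (G w)" "a = hor (G e)" "b = hor (G e')"
  have na: "hor (G (- e)) = - a" "hor (G (- e')) = - b" using e by (simp_all add: hom_neg A_a_b_def)
  have X: "om (G p) (G q) = om (hor (G p)) (hor (G q))" for p q by simp
  have "G ((((w \<odot> e) \<odot> e') \<odot> (- e)) \<odot> (- e')) $ tau = G w $ tau +
     2 * om A a + 2 * om (A + a) b + 2 * om (A + a + b) (- a) + 2 * om (A + a + b + - a) (- b)"
    unfolding hom_tau_step[OF n(2)] hom_tau_step[OF n(1)] hom_tau_step[OF e(2)] hom_tau_step[OF e(1)] X
    by (simp only: add[OF n(1)] add[OF e(1)] add[OF e(2)] na A_a_b_def[symmetric])
  also have "\<dots> = G w $ tau + 4 * om a b"
    using om_swap[of b a] by (simp add: om_simps)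
  finally show ?thesis unfolding commutator[OF e] by (simp add: A_a_b_def)
qed

lemma hom_structure:
  obtains lam where "linear G" "\<And>u v. om (G u) (G v) = lam * om u v" "\<And>v. G v $ tau = lam * v $ tau"
proof -
  define lam where "lam = G (axis tau 1) $ tau"
  \<comment> \<open>The value 1/4 makes the commutator of \<open>e0\<close> and \<open>e1\<close>
    the unit vertical vector.\<close>
  obtain e0 e1 where e01: "hor e0 = e0" "hor e1 = e1" "om e0 e1 = 1 / 4" by (rule ex_commutator)
  have lin0: "linear (\<lambda>w. hor (G w))" by (rule linear_hor_hom)
  have om_scale: "om (G (c *\<^sub>R u)) (G v) = c * om (G u) (G v)" for c u v
  proof -
    have "om (hor (G (c *\<^sub>R u))) (hor (G v)) = c * om (hor (G u)) (hor (G v))"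
      by (simp only: linear_scale[OF lin0] om_scale_left)
    then show ?thesis by simp
  qed
  have lam0: "lam = 4 * om (G e0) (G e1)"
    using hom_tau_commutator[OF e01(1,2), of 0] e01(3) G0 by (simp add: lam_def)
  have vert: "G (w \<odot> axis tau c) $ tau = G w $ tau + c * lam" for w c
  proof -
    have h: "hor (c *\<^sub>R e0) = c *\<^sub>R e0" using e01 by (simp add: hor_scale)
    show ?thesis
      using hom_tau_commutator[OF h e01(2), of w] by (simp add: om_scale_left om_scale e01(3) lam0)
  qed
  have tau: "G w $ tau = lam * w $ tau" for w
  proof -
    have "G (hor w) $ tau = 0" using hom_tau_step[of "hor w" 0] G0 by simp
    then show ?thesis using vert[of "hor w" "w $ tau"] hor_mul_tau[of w] by (simp add: mult.commute)
  qed
  have omh: "om (G e) (G e') = lam * om e e'" if "hor e = e" "hor e' = e'" for e e'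
    using hom_tau_commutator[OF that, of 0] G0 tau[of "axis tau (4 * om e e')"] by simp
  have om: "om (G u) (G v) = lam * om u v" for u v
  proof -
    have "om (G u) (G v) = om (hor (G u)) (hor (G v))" by simp
    also have "\<dots> = om (hor (G (hor u))) (hor (G (hor v)))" by (simp only: hom_hor[symmetric])
    also have "\<dots> = lam * om (hor u) (hor v)" using omh[of "hor u" "hor v"] by simp
    finally show ?thesis by simp
  qed
  have Geq: "G = (\<lambda>w. hor (G w) + (lam * w $ tau) *\<^sub>R axis tau 1)"
    by (rule ext) (metis hor_decomp tau scale_axis mult.right_neutral)
  have "linear G"
    by (subst Geq, rule linear_compose_add[OF lin0], rule linearI) (simp_all add: algebra_simps)
  then show ?thesis using that om tau by blast
qed

lemma hom_det_nonneg: assumes "odd CARD('m)" shows "det (Mat G) \<ge> 0"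
proof -
  obtain lam where l: "linear G" "\<And>u v. om (G u) (G v) = lam * om u v" "\<And>v. G v $ tau = lam * v $ tau"
    by (rule hom_structure) blast
  show ?thesis unfolding Mat_linear[OF l(1)] by (rule conformal_det_nonneg[OF assms l])
qed

end

section \<open>Compactness of Lipschitz maps that fix the origin\<close>

lemma nrm_minus: "nrm (- p) = nrm p" by (simp add: nrm_def hor_minus)

lemma integrable_kernel_mult:
  assumes "continuous_on UNIV G" shows "(\<lambda>q. kernel j q * G q $ i) integrable_on UNIV"
  by (rule csupp_integrable, rule csupp_mult_continuous[OF csupp_kernel]) (intro continuous_intros assms)

text \<open>Dominated convergence applies because maps with a common Lipschitz constant that fix the
  origin have a common bound on the support of \<open>kernel\<close>.\<close>

lemma Mat_tendsto:
  assumes Gn: "\<And>n. hlip L (G n)" "\<And>n. G n 0 = 0" and lim: "\<And>w. (\<lambda>n. G n w) \<longlonglongrightarrow> H w"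
  shows "(\<lambda>n. det (Mat (G n))) \<longlonglongrightarrow> det (Mat H)"
proof -
  have "(\<lambda>n. Mat (G n) $ i $ j) \<longlonglongrightarrow> Mat H $ i $ j" for i j
  proof -
    define b where "b q = \<bar>kernel j q\<bar> * (L * nrm q + (L * nrm q)\<^sup>2)" for q
    have cb: "csupp (\<lambda>q. \<bar>kernel j q\<bar>)"
      using csupp_combine[OF csupp_kernel csupp_kernel, of "\<lambda>x y. \<bar>x\<bar>"] csupp_continuous[OF csupp_kernel]
      by (simp add: continuous_on_rabs)
    have "(\<lambda>n. integral UNIV (\<lambda>q. kernel j q * G n q $ i)) \<longlonglongrightarrow> integral UNIV (\<lambda>q. kernel j q * H q $ i)"
    proof (rule dominated_convergence(2))
      show "(\<lambda>q. kernel j q * G n q $ i) integrable_on UNIV" for n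
        by (rule integrable_kernel_mult[OF hlip_continuous[OF Gn(1)]])
      show "b integrable_on UNIV" unfolding b_def[abs_def]
        by (rule csupp_integrable, rule csupp_mult_continuous[OF cb]) (intro continuous_intros)
      show "norm (kernel j q * G n q $ i) \<le> b q" for n q
      proof -
        have "\<bar>G n q $ i\<bar> \<le> L * nrm q + (L * nrm q)\<^sup>2"
          using component_le_norm_cart[of "G n q" i] hlip_norm_bound[OF Gn, of n q] by simp
        then show ?thesis unfolding b_def by (simp add: abs_mult mult_left_mono)
      qed
      show "(\<lambda>n. kernel j q * G n q $ i) \<longlonglongrightarrow> kernel j q * H q $ i" for q
        by (intro tendsto_intros lim)
    qed
    then show ?thesis by (simp add: Mat_def)
  qed
  then show ?thesis unfolding det_def
    by (intro tendsto_sum tendsto_mult tendsto_prod tendsto_const)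
qed

text \<open>Intended for the points where a blow-up is far from a homomorphism: the determinant has
  no sign there, so a uniform bound must be combined with the small measure of that set.\<close>

lemma det_Mat_bound:
  obtains K where "K \<ge> 0" "\<And>G. hlip L G \<Longrightarrow> G 0 = 0 \<Longrightarrow> \<bar>det (Mat G)\<bar> \<le> K"
proof -
  have "\<exists>B. \<forall>G i j. hlip L G \<longrightarrow> G 0 = 0 \<longrightarrow> \<bar>Mat G $ i $ j\<bar> \<le> B"
  proof -
    have "\<exists>B. \<forall>G i. hlip L G \<longrightarrow> G 0 = 0 \<longrightarrow> \<bar>Mat G $ i $ j\<bar> \<le> B" for j
    proof -
      define b where "b q = \<bar>kernel j q\<bar> * (L * nrm q + (L * nrm q)\<^sup>2)" for q
      have cb: "csupp (\<lambda>q. \<bar>kernel j q\<bar>)"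
        using csupp_combine[OF csupp_kernel csupp_kernel, of "\<lambda>x y. \<bar>x\<bar>"] csupp_continuous[OF csupp_kernel]
        by (simp add: continuous_on_rabs)
      have bi: "b integrable_on UNIV" unfolding b_def[abs_def]
        by (rule csupp_integrable, rule csupp_mult_continuous[OF cb]) (intro continuous_intros)
      have "\<bar>Mat G $ i $ j\<bar> \<le> integral UNIV b" if G: "hlip L G" "G 0 = 0" for G i
      proof -
        have "norm (integral UNIV (\<lambda>q. kernel j q * G q $ i)) \<le> integral UNIV b"
        proof (rule integral_norm_bound_integral[OF integrable_kernel_mult[OF hlip_continuous[OF G(1)]] bi])
          show "norm (kernel j q * G q $ i) \<le> b q" for q
          proof -
            have "\<bar>G q $ i\<bar> \<le> L * nrm q + (L * nrm q)\<^sup>2"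
              using component_le_norm_cart[of "G q" i] hlip_norm_bound[OF G, of q] by simp
            then show ?thesis unfolding b_def by (simp add: abs_mult mult_left_mono)
          qed
        qed
        then show ?thesis by (simp add: Mat_def)
      qed
      then show ?thesis by blast
    qed
    then obtain B where B: "\<And>j G i. hlip L G \<Longrightarrow> G 0 = 0 \<Longrightarrow> \<bar>Mat G $ i $ j\<bar> \<le> B j" by metis
    have "B j \<le> (\<Sum>j\<in>UNIV. \<bar>B j\<bar>)" for j
      using member_le_sum[of j UNIV "\<lambda>j. \<bar>B j\<bar>"] by (simp add: abs_le_iff)
    then show ?thesis using B order_trans by blast
  qed
  then obtain B where B: "\<And>G i j. hlip L G \<Longrightarrow> G 0 = 0 \<Longrightarrow> \<bar>Mat G $ i $ j\<bar> \<le> B" by blast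
  define K where "K = (\<Sum>p | p permutes (UNIV::'N set). \<bar>B\<bar> ^ CARD('N))"
  have "\<bar>det (Mat G)\<bar> \<le> K" if G: "hlip L G" "G 0 = 0" for G
  proof -
    have "\<bar>det (Mat G)\<bar> \<le> (\<Sum>p | p permutes (UNIV::'N set). \<bar>of_int (sign p) * (\<Prod>i\<in>UNIV. Mat G $ i $ p i)\<bar>)"
      unfolding det_def by (rule sum_abs)
    also have "\<dots> \<le> K"
      unfolding K_def
    proof (rule sum_mono)
      fix p assume "p \<in> {p. p permutes (UNIV::'N set)}"
      have "\<bar>of_int (sign p) * (\<Prod>i\<in>UNIV. Mat G $ i $ p i)\<bar> = (\<Prod>i\<in>UNIV. \<bar>Mat G $ i $ p i\<bar>)"
        by (simp add: abs_mult abs_prod sign_def)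
      also have "\<dots> \<le> (\<Prod>i\<in>(UNIV::'N set). \<bar>B\<bar>)"
        using B[OF G] by (intro prod_mono) (auto intro: order_trans[OF _ abs_ge_self])
      finally show "\<bar>of_int (sign p) * (\<Prod>i\<in>UNIV. Mat G $ i $ p i)\<bar> \<le> \<bar>B\<bar> ^ CARD('N)" by simp
    qed
    finally show ?thesis .
  qed
  moreover have "K \<ge> 0" unfolding K_def by (intro sum_nonneg) simp
  ultimately show ?thesis using that by blast
qed

lemma hlip_pointwise_limit:
  assumes "\<And>n. hlip L (G n)" and lim: "\<And>w. (\<lambda>n. G n w) \<longlonglongrightarrow> H w"
  shows "hlip L H"
  unfolding hlip_def
proof (intro conjI allI)
  show "0 \<le> L" using assms(1)[of 0] by (simp add: hlip_def)
  fix p q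
  have c: "continuous_on UNIV (\<lambda>x::'N pt \<times> 'N pt. nrm (- fst x \<odot> snd x))" by (intro continuous_intros)
  have "(\<lambda>n. (G n p, G n q)) \<longlonglongrightarrow> (H p, H q)" by (intro tendsto_intros lim)
  then have "(\<lambda>n. nrm (- G n p \<odot> G n q)) \<longlonglongrightarrow> nrm (- H p \<odot> H q)"
    using continuous_on_tendsto_compose[OF c] by fastforce
  then show "nrm (- H p \<odot> H q) \<le> L * nrm (- p \<odot> q)"
    by (rule LIMSEQ_le_const2) (use assms(1) in \<open>auto simp: hlip_def\<close>)
qed

text \<open>Arzela-Ascoli: convergence is arranged on a countable dense set, and the common modulus
  of continuity from \<open>hlip_dist\<close> carries it to every point.\<close>

lemma hlip_compactness:
  assumes Gn: "\<And>n. hlip L (G n)" "\<And>n. G n 0 = 0"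
  obtains r H where "strict_mono (r::nat \<Rightarrow> nat)" "\<And>w. (\<lambda>n. G (r n) w) \<longlonglongrightarrow> H w"
proof -
  obtain D :: "'N pt set" where D: "countable D" "\<And>X. open X \<Longrightarrow> X \<noteq> {} \<Longrightarrow> \<exists>d\<in>D. d \<in> X"
    using countable_dense_exists by blast
  have Dne: "D \<noteq> {}" using D(2)[of UNIV] by auto
  define d where "d = from_nat_into D"
  have "norm (G n (d i)) \<le> L * nrm (d i) + (L * nrm (d i))\<^sup>2" for n i
    by (rule hlip_norm_bound[OF Gn])
  from pointwise_convergent_subsequence[of "\<lambda>n i. G n (d i)", OF this]
  obtain r l where r: "strict_mono (r::nat \<Rightarrow> nat)" "\<And>i. (\<lambda>n. G (r n) (d i)) \<longlonglongrightarrow> l i" by blast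
  have "\<exists>h. (\<lambda>n. G (r n) w) \<longlonglongrightarrow> h" for w
  proof -
    have "Cauchy (\<lambda>n. G (r n) w)"
      unfolding Cauchy_def
    proof (intro allI impI)
      fix e :: real assume e: "e > 0"
      define c where "c q = (L * nrm (- w \<odot> q)) * (1 + 2 * (L * nrm w + (L * nrm w)\<^sup>2)) + (L * nrm (- w \<odot> q))\<^sup>2" for q
      have "continuous_on UNIV c" unfolding c_def by (intro continuous_intros)
      then have "open {q. c q < e / 3}" by (intro open_Collect_less continuous_on_const)
      moreover have "w \<in> {q. c q < e / 3}" using e by (simp add: c_def)
      ultimately obtain i where i: "c (d i) < e / 3"
        using D(2)[of "{q. c q < e / 3}"] from_nat_into_surj[OF D(1)] unfolding d_def by (metis (mono_tags) empty_iff mem_Collect_eq)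
      have close: "dist (G n (d i)) (G n w) < e / 3" for n
      proof -
        have "norm (hor (G n w)) \<le> L * nrm w + (L * nrm w)\<^sup>2"
          using norm_hor_le hlip_norm_bound[OF Gn, of n w] order_trans by blast
        moreover have "0 \<le> L * nrm (- w \<odot> d i)" using Gn(1)[of n] by (simp add: hlip_def nrm_nonneg)
        ultimately have "(L * nrm (- w \<odot> d i)) * (1 + 2 * norm (hor (G n w))) \<le>
            (L * nrm (- w \<odot> d i)) * (1 + 2 * (L * nrm w + (L * nrm w)\<^sup>2))"
          by (intro mult_left_mono) auto
        then have "norm (G n (d i) - G n w) \<le> c (d i)"
          using hlip_dist[OF Gn(1), of n "d i" w] by (simp add: c_def)
        then show ?thesis using i by (simp add: dist_norm)
      qed
      have "Cauchy (\<lambda>n. G (r n) (d i))" using r(2) LIMSEQ_imp_Cauchy by blast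
      then obtain M where M: "\<And>m n. m \<ge> M \<Longrightarrow> n \<ge> M \<Longrightarrow> dist (G (r m) (d i)) (G (r n) (d i)) < e / 3"
        unfolding Cauchy_def using e by (meson zero_less_divide_iff zero_less_numeral)
      have "dist (G (r m) w) (G (r n) w) < e" if "m \<ge> M" "n \<ge> M" for m n
      proof -
        have "dist (G (r m) w) (G (r n) w) \<le> dist (G (r m) w) (G (r m) (d i)) +
            dist (G (r m) (d i)) (G (r n) (d i)) + dist (G (r n) (d i)) (G (r n) w)"
          using dist_triangle[of "G (r m) w" "G (r n) w" "G (r m) (d i)"]
            dist_triangle[of "G (r m) (d i)" "G (r n) w" "G (r n) (d i)"] by linarith
        then show ?thesis using M[OF that] close[of "r m"] close[of "r n"] by (simp add: dist_commute)
      qed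
      then show "\<exists>M. \<forall>m\<ge>M. \<forall>n\<ge>M. dist (G (r m) w) (G (r n) w) < e" by blast
    qed
    then show ?thesis by (simp add: Cauchy_convergent_iff convergent_def)
  qed
  then obtain H where "\<And>w. (\<lambda>n. G (r n) w) \<longlonglongrightarrow> H w" by metis
  then show ?thesis using that r(1) by blast
qed

definition hdefect :: "('N pt \<Rightarrow> 'N pt) \<Rightarrow> 'N pt \<Rightarrow> 'N pt \<Rightarrow> 'N pt"
  where "hdefect G w e = hor (G (w \<odot> e)) - hor (G w) - hor (G e)"

text \<open>By compactness, finitely many almost satisfied homomorphism equations already force the
  determinant to be almost nonnegative.\<close>

lemma det_Mat_almost_nonneg:
  assumes odd: "odd CARD('m)" and \<eta>: "\<eta> > 0"
  obtains T \<delta> where "finite T" "\<delta> > 0" "\<And>w e. (w, e) \<in> T \<Longrightarrow> hor e = e"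
    "\<forall>G. hlip L G \<longrightarrow> G 0 = 0 \<longrightarrow> (\<forall>w e. (w, e) \<in> T \<longrightarrow> norm (hdefect G w e) < \<delta>) \<longrightarrow> det (Mat G) \<ge> - \<eta>"
proof (rule ccontr)
  note witness = that
  assume neg: "\<not> thesis"
  obtain D :: "'N pt set" where D: "countable D" "\<And>X. open X \<Longrightarrow> X \<noteq> {} \<Longrightarrow> \<exists>d\<in>D. d \<in> X"
    using countable_dense_exists by blast
  have Dne: "D \<noteq> {}" using D(2)[of UNIV] by auto
  define d where "d = from_nat_into D"
  \<comment> \<open>Growing finite pieces of a dense set of pairs. If none of them worked, the
    counterexamples \<open>G n\<close> would have a limit that satisfies all the equations exactly
    while its determinant is at most \<open>- \<eta>\<close>.\<close>
  define T where "T n = (\<lambda>(i, j). (d i, hor (d j))) ` ({..n} \<times> {..n})" for n :: nat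
  have "\<exists>G. hlip L G \<and> G 0 = 0 \<and> (\<forall>w e. (w, e) \<in> T n \<longrightarrow> norm (hdefect G w e) < 1 / real (Suc n)) \<and> det (Mat G) < - \<eta>" for n
  proof (rule ccontr)
    assume "\<nexists>G. hlip L G \<and> G 0 = 0 \<and> (\<forall>w e. (w, e) \<in> T n \<longrightarrow> norm (hdefect G w e) < 1 / real (Suc n)) \<and> det (Mat G) < - \<eta>"
    then have *: "det (Mat G) \<ge> - \<eta>" if "hlip L G" "G 0 = 0"
      "\<And>w e. (w, e) \<in> T n \<Longrightarrow> norm (hdefect G w e) < 1 / real (Suc n)" for G
      using that not_less by blast
    have thesis
    proof (rule witness[of "T n" "1 / real (Suc n)"])
      show "hor e = e" if "(w, e) \<in> T n" for w e using that by (auto simp: T_def)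
      show "\<forall>G. hlip L G \<longrightarrow> G 0 = 0 \<longrightarrow> (\<forall>w e. (w, e) \<in> T n \<longrightarrow> norm (hdefect G w e) < 1 / real (Suc n)) \<longrightarrow> det (Mat G) \<ge> - \<eta>"
        by (intro allI impI *) blast+
    qed (simp_all add: T_def)
    then show False using neg by simp
  qed
  then have "\<forall>n. \<exists>G. hlip L G \<and> G 0 = 0 \<and> (\<forall>w e. (w, e) \<in> T n \<longrightarrow> norm (hdefect G w e) < 1 / real (Suc n)) \<and> det (Mat G) < - \<eta>"
    by blast
  from choice[OF this] obtain G where G: "\<And>n. hlip L (G n)" "\<And>n. G n 0 = 0"
    "\<And>n w e. (w, e) \<in> T n \<Longrightarrow> norm (hdefect (G n) w e) < 1 / real (Suc n)" "\<And>n. det (Mat (G n)) < - \<eta>"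
    by blast
  obtain r H where r: "strict_mono (r::nat \<Rightarrow> nat)" "\<And>w. (\<lambda>n. G (r n) w) \<longlonglongrightarrow> H w"
    by (rule hlip_compactness[of L G, OF G(1) G(2)]) (rule that)
  have H: "hlip L H" by (rule hlip_pointwise_limit[OF G(1) r(2)])
  have H0: "H 0 = 0" using r(2)[of 0] G(2) by (simp add: LIMSEQ_const_iff)
  have tends: "(\<lambda>n. hdefect (G (r n)) w e) \<longlonglongrightarrow> hdefect H w e" for w e
    unfolding hdefect_def by (intro tendsto_intros bounded_linear.tendsto[OF bounded_linear_hor] r(2))
  have dense0: "hdefect H (d i) (hor (d j)) = 0" for i j
  proof -
    have "(\<lambda>n. norm (hdefect (G (r n)) (d i) (hor (d j)))) \<longlonglongrightarrow> 0"
    proof (rule tendsto_sandwich[OF _ _ tendsto_const LIMSEQ_inverse_real_of_nat])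
      show "\<forall>\<^sub>F n in sequentially. norm (hdefect (G (r n)) (d i) (hor (d j))) \<le> inverse (real (Suc n))"
      proof (rule eventually_sequentiallyI[of "max i j"])
        fix n assume n: "max i j \<le> n"
        have rn: "n \<le> r n" using seq_suble[OF r(1)] .
        then have "(d i, hor (d j)) \<in> T (r n)" using n by (auto simp: T_def intro!: image_eqI[of _ _ "(i, j)"])
        then have "norm (hdefect (G (r n)) (d i) (hor (d j))) < 1 / real (Suc (r n))" by (rule G(3))
        also have "\<dots> \<le> inverse (real (Suc n))" using rn by (simp add: inverse_eq_divide frac_le)
        finally show "norm (hdefect (G (r n)) (d i) (hor (d j))) \<le> inverse (real (Suc n))" by simp
      qed
    qed simp
    then have "(\<lambda>n. hdefect (G (r n)) (d i) (hor (d j))) \<longlonglongrightarrow> 0" by (simp add: tendsto_norm_zero_iff)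
    then show ?thesis using tends LIMSEQ_unique by blast
  qed
  have cH: "continuous_on UNIV H" by (rule hlip_continuous[OF H])
  define h where "h x = hdefect H (fst x) (hor (snd x))" for x :: "'N pt \<times> 'N pt"
  have ch: "continuous_on UNIV h"
    unfolding h_def hdefect_def by (intro continuous_intros continuous_on_compose_UNIV[OF cH])
  have h0: "h x = 0" for x
  proof (rule ccontr)
    assume x: "h x \<noteq> 0"
    have "open (h -` (- {0}))" using open_vimage[OF _ ch] by (simp add: open_Compl)
    then obtain A B where AB: "open A" "open B" "x \<in> A \<times> B" "A \<times> B \<subseteq> h -` (- {0})"
      by (rule open_prod_elim[of _ x]) (use x in simp)
    then have ne: "A \<noteq> {}" "B \<noteq> {}" by auto
    obtain a b where ab: "a \<in> D" "a \<in> A" "b \<in> D" "b \<in> B" using D(2)[OF AB(1) ne(1)] D(2)[OF AB(2) ne(2)] by blast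
    obtain i j where "d i = a" "d j = b"
      using from_nat_into_surj[OF D(1) ab(1)] from_nat_into_surj[OF D(1) ab(3)] unfolding d_def by blast
    then have "h (a, b) = 0" using dense0[of i j] by (simp add: h_def)
    then show False using AB(4) ab by blast
  qed
  have "hor (H (w \<odot> e)) = hor (H w) + hor (H e)" if "hor e = e" for w e
    using h0[of "(w, e)"] that by (simp add: h_def hdefect_def algebra_simps)
  then have "det (Mat H) \<ge> 0" by (rule hom_det_nonneg[OF H H0 _ odd])
  moreover have "(\<lambda>n. det (Mat (G (r n)))) \<longlonglongrightarrow> det (Mat H)"
    by (rule Mat_tendsto[OF G(1,2) r(2)])
  then have "det (Mat H) \<le> - \<eta>" by (rule LIMSEQ_le_const2) (use G(4) in \<open>auto intro: less_imp_le\<close>)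
  ultimately show False using \<eta> by simp
qed

end

section \<open>Lipschitz maps do not cover twice\<close>

context heis_coords begin

text \<open>The homomorphism defect of a blow-up is the change of a difference quotient of
  \<open>F\<close> under translation by \<open>dil s w\<close>. In a horizontal coordinate the
  identity has the same quotient everywhere, so subtracting it changes nothing and produces
  functions of compact support.\<close>

lemma hdefect_blow_nth:
  assumes s: "s > 0" and e: "hor e = e" and i: "i \<noteq> tau"
  shows "hdefect (blow F s p) w e $ i =
    dq (\<lambda>q. (F q - q) $ i) e s (p \<odot> dil s w) - dq (\<lambda>q. (F q - q) $ i) e s p"
proof -
  have de: "dil s e = s *\<^sub>R e"
  proof -
    have "e $ tau = 0" using hor_nth(1)[of e] e by simp
    then show ?thesis by (simp add: vec_eq_iff dil_def)
  qed
  have b: "blow F s p v $ i = (F (p \<odot> dil s v) $ i - F p $ i) / s" for v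
    using i by (simp add: blow_def)
  show ?thesis
    using s i by (simp add: hdefect_def b dq_def dil_mul de mul_assoc field_simps)
qed

lemma hlip_remainder:
  assumes F: "hlip L F" and i: "i \<noteq> tau"
  shows "\<bar>(F (p \<odot> q) - (p \<odot> q)) $ i - (F p - p) $ i\<bar> \<le> (L + 1) * nrm q"
proof -
  have "\<bar>(hor (F (p \<odot> q)) - hor (F p)) $ i\<bar> \<le> L * nrm q"
    using component_le_norm_cart[of "hor (F (p \<odot> q)) - hor (F p)" i] hlip_hor[OF F, where p = p and q = "p \<odot> q"] by simp
  then have "\<bar>F (p \<odot> q) $ i - F p $ i\<bar> \<le> L * nrm q" using i by simp
  moreover have "\<bar>q $ i\<bar> \<le> nrm q"
    using component_le_norm_cart[of "hor q" i] nrm_hor[of q] i by simp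
  ultimately show ?thesis using i by (simp add: algebra_simps)
qed

text \<open>A Chebyshev argument. Where the finitely many defects are all below
  \<open>\<delta>\<close>, the determinant is at least \<open>- \<eta>\<close>. Elsewhere the sum of
  their squares is at least \<open>\<delta>\<^sup>2\<close>, its integral is small by the L^2
  estimate, and the determinant is at most \<open>Kd\<close> in absolute value.\<close>

lemma negative_part_small:
  assumes odd: "odd CARD('m)" and F: "hlip L F" and K: "compact K" "\<And>p. p \<notin> K \<Longrightarrow> F p = p" and \<epsilon>: "\<epsilon> > 0"
  obtains s0 where "s0 > 0" "\<And>s. 0 < s \<Longrightarrow> s < s0 \<Longrightarrow>
    integral (cbox a b) (\<lambda>p. \<bar>det (jac F s p)\<bar> - det (jac F s p)) \<le> \<epsilon>"
proof -
  have cF: "continuous_on UNIV F" by (rule hlip_continuous[OF F])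
  obtain Kd where Kd: "Kd \<ge> 0" "\<And>G. hlip L G \<Longrightarrow> G 0 = 0 \<Longrightarrow> \<bar>det (Mat G)\<bar> \<le> Kd"
    using det_Mat_bound by blast
  define V where "V = measure lborel (cbox a b)"
  have V: "V \<ge> 0" by (simp add: V_def)
  define \<eta> where "\<eta> = \<epsilon> / (4 * (V + 1))"
  have \<eta>: "\<eta> > 0" using \<epsilon> V by (simp add: \<eta>_def)
  obtain T \<delta> where T: "finite T" "\<delta> > 0" "\<And>w e. (w, e) \<in> T \<Longrightarrow> hor e = e" and
    Tdet: "\<forall>G. hlip L G \<longrightarrow> G 0 = 0 \<longrightarrow> (\<forall>w e. (w, e) \<in> T \<longrightarrow> norm (hdefect G w e) < \<delta>) \<longrightarrow> det (Mat G) \<ge> - \<eta>"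
    by (rule det_Mat_almost_nonneg[OF odd \<eta>, where L = L]) (rule that)
  define u where "u i q = (F q - q) $ i" for i q
  have cu: "csupp (u i)" for i
    unfolding u_def[abs_def] by (rule csuppI[OF _ K(1)]) (intro continuous_intros cF, simp add: K(2))
  define f where "f s i w e p = (dq (u i) e s (p \<odot> dil s w) - dq (u i) e s p)\<^sup>2" for s i w e p
  have cf: "csupp (f s i w e)" for s i w e
    unfolding f_def[abs_def] by (intro csupp_square csupp_diff csupp_translate csupp_dq cu)
  define I where "I = T \<times> (UNIV - {tau})"
  have fI: "finite I" using T(1) by (simp add: I_def)
  \<comment> \<open>Together with the choice of \<open>\<eta>\<close>, this lets the good points and
    the bad points each contribute at most \<open>\<epsilon> / 2\<close>.\<close>
  define \<epsilon>' where "\<epsilon>' = \<epsilon> * \<delta>\<^sup>2 / (4 * (Kd + 1) * (real (card I) + 1))"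
  have \<epsilon>': "\<epsilon>' > 0" using \<epsilon> T(2) Kd(1) by (simp add: \<epsilon>'_def)
  have "\<exists>d>0. \<forall>r. 0 < r \<longrightarrow> r < d \<longrightarrow> integral UNIV (f r i w e) \<le> \<epsilon>'" if "((w, e), i) \<in> I" for w e i
  proof -
    have e: "hor e = e" and i: "i \<noteq> tau" using that T(3) by (auto simp: I_def)
    have L1: "0 \<le> L + 1" using F by (simp add: hlip_def)
    obtain d where "0 < d" "\<And>r. 0 < r \<Longrightarrow> r < d \<Longrightarrow>
        integral UNIV (\<lambda>p. (dq (u i) e r (p \<odot> dil r w) - dq (u i) e r p)\<^sup>2) \<le> \<epsilon>'"
      by (rule dq_translation_L2_tendsto[OF cu[of i] L1 hlip_remainder[OF F i, folded u_def] e \<epsilon>', where w = w]) (rule that)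
    then show ?thesis unfolding f_def by blast
  qed
  then have "\<forall>x\<in>I. \<exists>d>0. \<forall>r. 0 < r \<longrightarrow> r < d \<longrightarrow> integral UNIV (f r (snd x) (fst (fst x)) (snd (fst x))) \<le> \<epsilon>'"
    by auto
  from bchoice[OF this] obtain d where d: "\<And>x. x \<in> I \<Longrightarrow> d x > 0"
    "\<And>x r. x \<in> I \<Longrightarrow> 0 < r \<Longrightarrow> r < d x \<Longrightarrow> integral UNIV (f r (snd x) (fst (fst x)) (snd (fst x))) \<le> \<epsilon>'"
    by blast
  define s0 where "s0 = Min (insert 1 (d ` I))"
  have s0: "s0 > 0" using fI d(1) by (simp add: s0_def)
  have s0d: "s0 \<le> d x" if "x \<in> I" for x using fI that by (simp add: s0_def)
  have "integral (cbox a b) (\<lambda>p. \<bar>det (jac F s p)\<bar> - det (jac F s p)) \<le> \<epsilon>" if s: "0 < s" "s < s0" for s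
  proof -
    let ?g = "\<lambda>p. \<Sum>x\<in>I. f s (snd x) (fst (fst x)) (snd (fst x)) p"
    have cg: "csupp ?g" by (intro csupp_sum fI cf)
    have pt: "\<bar>det (jac F s p)\<bar> - det (jac F s p) \<le> 2 * \<eta> + 2 * Kd / \<delta>\<^sup>2 * ?g p" for p
    proof -
      let ?G = "blow F s p"
      have G: "hlip L ?G" "?G 0 = 0" using hlip_blow[OF F s(1)] by simp_all
      have gn: "0 \<le> ?g p" by (intro sum_nonneg) (simp add: f_def)
      have tn: "(norm (hdefect ?G w e))\<^sup>2 \<le> ?g p" if we: "(w, e) \<in> T" for w e
      proof -
        have e: "hor e = e" using T(3)[OF we] .
        have "hdefect ?G w e $ tau = 0" by (simp add: hdefect_def)
        then have "(norm (hdefect ?G w e))\<^sup>2 = (\<Sum>i\<in>UNIV - {tau}. (hdefect ?G w e $ i)\<^sup>2)"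
          by (simp add: power2_norm_eq_inner inner_vec_def power2_eq_square[symmetric] sum.remove[of UNIV tau])
        also have "\<dots> = (\<Sum>i\<in>UNIV - {tau}. f s i w e p)"
          unfolding f_def u_def by (intro sum.cong refl) (simp add: hdefect_blow_nth[OF s(1) e])
        also have "\<dots> = (\<Sum>x\<in>Pair (w, e) ` (UNIV - {tau}). f s (snd x) (fst (fst x)) (snd (fst x)) p)"
          by (subst sum.reindex) (auto intro: inj_onI)
        also have "\<dots> \<le> ?g p"
          by (rule sum_mono2[OF fI]) (use we in \<open>auto simp: I_def f_def\<close>)
        finally show ?thesis .
      qed
      show ?thesis
      proof (cases "\<forall>w e. (w, e) \<in> T \<longrightarrow> norm (hdefect ?G w e) < \<delta>")
        case True
        then have "det (jac F s p) \<ge> - \<eta>" using Tdet G by (simp add: det_jac[OF s(1)])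
        then have "\<bar>det (jac F s p)\<bar> - det (jac F s p) \<le> 2 * \<eta>" using \<eta> by linarith
        moreover have "0 \<le> 2 * Kd / \<delta>\<^sup>2 * ?g p" using Kd(1) gn by simp
        ultimately show ?thesis by linarith
      next
        case False
        then obtain w e where "(w, e) \<in> T" "norm (hdefect ?G w e) \<ge> \<delta>" by (auto simp: not_less)
        then have "\<delta>\<^sup>2 \<le> ?g p" using tn[of w e] T(2) power_mono[of \<delta> "norm (hdefect ?G w e)" 2] by linarith
        then have "2 * Kd \<le> 2 * Kd / \<delta>\<^sup>2 * ?g p"
          using T(2) Kd(1) mult_left_mono[of "\<delta>\<^sup>2" "?g p" "2 * Kd / \<delta>\<^sup>2"] by simp
        moreover have "\<bar>det (jac F s p)\<bar> \<le> Kd" using Kd(2)[OF G] by (simp add: det_jac[OF s(1)])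
        ultimately show ?thesis using \<eta> by linarith
      qed
    qed
    have cd: "continuous_on S (\<lambda>p. det (jac F s p))" for S
      by (rule continuous_on_det) (rule continuous_on_subset[OF continuous_on_jac[OF cF]], simp)
    have gi: "?g integrable_on cbox a b"
      by (rule integrable_continuous, rule continuous_on_subset[OF csupp_continuous[OF cg]]) simp
    have "integral (cbox a b) (\<lambda>p. \<bar>det (jac F s p)\<bar> - det (jac F s p)) \<le>
        integral (cbox a b) (\<lambda>p. 2 * \<eta> + 2 * Kd / \<delta>\<^sup>2 * ?g p)"
    proof (rule integral_le)
      show "(\<lambda>p. \<bar>det (jac F s p)\<bar> - det (jac F s p)) integrable_on cbox a b"
        by (intro integrable_continuous continuous_on_diff continuous_on_rabs cd)
      show "(\<lambda>p. 2 * \<eta> + 2 * Kd / \<delta>\<^sup>2 * ?g p) integrable_on cbox a b"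
        by (intro integrable_add integrable_on_mult_right gi integrable_const)
    qed (rule pt)
    also have "\<dots> = integral (cbox a b) (\<lambda>p. 2 * \<eta>) + integral (cbox a b) (\<lambda>p. 2 * Kd / \<delta>\<^sup>2 * ?g p)"
      by (rule integral_add[OF integrable_const integrable_on_mult_right[OF gi]])
    also have "integral (cbox a b) (\<lambda>p. 2 * \<eta>) = 2 * \<eta> * V" by (simp add: V_def)
    also have "integral (cbox a b) (\<lambda>p. 2 * Kd / \<delta>\<^sup>2 * ?g p) = 2 * Kd / \<delta>\<^sup>2 * integral (cbox a b) ?g" by simp
    also have "integral (cbox a b) ?g \<le> integral UNIV ?g"
      by (rule integral_subset_le[OF _ gi csupp_integrable[OF cg]]) (auto intro!: sum_nonneg simp: f_def)
    also have "integral UNIV ?g = (\<Sum>x\<in>I. integral UNIV (f s (snd x) (fst (fst x)) (snd (fst x))))"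
      by (rule integral_csupp_sum[OF fI cf])
    also have "\<dots> \<le> (\<Sum>x\<in>I. \<epsilon>')"
      by (rule sum_mono) (use d(2) s s0d in \<open>force intro: less_le_trans\<close>)
    also have "\<dots> = real (card I) * \<epsilon>'" by simp
    finally have "integral (cbox a b) (\<lambda>p. \<bar>det (jac F s p)\<bar> - det (jac F s p)) \<le> 2 * \<eta> * V + 2 * Kd / \<delta>\<^sup>2 * (real (card I) * \<epsilon>')"
      using Kd(1) by (simp add: mult_left_mono divide_right_mono)
    moreover have "2 * \<eta> * V \<le> \<epsilon> / 2"
    proof -
      have "V + 1 > 0" using V by simp
      then have "2 * \<eta> * V = \<epsilon> / 2 * (V / (V + 1))" unfolding \<eta>_def by (simp add: field_simps)
      also have "\<dots> \<le> \<epsilon> / 2 * 1" using V \<epsilon> by (intro mult_left_mono) auto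
      finally show ?thesis by simp
    qed
    moreover have "2 * Kd / \<delta>\<^sup>2 * (real (card I) * \<epsilon>') \<le> \<epsilon> / 2"
    proof -
      have "2 * Kd / \<delta>\<^sup>2 * (real (card I) * \<epsilon>') = \<epsilon> / 2 * ((Kd / (Kd + 1)) * (real (card I) / (real (card I) + 1)))"
      proof -
        have cancel: "2 * x / y * (c * (z * y / (4 * x' * c'))) = z / 2 * (x / x' * (c / c'))"
          if "y \<noteq> 0" "x' \<noteq> 0" "c' \<noteq> 0" for x y z c x' c' :: real
          using that by (simp add: field_simps)
        show ?thesis unfolding \<epsilon>'_def by (rule cancel) (use T(2) Kd(1) in auto)
      qed
      also have "\<dots> \<le> \<epsilon> / 2 * (1 * 1)"
        using \<epsilon> Kd(1) by (intro mult_left_mono mult_mono) auto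
      finally show ?thesis by simp
    qed
    ultimately show ?thesis by linarith
  qed
  then show ?thesis using that s0 by blast
qed

text \<open>\<open>F\<close> is the identity outside a compact set and covers the ball around \<open>c2\<close> twice, once from
  near \<open>c1\<close> and once from near \<open>c2\<close>; since its mollifications have almost nonnegative Jacobian
  determinant, they would need too much volume.\<close>

theorem no_hlip_double_cover:
  assumes odd: "odd CARD('m)" and F: "hlip L F" and out: "\<And>p. norm p \<ge> R \<Longrightarrow> F p = p"
    and r: "r > 0"
    and U1: "\<And>x. x \<in> cball c1 r \<Longrightarrow> norm (F x - (x + (c2 - c1))) \<le> r / 4"
    and U2: "\<And>x. x \<in> cball c2 (3 * r) \<Longrightarrow> norm (F x - x) \<le> r / 4"
    and disj: "cball c1 r \<inter> cball c2 (3 * r) = {}"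
    and inR: "cball c1 r \<subseteq> cball 0 R" "cball c2 (3 * r) \<subseteq> cball 0 R"
  shows False
proof -
  have cF: "continuous_on UNIV F" by (rule hlip_continuous[OF F])
  have L: "L \<ge> 0" using F by (simp add: hlip_def)
  have R: "R \<ge> 0"
  proof -
    have "c1 \<in> cball c1 r" using r by simp
    then have "norm c1 \<le> R" using inR(1) by (metis mem_cball_0 subsetD)
    then show ?thesis using norm_ge_zero[of c1] by linarith
  qed
  obtain a where a: "cball 0 (R + 1) \<subseteq> cbox (- a) (a :: 'N pt)"
    using bounded_subset_cbox_symmetric[OF bounded_cball] by blast
  let ?Q = "cbox (- a) a"
  define W where "W = cball c2 (r / 2)"
  have mW: "measure lebesgue W > 0" using r by (simp add: W_def content_cball_pos)
  obtain s1 where s1: "s1 > 0" "\<And>s. 0 < s \<Longrightarrow> s < s1 \<Longrightarrow>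
    integral ?Q (\<lambda>p. \<bar>det (jac F s p)\<bar> - det (jac F s p)) \<le> measure lebesgue W / 2"
  proof (rule negative_part_small[OF odd F compact_cball])
    show "F p = p" if "p \<notin> cball 0 R" for p using that by (intro out) auto
    show "measure lebesgue W / 2 > 0" using mW by simp
  qed (rule that)
  obtain B where B: "B \<ge> 0" "\<And>x. x \<in> cball 0 (R + 1) \<Longrightarrow> norm (F x) \<le> B"
    using continuous_compact_bound[OF cF compact_cball] by blast
  define c where "c s = (L * (2 * s)) * (1 + 2 * B) + (L * (2 * s))\<^sup>2" for s
  have clim: "(c \<longlongrightarrow> c 0) (at_right 0)" unfolding c_def by (intro tendsto_intros)
  have "\<forall>\<^sub>F s in at_right 0. c s < r / (4 * real CARD('N))"
    using r by (intro order_tendstoD(2)[OF clim]) (simp add: c_def)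
  then obtain s2 where s2: "s2 > 0" "\<And>s. 0 < s \<Longrightarrow> s < s2 \<Longrightarrow> c s < r / (4 * real CARD('N))"
    unfolding eventually_at_right_field by auto
  \<comment> \<open>The last entry ensures \<open>s * (1 + 2 * R) \<le> 1\<close>: right translation
    by a vector of norm at most \<open>s\<close> then cannot take a point of norm above
    \<open>R + 1\<close> to one of norm below \<open>R\<close>.\<close>
  define \<mu> where "\<mu> = min (min s1 s2) (1 / (1 + 2 * R))"
  define s where "s = \<mu> / 2"
  have "\<mu> > 0" "\<mu> \<le> s1" "\<mu> \<le> s2" "\<mu> \<le> 1 / (1 + 2 * R)" using s1 s2 R by (auto simp: \<mu>_def)
  then have s: "s > 0" "s < s1" "s < s2" "s < 1 / (1 + 2 * R)" unfolding s_def by linarith+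
  then have sR: "s * (1 + 2 * R) \<le> 1" using R by (simp add: field_simps)
  have "s * 1 \<le> s * (1 + 2 * R)" using R s(1) by (intro mult_left_mono) auto
  then have sle: "s \<le> 1" using sR by simp
  define g where "g = fsm F s"
  have cg: "continuous_on UNIV g"
    using has_derivative_continuous[OF fsm_has_derivative[OF cF s(1)]] unfolding g_def
    by (simp add: continuous_at_imp_continuous_on)
  have gid: "g p = p" if p: "norm p > R + 1" for p
    unfolding g_def
  proof (rule fsm_id)
    fix w :: "'N pt" assume w: "norm w \<le> 1"
    have dw: "norm (dil s w) \<le> s"
    proof -
      have "s * norm w \<le> s * 1" using w s(1) by (intro mult_left_mono) auto
      then show ?thesis using norm_dil_le[OF less_imp_le[OF s(1)] sle, of w] by linarith
    qed
    have "norm (p \<odot> dil s w) \<ge> R"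
    proof (rule ccontr)
      assume n: "\<not> norm (p \<odot> dil s w) \<ge> R"
      have "p = (p \<odot> dil s w) \<odot> (- dil s w)" by (simp add: mul_assoc)
      then have "norm p \<le> norm (p \<odot> dil s w) + norm (- dil s w) + 2 * (norm (p \<odot> dil s w) * norm (- dil s w))"
        using norm_mul_le by metis
      also have "\<dots> \<le> R + s + 2 * (R * s)"
        using n dw R by (intro add_mono mult_left_mono mult_mono) auto
      finally show False using p sR by (simp add: algebra_simps)
    qed
    then show "F (p \<odot> dil s w) = p \<odot> dil s w" by (rule out)
  qed
  have gF: "norm (g p - F p) \<le> r / 4" for p
  proof (cases "norm p > R + 1")
    case True
    then show ?thesis using gid out[of p] R r by simp
  next
    case False
    have "norm (F (p \<odot> dil s w) - F p) \<le> r / (4 * real CARD('N))" if w: "norm w \<le> 1" for w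
    proof -
      have nd: "nrm (dil s w) \<le> 2 * s"
      proof -
        have "\<bar>w $ tau\<bar> \<le> 1" using component_le_norm_cart[of w tau] w by simp
        then have "nrm w \<le> 2" using norm_hor_le[of w] w by (simp add: nrm_def) (smt (verit) real_sqrt_le_1_iff)
        then show ?thesis using s by (simp add: nrm_dil)
      qed
      have 2: "norm (hor (F p)) \<le> B" using B(2)[of p] False norm_hor_le[of "F p"] by simp
      have "norm (F (p \<odot> dil s w) - F p) \<le> (L * nrm (dil s w)) * (1 + 2 * norm (hor (F p))) + (L * nrm (dil s w))\<^sup>2"
        using hlip_dist[OF F, of "p \<odot> dil s w" p] by simp
      also have "\<dots> \<le> c s"
        unfolding c_def using nd 2 L s by (intro add_mono mult_mono power_mono) (auto simp: nrm_nonneg)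
      finally show ?thesis using s2(2)[OF s(1,3)] by simp
    qed
    then have "norm (g p - F p) \<le> real CARD('N) * (r / (4 * real CARD('N)))"
      unfolding g_def by (intro fsm_close[OF cF])
    then show ?thesis by simp
  qed
  have g1: "norm (g x - (x + (c2 - c1))) \<le> r / 2" if "x \<in> cball c1 r" for x
    using norm_diff_triangle_le[OF gF U1[OF that]] by simp
  have g2: "norm (g x - x) \<le> r / 2" if "x \<in> cball c2 (3 * r)" for x
    using norm_diff_triangle_le[OF gF U2[OF that]] by simp
  \<comment> \<open>On \<open>cball c1 r\<close> the map \<open>g\<close> is within
    \<open>r / 2\<close> of the translation taking \<open>c1\<close> to \<open>c2\<close>, so by
    Brouwer its image contains the ball of radius \<open>r / 2\<close> about
    \<open>c2\<close>.\<close>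
  have WU: "W \<subseteq> g ` cball c1 r"
  proof
    fix y assume y: "y \<in> W"
    have "\<exists>z\<in>cball c1 r. g z - (c2 - c1) = y - (c2 - c1)"
    proof (rule brouwer_surjective_cball[where S = "cball c1 (r / 2)"])
      show "continuous_on (cball c1 r) (\<lambda>z. g z - (c2 - c1))"
        by (intro continuous_intros continuous_on_subset[OF cg]) simp
      show "y - (c2 - c1) \<in> cball c1 (r / 2)" using y by (simp add: W_def dist_norm algebra_simps)
      fix x z assume x: "x \<in> cball c1 (r / 2)" and z: "z \<in> cball c1 r"
      have "c1 - (x + (z - (g z - (c2 - c1)))) = (c1 - x) + (g z - (z + (c2 - c1)))" by simp
      then have "norm (c1 - (x + (z - (g z - (c2 - c1))))) \<le> norm (c1 - x) + norm (g z - (z + (c2 - c1)))"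
        by (metis norm_triangle_ineq)
      then show "x + (z - (g z - (c2 - c1))) \<in> cball c1 r"
        using g1[OF z] x by (simp add: dist_norm)
    qed (rule r)
    then show "y \<in> g ` cball c1 r" by auto
  qed
  \<comment> \<open>The image of the first ball lies within \<open>3 * r / 2\<close> of
    \<open>c2\<close>, and \<open>g\<close>, being within \<open>r / 2\<close> of the identity on
    \<open>cball c2 (3 * r)\<close>, covers all of that. Removing the first ball from the domain
    therefore loses no image points.\<close>
  have cover2: "g ` cball c1 r \<subseteq> g ` cball c2 (3 * r)"
  proof
    fix y assume "y \<in> g ` cball c1 r"
    then obtain x where x: "x \<in> cball c1 r" "y = g x" by blast
    have "c2 - y = (c1 - x) - (g x - (x + (c2 - c1)))" using x by simp
    then have "norm (c2 - y) \<le> norm (c1 - x) + norm (g x - (x + (c2 - c1)))" by (metis norm_triangle_ineq4)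
    then have y: "y \<in> cball c2 (3 * r / 2)" using g1[OF x(1)] x(1) by (simp add: dist_norm)
    have "\<exists>z\<in>cball c2 (3 * r). g z = y"
    proof (rule brouwer_surjective_cball[where S = "cball c2 (3 * r / 2)"])
      show "continuous_on (cball c2 (3 * r)) g" by (rule continuous_on_subset[OF cg]) simp
      show "3 * r > 0" using r by simp
      show "y \<in> cball c2 (3 * r / 2)" by (rule y)
      fix x z assume x: "x \<in> cball c2 (3 * r / 2)" and z: "z \<in> cball c2 (3 * r)"
      have "c2 - (x + (z - g z)) = (c2 - x) + (g z - z)" by simp
      then have "norm (c2 - (x + (z - g z))) \<le> norm (c2 - x) + norm (g z - z)" by (metis norm_triangle_ineq)
      then show "x + (z - g z) \<in> cball c2 (3 * r)" using g2[OF z] x r by (simp add: dist_norm)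
    qed
    then show "y \<in> g ` cball c2 (3 * r)" by auto
  qed
  have ball_Q: "cball 0 R \<subseteq> ?Q" using a by (meson le_add_same_cancel1 order_trans subset_cball zero_le_one)
  have gQ: "g x = x" if "x \<notin> ?Q" for x 
  proof (rule gid)
    show "R + 1 < norm x" using that a by (metis mem_cball_0 not_le subsetD)
  qed
  have surj: "\<exists>x. g x = y" for y
  proof -
    obtain Bd where Bd: "Bd \<ge> 0" "\<And>x. x \<in> cball 0 (R + 1) \<Longrightarrow> norm (g x - x) \<le> Bd"
      by (rule continuous_compact_bound[OF continuous_on_diff[OF cg continuous_on_id] compact_cball]) (rule that)
    have "norm (g x - x) \<le> Bd" for x
      using Bd gid[of x] by (cases "norm x > R + 1") auto
    then show ?thesis using surj_of_bounded_displacement[OF cg] by blast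
  qed
  have "?Q \<subseteq> g ` (?Q - cball c1 r)"
  proof
    fix y assume y: "y \<in> ?Q"
    obtain x where x: "g x = y" using surj by blast
    have xQ: "x \<in> ?Q"
    proof (rule ccontr)
      assume n: "x \<notin> ?Q"
      then show False using gQ[OF n] x y by simp
    qed
    show "y \<in> g ` (?Q - cball c1 r)"
    proof (cases "x \<in> cball c1 r")
      case True
      then obtain z where z: "z \<in> cball c2 (3 * r)" "y = g z" using cover2 x by blast
      then have "z \<in> ?Q - cball c1 r" using disj inR(2) ball_Q by blast
      then show ?thesis using z(2) by blast
    qed (use x xQ in blast)
  qed
  then have "measure lebesgue W \<le> integral ?Q (\<lambda>x. \<bar>det (jac F s x)\<bar> - det (jac F s x))"
  proof (rule measure_le_integral_negative_part[rotated -1])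
    show "(g has_derivative (*v) (jac F s x)) (at x)" for x
      unfolding g_def by (rule fsm_has_derivative[OF cF s(1)])
    show "continuous_on UNIV (\<lambda>x. jac F s x $ i $ j)" for i j by (rule continuous_on_jac[OF cF])
    show "g x = x" if "x \<notin> ?Q" for x by (rule gQ[OF that])
    show "cball c1 r \<subseteq> ?Q" using inR(1) ball_Q by blast
    show "W \<in> lmeasurable" by (simp add: W_def)
    show "W \<subseteq> g ` cball c1 r" by (rule WU)
  qed simp
  then show False using s1(2)[OF s(1,2)] mW by linarith
qed

end

section \<open>Comparison with the Carnot--Caratheodory metric\<close>

text \<open>The horizontal plane is the kernel of the contact form, which turns membership in a span
  into one equation for the vertical component.\<close>

lemma horizontal_plane_iff:
  "v \<in> horizontal_plane p \<longleftrightarrow> snd (snd v) = 2 * (fst (snd p) \<bullet> fst v - fst p \<bullet> fst (snd v))"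
proof
  assume "v \<in> horizontal_plane p"
  then show "snd (snd v) = 2 * (fst (snd p) \<bullet> fst v - fst p \<bullet> fst (snd v))"
    unfolding horizontal_plane_def
  proof (induction rule: span_induct_alt)
    case (step c x y)
    then show ?case
      by (auto simp: heis_X_def heis_Y_def case_prod_unfold inner_axis algebra_simps)
  qed simp
next
  assume *: "snd (snd v) = 2 * (fst (snd p) \<bullet> fst v - fst p \<bullet> fst (snd v))"
  have "v = (\<Sum>i\<in>UNIV. (fst v $ i) *\<^sub>R heis_X i p + (fst (snd v) $ i) *\<^sub>R heis_Y i p)"
    unfolding heis_frame_sum using *
    by (simp add: prod_eq_iff inner_vec_def sum_subtractf mult.commute)
  also have "\<dots> \<in> horizontal_plane p"
    unfolding horizontal_plane_def by (intro span_sum span_add span_scale span_base) auto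
  finally show "v \<in> horizontal_plane p" .
qed

lemma horizontal_norm_eq:
  assumes "v \<in> horizontal_plane p"
  shows "horizontal_norm p v = norm (fst v, fst (snd v))"
proof -
  have v: "v = (\<Sum>i\<in>UNIV. (fst v $ i) *\<^sub>R heis_X i p + (fst (snd v) $ i) *\<^sub>R heis_Y i p)"
    unfolding heis_frame_sum using assms
    by (simp add: horizontal_plane_iff prod_eq_iff inner_vec_def sum_subtractf mult.commute)
  have "horizontal_norm p v = sqrt (\<Sum>i\<in>UNIV. (fst v $ i)\<^sup>2 + (fst (snd v) $ i)\<^sup>2)"
    by (rule trans[OF arg_cong[OF v, of "horizontal_norm p"] horizontal_norm_frame])
  also have "\<dots> = norm (fst v, fst (snd v))"
    by (simp add: norm_Pair norm_vec_def L2_set_def sum.distrib sum_nonneg)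
  finally show ?thesis .
qed

text \<open>The homogeneous norm of \<open>- p \<odot> q\<close>, written out for triples.\<close>

definition hdist :: "'n::finite heis \<Rightarrow> 'n heis \<Rightarrow> real"
  where "hdist p q = norm (fst q - fst p, fst (snd q) - fst (snd p)) +
    sqrt \<bar>snd (snd q) - snd (snd p) - 2 * (fst (snd p) \<bullet> fst q - fst p \<bullet> fst (snd q))\<bar>"

section \<open>Integrating the derivative of a Lipschitz curve\<close>

lemma AE_limit_integrable:
  fixes f :: "nat \<Rightarrow> real \<Rightarrow> real"
  assumes cont: "\<And>n. continuous_on {a..b} (f n)" and bd: "\<And>n x. x \<in> {a..b} \<Longrightarrow> \<bar>f n x\<bar> \<le> K"
    and lim: "AE x in lebesgue. x \<in> {a..b} \<longrightarrow> (\<lambda>n. f n x) \<longlonglongrightarrow> g x"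
  shows "g integrable_on {a..b}" "(\<lambda>n. integral {a..b} (f n)) \<longlonglongrightarrow> integral {a..b} g"
proof -
  obtain N where "N \<in> null_sets lebesgue"
    and sub: "{x \<in> space lebesgue. \<not> (x \<in> {a..b} \<longrightarrow> (\<lambda>n. f n x) \<longlonglongrightarrow> g x)} \<subseteq> N"
    using lim by (auto simp: eventually_ae_filter)
  then have N: "negligible N" by (simp add: negligible_iff_null_sets)
  have Nlim: "(\<lambda>n. f n x) \<longlonglongrightarrow> g x" if "x \<in> {a..b}" "x \<notin> N" for x
  proof (rule ccontr)
    assume "\<not> ?thesis"
    then have "x \<in> {x \<in> space lebesgue. \<not> (x \<in> {a..b} \<longrightarrow> (\<lambda>n. f n x) \<longlonglongrightarrow> g x)}" using that by simp
    then have "x \<in> N" by (rule subsetD[OF sub])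
    then show False using that by simp
  qed
  define f' where "f' n x = (if x \<in> N then 0 else f n x)" for n x
  define g' where "g' x = (if x \<in> N then 0 else g x)" for x
  have fi: "f n integrable_on {a..b}" for n by (rule integrable_continuous_real[OF cont])
  have f'i: "f' n integrable_on {a..b}" and f'e: "integral {a..b} (f' n) = integral {a..b} (f n)" for n
    using integrable_spike[OF fi[of n] N, of "f' n"] integral_spike[OF N, of "{a..b}" "f n" "f' n"]
    by (auto simp: f'_def)
  have d: "g' integrable_on {a..b}" "(\<lambda>n. integral {a..b} (f' n)) \<longlonglongrightarrow> integral {a..b} g'"
  proof -
    have h: "(\<lambda>x. \<bar>K\<bar>) integrable_on {a..b}" by (rule integrable_const_ivl)
    have 1: "norm (f' k x) \<le> \<bar>K\<bar>" if "x \<in> {a..b}" for k x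
      using bd[OF that, of k] by (auto simp: f'_def)
    have 2: "(\<lambda>n. f' n x) \<longlonglongrightarrow> g' x" if "x \<in> {a..b}" for x
      using Nlim[OF that] by (simp add: f'_def g'_def)
    show "g' integrable_on {a..b}" "(\<lambda>n. integral {a..b} (f' n)) \<longlonglongrightarrow> integral {a..b} g'"
      by (rule dominated_convergence[OF f'i h 1 2]; assumption)+
  qed
  show "g integrable_on {a..b}" by (rule integrable_spike[OF d(1) N]) (auto simp: g'_def)
  have "integral {a..b} g' = integral {a..b} g" by (rule integral_spike[OF N]) (auto simp: g'_def)
  then show "(\<lambda>n. integral {a..b} (f n)) \<longlonglongrightarrow> integral {a..b} g" using d(2) by (simp add: f'e)
qed

lemma average_tendsto:
  fixes f :: "real \<Rightarrow> real"
  assumes "continuous_on UNIV f"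
  shows "(\<lambda>n. real (Suc n) * integral {t..t + 1 / real (Suc n)} f) \<longlonglongrightarrow> f t"
proof -
  have "((\<lambda>u. integral {t..u} f) has_vector_derivative f t) (at t within {t..t + 1})"
    by (rule integral_has_vector_derivative[OF continuous_on_subset[OF assms]]) auto
  then have "((\<lambda>u. (integral {t..u} f - integral {t..t} f) / (u - t)) \<longlongrightarrow> f t) (at t within {t..t + 1})"
    by (simp add: has_real_derivative_iff_has_vector_derivative[symmetric] has_field_derivative_iff)
  moreover have "filterlim (\<lambda>n. t + 1 / real (Suc n)) (at t within {t..t + 1}) sequentially"
    unfolding filterlim_at
  proof
    show "\<forall>\<^sub>F n in sequentially. t + 1 / real (Suc n) \<in> {t..t + 1} \<and> t + 1 / real (Suc n) \<noteq> t"
      by (rule always_eventually) (auto simp: field_simps)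
    have "(\<lambda>n. 1 / real (Suc n)) \<longlonglongrightarrow> 0" using LIMSEQ_inverse_real_of_nat by (simp add: inverse_eq_divide)
    from tendsto_add[OF tendsto_const[of t] this] show "(\<lambda>n. t + 1 / real (Suc n)) \<longlonglongrightarrow> t" by simp
  qed
  ultimately have "(\<lambda>n. (integral {t..t + 1 / real (Suc n)} f - integral {t..t} f) / (t + 1 / real (Suc n) - t)) \<longlonglongrightarrow> f t"
    by (rule filterlim_compose)
  then show ?thesis by (simp add: field_simps)
qed

text \<open>Forward difference quotients are bounded by \<open>K\<close> and converge almost
  everywhere to the derivative, while their integrals telescope to averages of the function just
  after \<open>t\<close> and just after \<open>0\<close>. Differentiability almost everywhere is an
  assumption, since horizontal curves carry it by definition.\<close>

lemma Lipschitz_FTC: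
  fixes \<phi> :: "real \<Rightarrow> real"
  assumes lip: "K-lipschitz_on {0..1} \<phi>"
    and der: "AE x in lebesgue. x \<in> {0..1} \<longrightarrow> (\<phi> has_real_derivative \<phi>' x) (at x within {0..1})"
    and t: "t \<in> {0..1}"
  shows "\<phi>' integrable_on {0..t}" "integral {0..t} \<phi>' = \<phi> t - \<phi> 0"
proof -
  \<comment> \<open>Constant extension beyond \<open>{0..1}\<close>, so that forward quotients exist
    at every point.\<close>
  define \<psi> where "\<psi> x = \<phi> (max 0 (min 1 x))" for x
  have \<psi>: "\<psi> x = \<phi> x" if "x \<in> {0..1}" for x using that by (simp add: \<psi>_def)
  have \<psi>lip: "\<bar>\<psi> x - \<psi> y\<bar> \<le> K * \<bar>x - y\<bar>" for x y
  proof -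
    have "\<bar>\<psi> x - \<psi> y\<bar> \<le> K * \<bar>max 0 (min 1 x) - max 0 (min 1 y)\<bar>"
      using lipschitz_onD[OF lip, of "max 0 (min 1 x)" "max 0 (min 1 y)"] by (simp add: \<psi>_def dist_real_def)
    also have "\<dots> \<le> K * \<bar>x - y\<bar>" using lipschitz_on_nonneg[OF lip] by (intro mult_left_mono) auto
    finally show ?thesis .
  qed
  have c\<psi>: "continuous_on UNIV \<psi>"
    by (rule lipschitz_on_continuous_on[of K], rule lipschitz_onI)
      (use \<psi>lip lipschitz_on_nonneg[OF lip] in \<open>auto simp: dist_real_def\<close>)
  define D where "D n x = real (Suc n) * (\<psi> (x + 1 / real (Suc n)) - \<psi> x)" for n x
  have c\<psi>': "continuous_on S (\<lambda>x. \<psi> (x + c))" for S c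
    by (rule continuous_on_compose2[OF c\<psi>]) (auto intro!: continuous_intros)
  have Dc: "continuous_on {0..t} (D n)" for n
    unfolding D_def by (intro continuous_intros c\<psi>' continuous_on_subset[OF c\<psi>]) auto
  have Db: "\<bar>D n x\<bar> \<le> K" for n x
  proof -
    have "\<bar>\<psi> (x + 1 / real (Suc n)) - \<psi> x\<bar> \<le> K * (1 / real (Suc n))" using \<psi>lip[of "x + 1 / real (Suc n)" x] by simp
    then have "real (Suc n) * \<bar>\<psi> (x + 1 / real (Suc n)) - \<psi> x\<bar> \<le> real (Suc n) * (K * (1 / real (Suc n)))"
      by (rule mult_left_mono) simp
    then show ?thesis by (simp add: D_def abs_mult)
  qed
  have h0: "(\<lambda>n. 1 / real (Suc n)) \<longlonglongrightarrow> 0" using LIMSEQ_inverse_real_of_nat by (simp add: inverse_eq_divide)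
  have lim: "(\<lambda>n. D n x) \<longlonglongrightarrow> \<phi>' x" if x: "0 \<le> x" "x < 1" and d: "(\<phi> has_real_derivative \<phi>' x) (at x within {0..1})" for x
  proof -
    have "((\<lambda>y. (\<phi> y - \<phi> x) / (y - x)) \<longlongrightarrow> \<phi>' x) (at x within {0..1})"
      using d by (simp add: has_field_derivative_iff)
    moreover have ev: "\<forall>\<^sub>F n in sequentially. x + 1 / real (Suc n) < 1"
      using tendsto_add[OF tendsto_const[of x] h0] x by (intro order_tendstoD(2)[of _ x]) auto
    have "filterlim (\<lambda>n. x + 1 / real (Suc n)) (at x within {0..1}) sequentially"
      unfolding filterlim_at
    proof
      show "\<forall>\<^sub>F n in sequentially. x + 1 / real (Suc n) \<in> {0..1} \<and> x + 1 / real (Suc n) \<noteq> x"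
        using ev by (rule eventually_mono) (use x in auto)
      from tendsto_add[OF tendsto_const[of x] h0] show "(\<lambda>n. x + 1 / real (Suc n)) \<longlonglongrightarrow> x" by simp
    qed
    ultimately have "(\<lambda>n. (\<phi> (x + 1 / real (Suc n)) - \<phi> x) / (x + 1 / real (Suc n) - x)) \<longlonglongrightarrow> \<phi>' x"
      by (rule filterlim_compose)
    then show ?thesis
    proof (rule Lim_transform_eventually)
      show "\<forall>\<^sub>F n in sequentially. (\<phi> (x + 1 / real (Suc n)) - \<phi> x) / (x + 1 / real (Suc n) - x) = D n x"
        using ev
      proof (rule eventually_mono)
        fix n assume n: "x + 1 / real (Suc n) < 1"
        then have "\<psi> (x + 1 / real (Suc n)) = \<phi> (x + 1 / real (Suc n))" "\<psi> x = \<phi> x"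
          using x by (auto intro!: \<psi>)
        then show "(\<phi> (x + 1 / real (Suc n)) - \<phi> x) / (x + 1 / real (Suc n) - x) = D n x"
          by (simp add: D_def)
      qed
    qed
  qed
  have "AE x in lebesgue. x \<noteq> (1::real)"
    by (rule AE_I'[of "{1}"]) (auto simp: negligible_iff_null_sets[symmetric])
  with der have AE: "AE x in lebesgue. x \<in> {0..t} \<longrightarrow> (\<lambda>n. D n x) \<longlonglongrightarrow> \<phi>' x"
    by eventually_elim (use lim t in auto)
  show "\<phi>' integrable_on {0..t}" by (rule AE_limit_integrable(1)[OF Dc Db AE])
  have conv: "(\<lambda>n. integral {0..t} (D n)) \<longlonglongrightarrow> integral {0..t} \<phi>'" by (rule AE_limit_integrable(2)[OF Dc Db AE])
  have i: "\<psi> integrable_on {a..b}" for a b by (rule integrable_continuous_real[OF continuous_on_subset[OF c\<psi>]]) simp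
  have "integral {0..t} (D n) = real (Suc n) * integral {t..t + 1 / real (Suc n)} \<psi> - real (Suc n) * integral {0..0 + 1 / real (Suc n)} \<psi>" for n
  proof -
    define h where "h = 1 / real (Suc n)"
    have h: "h > 0" by (simp add: h_def)
    have "integral {0..t} (D n) = real (Suc n) * (integral {0..t} (\<lambda>x. \<psi> (x + h)) - integral {0..t} \<psi>)"
      unfolding D_def h_def[symmetric] using integral_diff[OF integrable_continuous_real[OF c\<psi>'] i, of 0 t h] by simp
    also have "integral {0..t} (\<lambda>x. \<psi> (x + h)) = integral {h..t + h} \<psi>"
      using integral_shift_Icc_real[of 0 t \<psi> h] by (simp add: o_def add.commute)
    also have "integral {h..t + h} \<psi> - integral {0..t} \<psi> = integral {t..t + h} \<psi> - integral {0..h} \<psi>"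
    proof -
      have "integral {0..h} \<psi> + integral {h..t + h} \<psi> = integral {0..t + h} \<psi>"
        using h t by (intro Henstock_Kurzweil_Integration.integral_combine i) auto
      moreover have "integral {0..t} \<psi> + integral {t..t + h} \<psi> = integral {0..t + h} \<psi>"
        using h t by (intro Henstock_Kurzweil_Integration.integral_combine i) auto
      ultimately show ?thesis by linarith
    qed
    finally show ?thesis by (simp add: h_def right_diff_distrib)
  qed
  then have "(\<lambda>n. integral {0..t} (D n)) \<longlonglongrightarrow> \<psi> t - \<psi> 0"
    using tendsto_diff[OF average_tendsto[OF c\<psi>, of t] average_tendsto[OF c\<psi>, of 0]] by simp
  then have "integral {0..t} \<phi>' = \<psi> t - \<psi> 0" using conv LIMSEQ_unique by blast
  then show "integral {0..t} \<phi>' = \<phi> t - \<phi> 0" using t by (simp add: \<psi>)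
qed

lemma Lipschitz_increment_le:
  fixes \<phi> :: "real \<Rightarrow> real"
  assumes lip: "K-lipschitz_on {0..1} \<phi>"
    and der: "AE x in lebesgue. x \<in> {0..1} \<longrightarrow> (\<exists>d. (\<phi> has_real_derivative d) (at x within {0..1}) \<and> d \<le> G x)"
    and G: "G integrable_on {0..1}" "\<And>x. 0 \<le> G x" and t: "t \<in> {0..1}"
  shows "\<phi> t - \<phi> 0 \<le> integral {0..1} G"
proof -
  let ?P = "\<lambda>x d. (\<phi> has_real_derivative d) (at x within {0..1}) \<and> d \<le> G x"
  define \<phi>' where "\<phi>' x = (if \<exists>d. ?P x d then SOME d. ?P x d else 0)" for x
  have P: "?P x (\<phi>' x)" if "\<exists>d. ?P x d" for x
    using someI_ex[OF that] that by (simp add: \<phi>'_def)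
  have le: "\<phi>' x \<le> G x" for x
  proof (cases "\<exists>d. ?P x d")
    case True then show ?thesis using P by blast
  next
    case False
    then have "\<phi>' x = 0" unfolding \<phi>'_def by (rule if_not_P)
    then show ?thesis using G(2) by simp
  qed
  have "AE x in lebesgue. x \<in> {0..1} \<longrightarrow> (\<phi> has_real_derivative \<phi>' x) (at x within {0..1})"
    using der by eventually_elim (use P in blast)
  note FTC = Lipschitz_FTC[OF lip this t]
  have G': "G integrable_on {0..t}"
    by (rule integrable_on_subinterval[OF G(1)]) (use t in auto)
  have "\<phi> t - \<phi> 0 \<le> integral {0..t} G"
    unfolding FTC(2)[symmetric] by (rule integral_le[OF FTC(1) G' le])
  also have "\<dots> \<le> integral {0..1} G"
    by (rule integral_subset_le[OF _ G' G(1)]) (use t G(2) in auto)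
  finally show ?thesis .
qed

lemma difference_quotient_limit:
  fixes \<phi> :: "real \<Rightarrow> 'a::real_normed_vector"
  assumes d: "(\<phi> has_vector_derivative d) (at x within {0..1})" and x: "0 \<le> x" "x < 1"
  shows "(\<lambda>n. real (Suc n) *\<^sub>R (\<phi> (max 0 (min 1 (x + 1 / real (Suc n)))) - \<phi> (max 0 (min 1 x)))) \<longlonglongrightarrow> d"
proof -
  have h0: "(\<lambda>n. 1 / real (Suc n)) \<longlonglongrightarrow> 0" using LIMSEQ_inverse_real_of_nat by (simp add: inverse_eq_divide)
  have xl: "(\<lambda>n. x + 1 / real (Suc n)) \<longlonglongrightarrow> x" using tendsto_add[OF tendsto_const[of x] h0] by simp
  have ev: "\<forall>\<^sub>F n in sequentially. x + 1 / real (Suc n) < 1"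
    using xl x(2) by (rule order_tendstoD(2))
  have "((\<lambda>y. (1 / norm (y - x)) *\<^sub>R (\<phi> y - (\<phi> x + (y - x) *\<^sub>R d))) \<longlongrightarrow> 0) (at x within {0..1})"
    using d by (simp add: has_vector_derivative_def has_derivative_within)
  moreover have "filterlim (\<lambda>n. x + 1 / real (Suc n)) (at x within {0..1}) sequentially"
    unfolding filterlim_at
  proof
    show "\<forall>\<^sub>F n in sequentially. x + 1 / real (Suc n) \<in> {0..1} \<and> x + 1 / real (Suc n) \<noteq> x"
      using ev by (rule eventually_mono) (use x in auto)
  qed (rule xl)
  ultimately have "(\<lambda>n. (1 / norm (x + 1 / real (Suc n) - x)) *\<^sub>R
      (\<phi> (x + 1 / real (Suc n)) - (\<phi> x + (x + 1 / real (Suc n) - x) *\<^sub>R d))) \<longlonglongrightarrow> 0"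
    by (rule filterlim_compose)
  then have "(\<lambda>n. real (Suc n) *\<^sub>R (\<phi> (x + 1 / real (Suc n)) - \<phi> x) - d) \<longlonglongrightarrow> 0"
    by (simp add: algebra_simps del: of_nat_Suc)
  then have "(\<lambda>n. real (Suc n) *\<^sub>R (\<phi> (x + 1 / real (Suc n)) - \<phi> x)) \<longlonglongrightarrow> d" by (simp add: LIM_zero_iff)
  then show ?thesis
  proof (rule Lim_transform_eventually)
    show "\<forall>\<^sub>F n in sequentially. real (Suc n) *\<^sub>R (\<phi> (x + 1 / real (Suc n)) - \<phi> x) =
        real (Suc n) *\<^sub>R (\<phi> (max 0 (min 1 (x + 1 / real (Suc n)))) - \<phi> (max 0 (min 1 x)))"
      using ev
    proof (rule eventually_mono)
      fix n assume n: "x + 1 / real (Suc n) < 1"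
      have "max 0 (min 1 (x + 1 / real (Suc n))) = x + 1 / real (Suc n)" "max 0 (min 1 x) = x"
        using n x by auto
      then show "real (Suc n) *\<^sub>R (\<phi> (x + 1 / real (Suc n)) - \<phi> x) =
        real (Suc n) *\<^sub>R (\<phi> (max 0 (min 1 (x + 1 / real (Suc n)))) - \<phi> (max 0 (min 1 x)))" by (simp only:)
    qed
  qed
qed

text \<open>The speed is an almost everywhere limit of continuous functions bounded by
  \<open>K\<close>.\<close>

lemma Lipschitz_speed_integrable:
  fixes \<phi> :: "real \<Rightarrow> 'a::real_normed_vector"
  assumes lip: "K-lipschitz_on {0..1} \<phi>"
    and der: "AE x in lebesgue. x \<in> {0..1} \<longrightarrow> (\<phi> has_vector_derivative d x) (at x within {0..1})"
  shows "(\<lambda>x. norm (d x)) integrable_on {0..1}"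
proof -
  let ?c = "\<lambda>x::real. max 0 (min 1 x)"
  define f where "f n x = norm (real (Suc n) *\<^sub>R (\<phi> (?c (x + 1 / real (Suc n))) - \<phi> (?c x)))" for n x
  have c\<phi>: "continuous_on {0..1} \<phi>" by (rule lipschitz_on_continuous_on[OF lip])
  show ?thesis
  proof (rule AE_limit_integrable(1)[of 0 1 f K])
    show "continuous_on {0..1} (f n)" for n
      unfolding f_def by (intro continuous_intros continuous_on_compose2[OF c\<phi>]) auto
    show "\<bar>f n x\<bar> \<le> K" for n x
    proof -
      have "norm (\<phi> (?c (x + 1 / real (Suc n))) - \<phi> (?c x)) \<le> K * \<bar>?c (x + 1 / real (Suc n)) - ?c x\<bar>"
        using lipschitz_onD[OF lip, of "?c (x + 1 / real (Suc n))" "?c x"] by (simp add: dist_norm)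
      also have "\<bar>?c (x + 1 / real (Suc n)) - ?c x\<bar> \<le> 1 / real (Suc n)"
      proof -
        have "\<bar>?c (x + h) - ?c x\<bar> \<le> h" if "h \<ge> 0" for h :: real using that by (simp add: max_def min_def)
        from this[of "1 / real (Suc n)"] show ?thesis by simp
      qed
      finally have "norm (\<phi> (?c (x + 1 / real (Suc n))) - \<phi> (?c x)) \<le> K * (1 / real (Suc n))"
        using lipschitz_on_nonneg[OF lip] by (simp add: mult_left_mono)
      then have "real (Suc n) * norm (\<phi> (?c (x + 1 / real (Suc n))) - \<phi> (?c x)) \<le> real (Suc n) * (K * (1 / real (Suc n)))"
        by (rule mult_left_mono) simp
      then show ?thesis by (simp add: f_def del: of_nat_Suc)
    qed
    have "AE x in lebesgue. x \<noteq> (1::real)"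
      by (rule AE_I'[of "{1}"]) (auto simp: negligible_iff_null_sets[symmetric])
    with der show "AE x in lebesgue. x \<in> {0..1} \<longrightarrow> (\<lambda>n. f n x) \<longlonglongrightarrow> norm (d x)"
    proof eventually_elim
      case (elim x)
      then show ?case
        unfolding f_def by (intro impI tendsto_norm difference_quotient_limit) auto
    qed
  qed
qed

section \<open>The length of a curve bounds the homogeneous distance\<close>

lemma horizontal_curve_length:
  assumes \<gamma>: "horizontal_curve \<gamma>"
  obtains K v where "K-lipschitz_on {0..1} \<gamma>"
    "AE x in lebesgue. x \<in> {0..1} \<longrightarrow> (\<gamma> has_vector_derivative v x) (at x within {0..1}) \<and> v x \<in> horizontal_plane (\<gamma> x)"
    "(\<lambda>x. norm (fst (v x), fst (snd (v x)))) integrable_on {0..1}"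
    "horizontal_length \<gamma> = integral {0..1} (\<lambda>x. norm (fst (v x), fst (snd (v x))))"
proof -
  define v where "v x = vector_derivative \<gamma> (at x within {0..1})" for x
  define g where "g x = norm (fst (v x), fst (snd (v x)))" for x
  obtain K where K: "K-lipschitz_on {0..1} \<gamma>" using \<gamma> by (auto simp: horizontal_curve_def)
  have AE: "AE x in lebesgue. x \<in> {0..1} \<longrightarrow> (\<gamma> has_vector_derivative v x) (at x within {0..1}) \<and> v x \<in> horizontal_plane (\<gamma> x)"
    using \<gamma> unfolding horizontal_curve_def v_def by (simp add: vector_derivative_works)
  have gi: "g integrable_on {0..1}"
    unfolding g_def
  proof (rule Lipschitz_speed_integrable[of K "\<lambda>x. (fst (\<gamma> x), fst (snd (\<gamma> x)))"])
    show "K-lipschitz_on {0..1} (\<lambda>x. (fst (\<gamma> x), fst (snd (\<gamma> x))))"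
    proof (rule lipschitz_onI)
      fix x y :: real assume xy: "x \<in> {0..1}" "y \<in> {0..1}"
      have le: "norm (fst u, fst (snd u)) \<le> norm u" for u :: "'a heis"
        by (cases u) (auto simp: norm_Pair)
      have "dist (fst (\<gamma> x), fst (snd (\<gamma> x))) (fst (\<gamma> y), fst (snd (\<gamma> y))) = norm (fst (\<gamma> x - \<gamma> y), fst (snd (\<gamma> x - \<gamma> y)))"
        by (simp add: dist_norm)
      also have "\<dots> \<le> dist (\<gamma> x) (\<gamma> y)" unfolding dist_norm by (rule le)
      also have "\<dots> \<le> K * dist x y" by (rule lipschitz_onD[OF K xy])
      finally show "dist (fst (\<gamma> x), fst (snd (\<gamma> x))) (fst (\<gamma> y), fst (snd (\<gamma> y))) \<le> K * dist x y" .
    qed (rule lipschitz_on_nonneg[OF K])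
    show "AE x in lebesgue. x \<in> {0..1} \<longrightarrow>
      ((\<lambda>x. (fst (\<gamma> x), fst (snd (\<gamma> x)))) has_vector_derivative (fst (v x), fst (snd (v x)))) (at x within {0..1})"
      using AE
    proof eventually_elim
      case (elim x)
      show ?case
      proof
        assume "x \<in> {0..1}"
        then have d: "(\<gamma> has_vector_derivative v x) (at x within {0..1})" using elim by blast
        show "((\<lambda>x. (fst (\<gamma> x), fst (snd (\<gamma> x)))) has_vector_derivative (fst (v x), fst (snd (v x)))) (at x within {0..1})"
          by (intro has_vector_derivative_Pair bounded_linear.has_vector_derivative[OF bounded_linear_fst]
              bounded_linear.has_vector_derivative[OF bounded_linear_snd] d)
      qed
    qed
  qed
  have "AE x in lebesgue. x \<in> {0..1} \<longrightarrow> horizontal_norm (\<gamma> x) (v x) = g x"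
    using AE by eventually_elim (auto simp: horizontal_norm_eq g_def)
  then obtain N where N0: "N \<in> null_sets lebesgue"
    and sub: "{x \<in> space lebesgue. \<not> (x \<in> {0..1} \<longrightarrow> horizontal_norm (\<gamma> x) (v x) = g x)} \<subseteq> N"
    by (auto simp: eventually_ae_filter)
  have N: "negligible N" using N0 by (simp add: negligible_iff_null_sets)
  have eq: "horizontal_norm (\<gamma> x) (v x) = g x" if "x \<in> {0..1} - N" for x using sub that by auto
  have "g absolutely_integrable_on {0..1}"
    using gi by (simp add: absolutely_integrable_on_iff_nonneg g_def)
  then have "(\<lambda>x. horizontal_norm (\<gamma> x) (v x)) absolutely_integrable_on {0..1}"
    by (rule absolutely_integrable_spike[OF _ N]) (rule eq)
  then have "horizontal_length \<gamma> = integral {0..1} (\<lambda>x. horizontal_norm (\<gamma> x) (v x))"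
    unfolding horizontal_length_def v_def by (rule set_lebesgue_integral_eq_integral(2))
  also have "\<dots> = integral {0..1} g" by (rule integral_spike[OF N]) (use eq in auto)
  finally show ?thesis using that[OF K AE] gi unfolding g_def by blast
qed

lemma horizontal_length_nonneg: "horizontal_curve \<gamma> \<Longrightarrow> 0 \<le> horizontal_length \<gamma>"
  by (erule horizontal_curve_length) (auto intro: integral_nonneg)

text \<open>A linear functional grows along the curve no faster than its values on horizontal
  velocities allow. Pairing with the displacement itself bounds the horizontal displacement by the
  length \<open>l\<close>. For the vertical coordinate seen from \<open>p\<close>, horizontality
  gives a rate of at most \<open>2 * l\<close> times the speed, hence a total of
  \<open>2 * l\<^sup>2\<close>, with root below \<open>2 * l\<close>. The factor 3 adds
  \<open>l\<close> and \<open>2 * l\<close>.\<close>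

lemma hdist_le_length:
  fixes p q :: "'n::finite heis"
  assumes \<gamma>: "horizontal_curve \<gamma>" and pq: "\<gamma> 0 = p" "\<gamma> 1 = q"
  shows "hdist p q \<le> 3 * horizontal_length \<gamma>"
proof -
  obtain K v where K: "K-lipschitz_on {0..1} \<gamma>" and
    AE: "AE x in lebesgue. x \<in> {0..1} \<longrightarrow> (\<gamma> has_vector_derivative v x) (at x within {0..1}) \<and> v x \<in> horizontal_plane (\<gamma> x)" and
    g: "(\<lambda>x. norm (fst (v x), fst (snd (v x)))) integrable_on {0..1}" and
    len: "horizontal_length \<gamma> = integral {0..1} (\<lambda>x. norm (fst (v x), fst (snd (v x))))"
    by (rule horizontal_curve_length[OF \<gamma>])
  let ?g = "\<lambda>x. norm (fst (v x), fst (snd (v x)))"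
  define l where "l = horizontal_length \<gamma>"
  have l0: "l \<ge> 0" using horizontal_length_nonneg[OF \<gamma>] by (simp add: l_def)
  have functional: "B (\<gamma> t) - B (\<gamma> 0) \<le> c * l"
    if B: "bounded_linear B" and c: "c \<ge> 0" and t: "t \<in> {0..1}"
      and bd: "\<And>x. x \<in> {0..1} \<Longrightarrow> v x \<in> horizontal_plane (\<gamma> x) \<Longrightarrow> B (v x) \<le> c * ?g x" for B :: "'n heis \<Rightarrow> real" and c t
  proof -
    obtain M where M: "M \<ge> 0" "\<And>x. norm (B x) \<le> norm x * M" using bounded_linear.nonneg_bounded[OF B] by blast
    have "(M * K)-lipschitz_on {0..1} (\<lambda>x. B (\<gamma> x))"
    proof (rule lipschitz_onI)
      fix x y :: real assume xy: "x \<in> {0..1}" "y \<in> {0..1}"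
      have "dist (B (\<gamma> x)) (B (\<gamma> y)) \<le> dist (\<gamma> x) (\<gamma> y) * M"
        using M(2)[of "\<gamma> x - \<gamma> y"] by (simp add: dist_norm linear_diff[OF bounded_linear.linear[OF B]])
      also have "\<dots> \<le> (K * dist x y) * M" by (rule mult_right_mono[OF lipschitz_onD[OF K xy] M(1)])
      finally show "dist (B (\<gamma> x)) (B (\<gamma> y)) \<le> M * K * dist x y" by (simp add: mult_ac)
    qed (use M lipschitz_on_nonneg[OF K] in simp)
    then have "B (\<gamma> t) - B (\<gamma> 0) \<le> integral {0..1} (\<lambda>x. c * ?g x)"
    proof (rule Lipschitz_increment_le)
      show "AE x in lebesgue. x \<in> {0..1} \<longrightarrow> (\<exists>d. ((\<lambda>x. B (\<gamma> x)) has_real_derivative d) (at x within {0..1}) \<and> d \<le> c * ?g x)"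
        using AE
      proof eventually_elim
        case (elim x)
        show ?case
        proof
          assume x: "x \<in> {0..1}"
          then have "((\<lambda>x. B (\<gamma> x)) has_vector_derivative B (v x)) (at x within {0..1})"
            using elim bounded_linear.has_vector_derivative[OF B] by blast
          then show "\<exists>d. ((\<lambda>x. B (\<gamma> x)) has_real_derivative d) (at x within {0..1}) \<and> d \<le> c * ?g x"
            using bd[OF x] elim x by (auto simp: has_real_derivative_iff_has_vector_derivative)
        qed
      qed
    qed (use g c t in \<open>auto intro: integrable_on_mult_right\<close>)
    also have "\<dots> = c * l" by (simp add: l_def len)
    finally show ?thesis .
  qed
  have z: "norm (fst (\<gamma> t) - fst p, fst (snd (\<gamma> t)) - fst (snd p)) \<le> l" if t: "t \<in> {0..1}" for t
  proof -
    let ?w = "(fst (\<gamma> t) - fst p, fst (snd (\<gamma> t)) - fst (snd p))"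
    let ?B = "\<lambda>u::'n heis. ?w \<bullet> (fst u, fst (snd u))"
    have "?B (\<gamma> t) - ?B (\<gamma> 0) \<le> norm ?w * l"
    proof (rule functional[OF _ _ t])
      show "bounded_linear ?B"
        by (intro bounded_linear_inner_right_comp bounded_linear_Pair bounded_linear_fst
            bounded_linear_fst_comp bounded_linear_snd)
      show "?B (v x) \<le> norm ?w * ?g x" for x by (rule norm_cauchy_schwarz)
    qed simp
    moreover have "?B (\<gamma> t) - ?B (\<gamma> 0) = ?w \<bullet> ?w"
      unfolding inner_diff_right[symmetric] pq by (simp only: diff_Pair)
    moreover have "?w \<bullet> ?w = norm ?w * norm ?w" by (simp only: norm_eq_sqrt_inner) simp
    ultimately have "norm ?w * norm ?w \<le> norm ?w * l" by linarith
    then show ?thesis using l0 by (cases "norm ?w = 0") (auto simp: mult_le_cancel_left)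
  qed
  have tau: "e * (snd (snd q) - snd (snd p) - 2 * (fst (snd p) \<bullet> fst q - fst p \<bullet> fst (snd q))) \<le> (2 * l) * l"
    if e: "\<bar>e\<bar> = 1" for e :: real
  proof -
    let ?B = "\<lambda>u::'n heis. e * (snd (snd u) - 2 * (fst (snd p) \<bullet> fst u - fst p \<bullet> fst (snd u)))"
    have "?B (\<gamma> 1) - ?B (\<gamma> 0) \<le> (2 * l) * l"
    proof (rule functional)
      have "linear ?B" by (rule linearI) (simp_all add: inner_simps algebra_simps)
      then show "bounded_linear ?B" by (simp add: linear_conv_bounded_linear)
      fix x :: real assume x: "x \<in> {0..1}" and h: "v x \<in> horizontal_plane (\<gamma> x)"
      let ?w = "(fst (snd (\<gamma> x)) - fst (snd p), - (fst (\<gamma> x) - fst p))"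
      have "snd (snd (v x)) - 2 * (fst (snd p) \<bullet> fst (v x) - fst p \<bullet> fst (snd (v x))) =
          2 * (?w \<bullet> (fst (v x), fst (snd (v x))))"
        using h by (simp add: horizontal_plane_iff inner_simps algebra_simps)
      then have "?B (v x) = e * (2 * (?w \<bullet> (fst (v x), fst (snd (v x)))))" by (simp only:)
      also have "\<dots> \<le> \<bar>2 * (?w \<bullet> (fst (v x), fst (snd (v x))))\<bar>"
        using e abs_ge_self[of "e * (2 * (?w \<bullet> (fst (v x), fst (snd (v x)))))"] by (simp add: abs_mult)
      also have "\<dots> \<le> 2 * (norm ?w * ?g x)"
        using Cauchy_Schwarz_ineq2[of ?w "(fst (v x), fst (snd (v x)))"] by simp
      also have "norm ?w = norm (fst (\<gamma> x) - fst p, fst (snd (\<gamma> x)) - fst (snd p))"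
        by (simp add: norm_Pair norm_minus_commute add.commute)
      also have "2 * (norm (fst (\<gamma> x) - fst p, fst (snd (\<gamma> x)) - fst (snd p)) * ?g x) \<le> 2 * (l * ?g x)"
        by (intro mult_left_mono mult_right_mono z[OF x]) auto
      finally show "?B (v x) \<le> 2 * l * ?g x" by simp
    qed (use l0 in auto)
    then show ?thesis using pq by (simp add: inner_commute algebra_simps)
  qed
  let ?\<tau> = "snd (snd q) - snd (snd p) - 2 * (fst (snd p) \<bullet> fst q - fst p \<bullet> fst (snd q))"
  have "\<bar>?\<tau>\<bar> \<le> (2 * l)\<^sup>2"
    using tau[of 1] tau[of "-1"] zero_le_square[of l] by (simp add: abs_le_iff power2_eq_square)
  then have "sqrt \<bar>?\<tau>\<bar> \<le> sqrt ((2 * l)\<^sup>2)" by (rule real_sqrt_le_mono)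
  also have "sqrt ((2 * l)\<^sup>2) = 2 * l" using l0 by (simp only: real_sqrt_abs)
  finally have "sqrt \<bar>?\<tau>\<bar> \<le> 2 * l" .
  moreover have "norm (fst q - fst p, fst (snd q) - fst (snd p)) \<le> l" using z[of 1] pq by simp
  ultimately show ?thesis unfolding hdist_def l_def[symmetric] by linarith
qed

section \<open>An explicit horizontal curve of comparable length\<close>

definition loop1 :: "real \<Rightarrow> real" where "loop1 s = s - 3 * s^2 + 2 * s^3"
definition loop2 :: "real \<Rightarrow> real" where "loop2 s = s - 6 * s^2 + 10 * s^3 - 5 * s^4"
definition dloop1 :: "real \<Rightarrow> real" where "dloop1 s = 1 - 6 * s + 6 * s^2"
definition dloop2 :: "real \<Rightarrow> real" where "dloop2 s = 1 - 12 * s + 30 * s^2 - 20 * s^3"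

text \<open>Both loop profiles \<open>loop1\<close> and \<open>loop2\<close> vanish at the endpoints and have mean zero, so the loop
  \<open>(a loop1, b loop2)\<close> added to a segment contributes only its own area \<open>ab/35\<close> to the height.\<close>

definition loop_height :: "real \<Rightarrow> real \<Rightarrow> real \<Rightarrow> real \<Rightarrow> real \<Rightarrow> real"
  where "loop_height a b X Y s = 2 * (a * Y * (s^4 - s^3) - b * X * (- 2 * s^3 + 5 * s^4 - 3 * s^5) +
    a * b * (s^3 - 4 * s^4 + 33 / 5 * s^5 - 5 * s^6 + 10 / 7 * s^7))"

lemma has_real_derivative_loop: "(loop1 has_real_derivative dloop1 s) (at s)" "(loop2 has_real_derivative dloop2 s) (at s)"
  unfolding loop1_def[abs_def] loop2_def[abs_def] dloop1_def dloop2_def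
  by (auto intro!: derivative_eq_intros simp: power2_eq_square power3_eq_cube)

lemma has_real_derivative_loop_height:
  "(loop_height a b X Y has_real_derivative
     2 * (a * Y * (s * dloop1 s - loop1 s) - b * X * (s * dloop2 s - loop2 s) + a * b * (loop2 s * dloop1 s - loop1 s * dloop2 s))) (at s)"
  unfolding loop_height_def[abs_def] loop1_def loop2_def dloop1_def dloop2_def
  by (rule derivative_eq_intros refl | simp)+ (simp add: algebra_simps power_numeral_reduce)

lemma dloop_bound: "s \<in> {0..1} \<Longrightarrow> \<bar>dloop1 s\<bar> \<le> 13" "s \<in> {0..1} \<Longrightarrow> \<bar>dloop2 s\<bar> \<le> 63"
proof -
  assume s: "s \<in> {0..1}"
  then have p: "0 \<le> s^k" "s^k \<le> 1" for k by (auto intro: power_le_one)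
  have b: "0 \<le> s" "s \<le> 1" "0 \<le> s\<^sup>2" "s\<^sup>2 \<le> 1" "0 \<le> s^3" "s^3 \<le> 1" using s p by auto
  show "\<bar>dloop1 s\<bar> \<le> 13" unfolding dloop1_def abs_le_iff using b by linarith
  show "\<bar>dloop2 s\<bar> \<le> 63" unfolding dloop2_def abs_le_iff using b by linarith
qed

text \<open>The curve is the left translate by \<open>p\<close> of a straight segment with a loop
  superposed in one coordinate direction of x and of y. A segment from the origin gains no height,
  so the loop alone produces the vertical coordinate \<open>T\<close> of the target seen from
  \<open>p\<close>.\<close>

lemma ex_horizontal_curve:
  fixes p q :: "'n::finite heis"
  obtains \<gamma> where "horizontal_curve \<gamma>" "\<gamma> 0 = p" "\<gamma> 1 = q" "horizontal_length \<gamma> \<le> 400 * hdist p q"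
proof -
  define x0 y0 t0 where "x0 = fst p" "y0 = fst (snd p)" "t0 = snd (snd p)"
  define X Y where "X = fst q - x0" "Y = fst (snd q) - y0"
  define T where "T = snd (snd q) - t0 - 2 * (y0 \<bullet> fst q - x0 \<bullet> fst (snd q))"
  note defs = x0_y0_t0_def X_Y_def T_def
  \<comment> \<open>The height gained is \<open>2 * a * b / 35\<close>, so
    \<open>a * b = 35 / 2 * T\<close> is wanted. The sign of \<open>T\<close> goes into
    \<open>b\<close>, and both amplitudes are of order \<open>sqrt \<bar>T\<bar>\<close>.\<close>
  define a where "a = sqrt (35 * \<bar>T\<bar> / 2)"
  define b where "b = sgn T * a"
  have ab: "a * b = 35 / 2 * T"
  proof -
    have "a * a = 35 * \<bar>T\<bar> / 2" by (simp add: a_def)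
    moreover have "a * b = sgn T * (a * a)" unfolding b_def by (simp only: mult.left_commute)
    ultimately have "a * b = sgn T * (35 * \<bar>T\<bar> / 2)" by (simp only:)
    then have "a * b = 35 / 2 * (sgn T * \<bar>T\<bar>)" by simp
    then show ?thesis by (simp only: sgn_mult_abs)
  qed
  have a0: "a \<ge> 0" by (simp add: a_def)
  have ba: "\<bar>b\<bar> \<le> a" using a0 by (auto simp: b_def sgn_if)
  have a5: "a \<le> 5 * sqrt \<bar>T\<bar>"
  proof -
    have "a \<le> sqrt (25 * \<bar>T\<bar>)" unfolding a_def by (rule real_sqrt_le_mono) simp
    then show ?thesis by (simp add: real_sqrt_mult)
  qed
  obtain i :: 'n where True by blast
  define e where "e = axis i (1::real)"
  have ee: "e \<bullet> e = 1" by (simp add: e_def inner_axis_axis)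
  have ne: "norm e = 1" by (simp add: e_def)
  define x y where "x s = s *\<^sub>R X + (a * loop1 s) *\<^sub>R e" and "y s = s *\<^sub>R Y + (b * loop2 s) *\<^sub>R e" for s
  define dx dy where "dx s = X + (a * dloop1 s) *\<^sub>R e" and "dy s = Y + (b * dloop2 s) *\<^sub>R e" for s
  define \<theta> where "\<theta> s = loop_height a b (X \<bullet> e) (Y \<bullet> e) s" for s
  define \<gamma> where "\<gamma> s = (x0 + x s, y0 + y s, t0 + \<theta> s + 2 * (y0 \<bullet> x s - x0 \<bullet> y s))" for s
  define d\<gamma> where "d\<gamma> s = (dx s, dy s, 2 * ((y0 + y s) \<bullet> dx s - (x0 + x s) \<bullet> dy s))" for s
  have cont: "continuous_on S loop1" "continuous_on S loop2" "continuous_on S dloop1" "continuous_on S dloop2" for S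
    unfolding loop1_def[abs_def] loop2_def[abs_def] dloop1_def[abs_def] dloop2_def[abs_def] by (intro continuous_intros)+
  have derx: "(x has_vector_derivative dx s) (at s)" for s
    unfolding x_def[abs_def] dx_def
    by (auto intro!: derivative_eq_intros has_real_derivative_loop)
  have dery: "(y has_vector_derivative dy s) (at s)" for s
    unfolding y_def[abs_def] dy_def
    by (auto intro!: derivative_eq_intros has_real_derivative_loop)
  have der\<theta>: "(\<theta> has_vector_derivative 2 * (y s \<bullet> dx s - x s \<bullet> dy s)) (at s)" for s
  proof -
    have "2 * (y s \<bullet> dx s - x s \<bullet> dy s) = 2 * (a * (Y \<bullet> e) * (s * dloop1 s - loop1 s) - b * (X \<bullet> e) * (s * dloop2 s - loop2 s)
        + a * b * (loop2 s * dloop1 s - loop1 s * dloop2 s))"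
      unfolding x_def y_def dx_def dy_def
      by (simp add: inner_simps ee inner_commute[of e X] inner_commute[of e Y] inner_commute[of Y X] algebra_simps)
    then show ?thesis
      using has_real_derivative_loop_height[of a b "X \<bullet> e" "Y \<bullet> e" s]
      unfolding \<theta>_def[abs_def] by (simp only: has_real_derivative_iff_has_vector_derivative)
  qed
  have der: "(\<gamma> has_vector_derivative d\<gamma> s) (at s)" for s
  proof -
    have lin: "bounded_linear (\<lambda>u. c \<bullet> u)" for c :: "real ^ 'n" by (rule bounded_linear_inner_right)
    have "((\<lambda>s. t0 + \<theta> s + 2 * (y0 \<bullet> x s - x0 \<bullet> y s)) has_vector_derivative
        0 + 2 * (y s \<bullet> dx s - x s \<bullet> dy s) + 2 * (y0 \<bullet> dx s - x0 \<bullet> dy s)) (at s)"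
      by (intro has_vector_derivative_add has_vector_derivative_const der\<theta> has_vector_derivative_mult_right
          has_vector_derivative_diff bounded_linear.has_vector_derivative[OF lin] derx dery)
    moreover have "((\<lambda>s. x0 + x s) has_vector_derivative 0 + dx s) (at s)" "((\<lambda>s. y0 + y s) has_vector_derivative 0 + dy s) (at s)"
      by (intro has_vector_derivative_add has_vector_derivative_const derx dery)+
    ultimately have "(\<gamma> has_vector_derivative (0 + dx s, 0 + dy s, 0 + 2 * (y s \<bullet> dx s - x s \<bullet> dy s) + 2 * (y0 \<bullet> dx s - x0 \<bullet> dy s))) (at s)"
      unfolding \<gamma>_def[abs_def] by (intro has_vector_derivative_Pair)
    then show ?thesis by (simp add: d\<gamma>_def inner_simps algebra_simps)
  qed
  have vd: "vector_derivative \<gamma> (at s within {0..1}) = d\<gamma> s" if "s \<in> {0..1}" for s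
    using vector_derivative_within_cbox[of 0 1 s \<gamma> "d\<gamma> s"] has_vector_derivative_at_within[OF der] that by simp
  have plane: "d\<gamma> s \<in> horizontal_plane (\<gamma> s)" for s
    by (simp add: horizontal_plane_iff d\<gamma>_def \<gamma>_def)
  have cd: "continuous_on S d\<gamma>" for S
    unfolding d\<gamma>_def[abs_def] dx_def dy_def x_def y_def by (intro continuous_intros cont)
  have lip: "\<exists>L. L-lipschitz_on {0..1} \<gamma>"
  proof -
    have "compact (d\<gamma> ` {0..1})" by (rule compact_continuous_image[OF cd]) simp
    then have "bounded (d\<gamma> ` {0..1})" by (rule compact_imp_bounded)
    then obtain C where "\<forall>u\<in>d\<gamma> ` {0..1}. norm u \<le> C" unfolding bounded_iff by (rule exE)
    then have C: "norm (d\<gamma> s) \<le> C" if "s \<in> {0..1}" for s using that by simp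
    have "norm (\<gamma> u - \<gamma> v) \<le> \<bar>C\<bar> * norm (u - v)" if "u \<in> {0..1}" "v \<in> {0..1}" for u v
    proof (rule differentiable_bound[of "{0..1}" \<gamma> "\<lambda>s h. h *\<^sub>R d\<gamma> s"])
      show "(\<gamma> has_derivative (\<lambda>h. h *\<^sub>R d\<gamma> s)) (at s within {0..1})" for s
        using has_vector_derivative_at_within[OF der] by (simp add: has_vector_derivative_def)
      show "onorm (\<lambda>h. h *\<^sub>R d\<gamma> s) \<le> \<bar>C\<bar>" if "s \<in> {0..1}" for s
      proof (rule onorm_le)
        show "norm (h *\<^sub>R d\<gamma> s) \<le> \<bar>C\<bar> * norm h" for h :: real
          using mult_left_mono[OF order_trans[OF C[OF that] abs_ge_self], of "\<bar>h\<bar>"] by (simp add: mult.commute)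
      qed
    qed (use that in auto)
    then have "\<bar>C\<bar>-lipschitz_on {0..1} \<gamma>" by (intro lipschitz_onI) (auto simp: dist_norm)
    then show ?thesis by blast
  qed
  have hc: "horizontal_curve \<gamma>"
    unfolding horizontal_curve_def
  proof (intro conjI lip AE_I2 impI)
    fix s :: real assume s: "s \<in> {0..1}"
    show "\<gamma> differentiable (at s within {0..1})"
      using has_vector_derivative_at_within[OF der] by (auto simp: differentiable_def has_vector_derivative_def)
    show "vector_derivative \<gamma> (at s within {0..1}) \<in> horizontal_plane (\<gamma> s)"
      unfolding vd[OF s] by (rule plane)
  qed
  have g0: "\<gamma> 0 = p"
    by (simp add: \<gamma>_def x_def y_def \<theta>_def loop_height_def loop1_def loop2_def x0_y0_t0_def)
  have g1: "\<gamma> 1 = q"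
  proof -
    have x1: "x 1 = X" "y 1 = Y" by (simp_all add: x_def y_def loop1_def loop2_def)
    have "\<theta> 1 = T" using ab by (simp add: \<theta>_def loop_height_def)
    then have "t0 + \<theta> 1 + 2 * (y0 \<bullet> x 1 - x0 \<bullet> y 1) = snd (snd q)"
      unfolding x1 by (simp add: T_def X_Y_def inner_simps inner_commute)
    then show ?thesis using x1 by (simp add: \<gamma>_def X_Y_def prod_eq_iff)
  qed
  have "horizontal_length \<gamma> \<le> 400 * hdist p q"
  proof -
    define C where "C = norm (X, Y) + 13 * a + 63 * a"
    have bd: "norm (dx s, dy s) \<le> C" if s: "s \<in> {0..1}" for s
    proof -
      have "(dx s, dy s) = (X, Y) + (((a * dloop1 s) *\<^sub>R e, 0) + (0, (b * dloop2 s) *\<^sub>R e))" by (simp add: dx_def dy_def)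
      then have "norm (dx s, dy s) \<le> norm (X, Y) + (norm ((a * dloop1 s) *\<^sub>R e, 0::real^'n) + norm (0::real^'n, (b * dloop2 s) *\<^sub>R e))"
        by (simp only:) (rule order_trans[OF norm_triangle_ineq add_left_mono[OF norm_triangle_ineq]])
      also have "norm ((a * dloop1 s) *\<^sub>R e, 0::real^'n) = a * \<bar>dloop1 s\<bar>" using a0 ne by (simp add: norm_Pair abs_mult)
      also have "norm (0::real^'n, (b * dloop2 s) *\<^sub>R e) = \<bar>b\<bar> * \<bar>dloop2 s\<bar>" using ne by (simp add: norm_Pair abs_mult)
      also have "norm (X, Y) + (a * \<bar>dloop1 s\<bar> + \<bar>b\<bar> * \<bar>dloop2 s\<bar>) \<le> norm (X, Y) + (a * 13 + a * 63)"
        using dloop_bound[OF s] a0 ba by (intro add_mono mult_mono order_refl) auto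
      finally show ?thesis by (simp add: C_def)
    qed
    have len: "horizontal_length \<gamma> = (LINT s:{0..1}|lebesgue. norm (dx s, dy s))"
      unfolding horizontal_length_def
    proof (rule set_lebesgue_integral_cong)
      show "\<forall>s. s \<in> {0..1} \<longrightarrow> horizontal_norm (\<gamma> s) (vector_derivative \<gamma> (at s within {0..1})) = norm (dx s, dy s)"
        using vd horizontal_norm_eq[OF plane] by (simp add: d\<gamma>_def)
    qed simp
    have cn: "continuous_on {0..1} (\<lambda>s. norm (dx s, dy s))"
      unfolding dx_def dy_def by (intro continuous_intros cont)
    have "(\<lambda>s. norm (dx s, dy s)) absolutely_integrable_on {0..1}"
      by (rule absolutely_integrable_continuous_real[OF cn])
    then have "horizontal_length \<gamma> = integral {0..1} (\<lambda>s. norm (dx s, dy s))"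
      unfolding len by (rule set_lebesgue_integral_eq_integral(2))
    also have "\<dots> \<le> integral {0..1::real} (\<lambda>s. C)"
      by (rule integral_le) (use integrable_continuous_real[OF cn] bd in auto)
    also have "\<dots> = C" by simp
    \<comment> \<open>\<open>380 = (13 + 63) * 5\<close>.\<close>
    also have "C \<le> norm (X, Y) + 380 * sqrt \<bar>T\<bar>" using a5 by (simp add: C_def)
    also have "\<dots> \<le> 400 * (norm (X, Y) + sqrt \<bar>T\<bar>)" by simp
    also have "\<dots> = 400 * hdist p q" by (simp add: hdist_def defs)
    finally show ?thesis .
  qed
  then show ?thesis using that hc g0 g1 by blast
qed

lemma d_cc_le_hdist: "d_cc p q \<le> 400 * hdist p q"
proof -
  obtain \<gamma> where g: "horizontal_curve \<gamma>" "\<gamma> 0 = p" "\<gamma> 1 = q" "horizontal_length \<gamma> \<le> 400 * hdist p q"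
    by (rule ex_horizontal_curve)
  have "d_cc p q \<le> horizontal_length \<gamma>"
    unfolding d_cc_def
  proof (rule cInf_lower)
    show "bdd_below (horizontal_length ` {\<gamma>. horizontal_curve \<gamma> \<and> \<gamma> 0 = p \<and> \<gamma> 1 = q})"
      by (rule bdd_belowI[of _ 0]) (auto intro: horizontal_length_nonneg)
  qed (use g in auto)
  then show ?thesis using g(4) by linarith
qed

lemma hdist_le_d_cc: "hdist p q \<le> 3 * d_cc p q"
proof -
  have "hdist p q / 3 \<le> d_cc p q"
    unfolding d_cc_def
  proof (rule cInf_greatest)
    obtain \<gamma> where "horizontal_curve \<gamma>" "\<gamma> 0 = p" "\<gamma> 1 = q"
      by (rule ex_horizontal_curve[of p q]) (rule that)
    then show "horizontal_length ` {\<gamma>. horizontal_curve \<gamma> \<and> \<gamma> 0 = p \<and> \<gamma> 1 = q} \<noteq> {}" by blast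
  next
    fix l assume "l \<in> horizontal_length ` {\<gamma>. horizontal_curve \<gamma> \<and> \<gamma> 0 = p \<and> \<gamma> 1 = q}"
    then obtain \<gamma> where "horizontal_curve \<gamma>" "\<gamma> 0 = p" "\<gamma> 1 = q" "l = horizontal_length \<gamma>" by blast
    then show "hdist p q / 3 \<le> l" using hdist_le_length[of \<gamma> p q] by simp
  qed
  then show ?thesis by simp
qed

section \<open>Lipschitz maps on a lattice\<close>

context heis_coords begin

lemma nrm_sym: "nrm (- p \<odot> q) = nrm (- q \<odot> p)"
  using nrm_minus[of "- p \<odot> q"] by (simp add: minus_mul)

lemma nrm_diff: "nrm (- p \<odot> q) = norm (hor (q - p)) + sqrt \<bar>q $ tau - p $ tau - 2 * om p q\<bar>"
  by (simp add: nrm_def hor_minus hor_diff om_simps)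

text \<open>The integer points of the group, dilated by \<open>\<epsilon>\<close>. The vertical
  spacing \<open>\<epsilon>\<^sup>2\<close> makes them closed under \<open>- p \<odot> q\<close> and
  separated by \<open>\<epsilon>\<close> in \<open>nrm\<close>.\<close>

definition lattice :: "real \<Rightarrow> 'N pt set"
  where "lattice \<epsilon> = {g. (\<forall>k. k \<noteq> tau \<longrightarrow> (\<exists>z\<in>\<int>. g $ k = z * \<epsilon>)) \<and> (\<exists>z\<in>\<int>. g $ tau = z * \<epsilon>\<^sup>2)}"

lemma lattice_diff:
  assumes p: "p \<in> lattice \<epsilon>" and q: "q \<in> lattice \<epsilon>" shows "- p \<odot> q \<in> lattice \<epsilon>"
proof -
  obtain P where P: "\<And>k. k \<noteq> tau \<Longrightarrow> P k \<in> \<int> \<and> p $ k = P k * \<epsilon>"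
    using p unfolding lattice_def mem_Collect_eq by metis
  obtain Q where Q: "\<And>k. k \<noteq> tau \<Longrightarrow> Q k \<in> \<int> \<and> q $ k = Q k * \<epsilon>"
    using q unfolding lattice_def mem_Collect_eq by metis
  obtain zp zq where z: "zp \<in> \<int>" "p $ tau = zp * \<epsilon>\<^sup>2" "zq \<in> \<int>" "q $ tau = zq * \<epsilon>\<^sup>2"
    using p q unfolding lattice_def mem_Collect_eq by blast
  define w where "w = (\<Sum>i\<in>UNIV. P (yi i) * Q (xi i) - P (xi i) * Q (yi i))"
  have w: "w \<in> \<int>" unfolding w_def using P Q by (intro Ints_sum Ints_diff Ints_mult) auto
  have "om p q = w * \<epsilon>\<^sup>2"
    unfolding om_def w_def sum_distrib_right using P Q
    by (intro sum.cong refl) (simp add: power2_eq_square algebra_simps)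
  then have "(- p \<odot> q) $ tau = (zq - zp - 2 * w) * \<epsilon>\<^sup>2" using z by (simp add: om_simps algebra_simps)
  moreover have "zq - zp - 2 * w \<in> \<int>" using z w by (intro Ints_diff Ints_mult) auto
  moreover have "(- p \<odot> q) $ k = (Q k - P k) * \<epsilon>" "Q k - P k \<in> \<int>" if "k \<noteq> tau" for k
    using P[OF that] Q[OF that] that by (auto simp: algebra_simps intro: Ints_diff)
  ultimately show ?thesis unfolding lattice_def mem_Collect_eq by blast
qed

lemma lattice_nrm_ge:
  assumes v: "v \<in> lattice \<epsilon>" "v \<noteq> 0" and \<epsilon>: "\<epsilon> > 0" shows "nrm v \<ge> \<epsilon>"
proof -
  have one: "\<bar>z\<bar> \<ge> 1" if "z \<in> \<int>" "z \<noteq> 0" for z :: real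
    using that by (rule Ints_nonzero_abs_ge1)
  obtain k where k: "v $ k \<noteq> 0" using v(2) by (auto simp: vec_eq_iff)
  show ?thesis
  proof (cases "k = tau")
    case True
    obtain z where z: "z \<in> \<int>" "v $ tau = z * \<epsilon>\<^sup>2" using v(1) unfolding lattice_def by blast
    then have "z \<noteq> 0" using k True by auto
    then have "1 * \<epsilon>\<^sup>2 \<le> \<bar>z\<bar> * \<epsilon>\<^sup>2" using one[OF z(1)] by (intro mult_right_mono) auto
    then have "\<epsilon>\<^sup>2 \<le> \<bar>v $ tau\<bar>" using z by (simp add: abs_mult)
    then have "sqrt (\<epsilon>\<^sup>2) \<le> sqrt \<bar>v $ tau\<bar>" by (rule real_sqrt_le_mono)
    then have "\<epsilon> \<le> sqrt \<bar>v $ tau\<bar>" using \<epsilon> by simp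
    then show ?thesis unfolding nrm_def using norm_ge_zero[of "hor v"] by linarith
  next
    case False
    obtain z where z: "z \<in> \<int>" "v $ k = z * \<epsilon>" using v(1) False unfolding lattice_def by blast
    then have "z \<noteq> 0" using k by auto
    then have "1 * \<epsilon> \<le> \<bar>z\<bar> * \<epsilon>" using one[OF z(1)] \<epsilon> by (intro mult_right_mono) auto
    then have "\<epsilon> \<le> \<bar>hor v $ k\<bar>" using z False \<epsilon> by (simp add: abs_mult)
    also have "\<dots> \<le> norm (hor v)" by (rule component_le_norm_cart)
    also have "\<dots> \<le> nrm v" by (rule nrm_hor)
    finally show ?thesis .
  qed
qed

text \<open>The vertical coordinate of \<open>- g \<odot> p\<close> must be small, so the vertical
  coordinate of \<open>p\<close> is rounded only after \<open>2 * om g0 p\<close> has been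
  subtracted. This is not circular, as \<open>om g p\<close> ignores the vertical coordinate of
  \<open>g\<close>.\<close>

lemma lattice_dense:
  assumes \<epsilon>: "\<epsilon> > 0"
  obtains g where "g \<in> lattice \<epsilon>" "nrm (- g \<odot> p) \<le> (real CARD('N) + 1) * \<epsilon>"
proof -
  define g0 where "g0 = (\<chi> k. if k = tau then 0 else of_int \<lfloor>p $ k / \<epsilon>\<rfloor> * \<epsilon>)"
  define g where "g = (\<chi> k. if k = tau then of_int \<lfloor>(p $ tau - 2 * om g0 p) / \<epsilon>\<^sup>2\<rfloor> * \<epsilon>\<^sup>2 else g0 $ k)"
  have fl: "\<bar>a - of_int \<lfloor>a / c\<rfloor> * c\<bar> \<le> c" if "c > 0" for a c :: real
  proof -
    have l: "of_int \<lfloor>a / c\<rfloor> \<le> a / c" "a / c < of_int \<lfloor>a / c\<rfloor> + 1" by linarith+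
    have "of_int \<lfloor>a / c\<rfloor> * c \<le> a" by (rule pos_le_divide_eq[OF that, THEN iffD1, OF l(1)])
    moreover have "a < (of_int \<lfloor>a / c\<rfloor> + 1) * c" by (rule pos_divide_less_eq[OF that, THEN iffD1, OF l(2)])
    ultimately show ?thesis using that by (simp add: abs_le_iff algebra_simps)
  qed
  have om: "om g p = om g0 p"
    by (simp add: om_def g_def)
  have "g \<in> lattice \<epsilon>" by (auto simp: lattice_def g_def g0_def)
  moreover have "nrm (- g \<odot> p) \<le> (real CARD('N) + 1) * \<epsilon>"
  proof -
    have "\<bar>hor (p - g) $ k\<bar> \<le> \<epsilon>" for k
      using fl[OF \<epsilon>, of "p $ k"] \<epsilon> by (simp add: hor_def g_def g0_def)
    then have "(\<Sum>k\<in>UNIV. \<bar>hor (p - g) $ k\<bar>) \<le> real CARD('N) * \<epsilon>"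
      using sum_bounded_above[of UNIV "\<lambda>k. \<bar>hor (p - g) $ k\<bar>" \<epsilon>] by simp
    then have 1: "norm (hor (p - g)) \<le> real CARD('N) * \<epsilon>" using norm_le_l1_cart order_trans by blast
    have "\<bar>p $ tau - g $ tau - 2 * om g p\<bar> \<le> \<epsilon>\<^sup>2"
      using fl[of "\<epsilon>\<^sup>2" "p $ tau - 2 * om g0 p"] \<epsilon> unfolding om by (simp add: g_def algebra_simps)
    then have "sqrt \<bar>p $ tau - g $ tau - 2 * om g p\<bar> \<le> sqrt (\<epsilon>\<^sup>2)" by (rule real_sqrt_le_mono)
    then have "sqrt \<bar>p $ tau - g $ tau - 2 * om g p\<bar> \<le> \<epsilon>" using \<epsilon> by simp
    then show ?thesis unfolding nrm_diff using 1 by (simp add: algebra_simps)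
  qed
  ultimately show ?thesis by (rule that)
qed

lemma norm_diff_le_nrm:
  "norm (q - p) \<le> nrm (- p \<odot> q) * (1 + nrm (- p \<odot> q) + 2 * norm p)"
proof -
  define r where "r = nrm (- p \<odot> q)"
  have h: "norm (hor (q - p)) \<le> r" unfolding r_def nrm_diff by simp
  have "\<bar>(- p \<odot> q) $ tau\<bar> \<le> r\<^sup>2" unfolding r_def by (rule nrm_tau)
  then have t: "\<bar>q $ tau - p $ tau - 2 * om p q\<bar> \<le> r\<^sup>2" by (simp add: om_simps)
  have "om p q = om p (q - p)" by (simp add: om_simps)
  then have "\<bar>om p q\<bar> \<le> norm p * r"
    using om_bound[of p "q - p"] mult_mono[OF norm_hor_le[of p] h] by simp
  then have "\<bar>(q - p) $ tau\<bar> \<le> r\<^sup>2 + 2 * (norm p * r)" using t by (simp add: abs_le_iff)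
  then have "norm (q - p) \<le> r + (r\<^sup>2 + 2 * (norm p * r))" using norm_le_hor[of "q - p"] h by linarith
  also have "\<dots> = r * (1 + r + 2 * norm p)" by (simp add: power2_eq_square algebra_simps)
  finally show ?thesis unfolding r_def .
qed

text \<open>The square root, a loss in passing from Euclidean displacements to the homogeneous norm,
  is the source of the factor \<open>1 / sqrt \<epsilon>\<close> on the lattice.\<close>

lemma nrm_le_norm_diff: "nrm (- p \<odot> q) \<le> norm (q - p) + sqrt (norm (q - p) * (1 + 2 * norm p))"
proof -
  have "om p q = om p (q - p)" by (simp add: om_simps)
  then have "\<bar>om p q\<bar> \<le> norm p * norm (q - p)"
    using om_bound[of p "q - p"] mult_mono[OF norm_hor_le[of p] norm_hor_le[of "q - p"]] by simp
  moreover have "\<bar>(q - p) $ tau\<bar> \<le> norm (q - p)" by (rule component_le_norm_cart)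
  ultimately have "\<bar>q $ tau - p $ tau - 2 * om p q\<bar> \<le> norm (q - p) * (1 + 2 * norm p)"
    by (simp add: abs_le_iff algebra_simps)
  then show ?thesis unfolding nrm_diff using norm_hor_le[of "q - p"] by (intro add_mono real_sqrt_le_mono)
qed

text \<open>For distinct lattice points \<open>r = nrm (- p \<odot> q)\<close> is at least
  \<open>\<epsilon>\<close>, so a term \<open>sqrt r\<close> is at most
  \<open>r / sqrt \<epsilon>\<close>. The exterior of a ball is included in order that an extension
  be the identity there. From the inner ball to that exterior \<open>r\<close> is bounded below,
  while \<open>\<phi>\<close> moves points by a bounded amount.\<close>

lemma lattice_Lipschitz:
  fixes \<phi> :: "'N pt \<Rightarrow> 'N pt"
  assumes K: "K \<ge> 0" "\<And>p q. norm (\<phi> q - \<phi> p) \<le> K * norm (q - p)"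
    and \<rho>: "\<rho> \<ge> 0" and id: "\<And>p. norm p \<ge> \<rho> \<Longrightarrow> \<phi> p = p"
  obtains C where "C \<ge> 1" "\<And>\<epsilon> p q. 0 < \<epsilon> \<Longrightarrow> \<epsilon> \<le> 1 \<Longrightarrow> p \<in> lattice \<epsilon> \<union> {p. norm p \<ge> \<rho> + 1} \<Longrightarrow>
    q \<in> lattice \<epsilon> \<union> {p. norm p \<ge> \<rho> + 1} \<Longrightarrow> nrm (- \<phi> p \<odot> \<phi> q) \<le> C / sqrt \<epsilon> * nrm (- p \<odot> q)"
proof -
  define B where "B = norm (\<phi> 0) + K * \<rho>"
  have B0: "B \<ge> 0" using K \<rho> by (simp add: B_def)
  have B: "norm (\<phi> p) \<le> B" if "norm p < \<rho>" for p
  proof -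
    have "norm (\<phi> p) \<le> norm (\<phi> 0) + norm (\<phi> p - \<phi> 0)" using norm_triangle_ineq[of "\<phi> 0" "\<phi> p - \<phi> 0"] by simp
    also have "norm (\<phi> p - \<phi> 0) \<le> K * norm p" using K(2)[of p 0] by simp
    also have "K * norm p \<le> K * \<rho>" using K(1) that by (intro mult_left_mono) auto
    finally show ?thesis by (simp add: B_def)
  qed
  define d where "d = 1 + 2 * \<rho>"
  have d: "d \<ge> 1" using \<rho> by (simp add: d_def)
  define c where "c = K * (3 * d)"
  have c0: "c \<ge> 0" using K d by (simp add: c_def)
  define Ca where "Ca = c + sqrt (c * (1 + 2 * B))"
  define b where "b = B + \<rho>"
  have b0: "b \<ge> 0" using B0 \<rho> by (simp add: b_def)
  \<comment> \<open>It gives \<open>k * r \<ge> 1\<close> when \<open>p\<close> has norm below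
    \<open>\<rho>\<close> and \<open>q\<close> norm at least \<open>\<rho> + 1\<close>, so bounded
    quantities can be absorbed into multiples of \<open>r\<close>.\<close>
  define k where "k = 2 + 2 * \<rho>"
  have k: "k \<ge> 2" using \<rho> by (simp add: k_def)
  define Cb where "Cb = 1 + b * k + sqrt (1 + b * k\<^sup>2 * (1 + 2 * \<rho>) + 2 * b * k)"
  have near: "nrm (- \<phi> p \<odot> \<phi> q) \<le> Ca / sqrt \<epsilon> * nrm (- p \<odot> q)"
    if \<epsilon>: "0 < \<epsilon>" "\<epsilon> \<le> 1" and p: "norm p < \<rho>" and q: "norm q < \<rho> + 1" and r: "nrm (- p \<odot> q) \<ge> \<epsilon>" for \<epsilon> p q
  proof -
    define r where "r = nrm (- p \<odot> q)"
    have r0: "r > 0" using r \<epsilon> by (simp add: r_def)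
    have n: "norm (q - p) \<le> d" using norm_triangle_ineq4[of q p] p q by (simp add: d_def)
    have "r \<le> d + sqrt (d * d)"
    proof -
      have "norm (q - p) * (1 + 2 * norm p) \<le> d * d"
        using n p d by (intro mult_mono) (auto simp: d_def)
      then show ?thesis
        unfolding r_def using nrm_le_norm_diff[of p q] n real_sqrt_le_mono by fastforce
    qed
    then have "r \<le> 2 * d" using d by simp
    then have "r * (1 + r + 2 * norm p) \<le> r * (3 * d)"
      using p r0 by (intro mult_left_mono) (auto simp: d_def)
    then have nd: "norm (q - p) \<le> r * (3 * d)"
      using norm_diff_le_nrm[of q p] unfolding r_def[symmetric] by linarith
    have D: "norm (\<phi> q - \<phi> p) \<le> c * r"
      using order_trans[OF K(2) mult_left_mono[OF nd K(1)]] by (simp add: c_def mult_ac)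
    have "nrm (- \<phi> p \<odot> \<phi> q) \<le> norm (\<phi> q - \<phi> p) + sqrt (norm (\<phi> q - \<phi> p) * (1 + 2 * norm (\<phi> p)))"
      by (rule nrm_le_norm_diff)
    also have "\<dots> \<le> c * r + sqrt ((c * r) * (1 + 2 * B))"
      using D B[OF p] B0 c0 r0 by (intro add_mono real_sqrt_le_mono mult_mono) auto
    also have "sqrt ((c * r) * (1 + 2 * B)) = sqrt (c * (1 + 2 * B)) * sqrt r"
      by (simp add: real_sqrt_mult)
    also have "c * r + sqrt (c * (1 + 2 * B)) * sqrt r \<le> c * (r / sqrt \<epsilon>) + sqrt (c * (1 + 2 * B)) * (r / sqrt \<epsilon>)"
    proof (intro add_mono mult_left_mono)
      have "sqrt \<epsilon> \<le> 1" using \<epsilon> by simp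
      then have "r * sqrt \<epsilon> \<le> r * 1" using r0 by (intro mult_left_mono) auto
      then show "r \<le> r / sqrt \<epsilon>" using \<epsilon> by (simp add: pos_le_divide_eq)
      have "sqrt r * sqrt \<epsilon> \<le> sqrt r * sqrt r" using r unfolding r_def by (intro mult_left_mono) (auto simp: nrm_nonneg)
      then have "sqrt r * sqrt \<epsilon> \<le> r" using r0 by simp
      then show "sqrt r \<le> r / sqrt \<epsilon>" using \<epsilon> by (simp add: pos_le_divide_eq)
    qed (use c0 B0 in auto)
    also have "\<dots> = Ca / sqrt \<epsilon> * r" by (simp add: Ca_def add_divide_distrib algebra_simps)
    finally show ?thesis unfolding r_def .
  qed
  have far: "nrm (- \<phi> p \<odot> \<phi> q) \<le> Cb * nrm (- p \<odot> q)" if p: "norm p < \<rho>" and q: "norm q \<ge> \<rho> + 1" for p q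
  proof -
    define r where "r = nrm (- p \<odot> q)"
    have r0: "r \<ge> 0" by (simp add: r_def nrm_nonneg)
    have q': "\<phi> q = q" using id q by simp
    have "norm (q - p) \<ge> 1" using norm_triangle_ineq2[of q p] p q by simp
    then have 1: "1 \<le> r * (1 + r + 2 * norm p)" using norm_diff_le_nrm[of q p] by (simp add: r_def)
    have kr: "1 \<le> k * r"
    proof (cases "r \<le> 1")
      case True
      then have "r * (1 + r + 2 * norm p) \<le> r * k" using r0 p by (intro mult_left_mono) (auto simp: k_def)
      then show ?thesis using 1 by (simp add: mult.commute)
    next
      case False
      then show ?thesis using k mult_mono[of 1 k 1 r] by simp
    qed
    define u where "u = \<phi> p - p"
    have u: "norm u \<le> b" using norm_triangle_ineq4[of "\<phi> p" p] B[OF p] p by (simp add: u_def b_def)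
    have hd: "norm (hor (q - p)) \<le> r" unfolding r_def nrm_diff by simp
    have "norm (hor (q - \<phi> p)) \<le> norm (hor (q - p)) + norm (hor u)"
      using norm_triangle_ineq4[of "hor (q - p)" "hor u"] by (simp add: u_def hor_diff)
    also have "\<dots> \<le> r + b" using hd u norm_hor_le[of u] by linarith
    also have "\<dots> \<le> r + b * (k * r)" using kr b0 mult_left_mono[OF kr b0] by simp
    finally have H: "norm (hor (q - \<phi> p)) \<le> r + b * (k * r)" .
    have hq: "norm (hor q) \<le> \<rho> + r"
      using norm_triangle_ineq[of "hor p" "hor (q - p)"] norm_hor_le[of p] p hd by (simp add: hor_diff)
    have ou: "\<bar>om u q\<bar> \<le> b * (\<rho> + r)"
      using om_bound[of u q] mult_mono[OF order_trans[OF norm_hor_le u] hq b0] by simp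
    have "\<bar>(- p \<odot> q) $ tau\<bar> \<le> r\<^sup>2" unfolding r_def by (rule nrm_tau)
    then have t: "\<bar>q $ tau - p $ tau - 2 * om p q\<bar> \<le> r\<^sup>2" by (simp add: om_simps)
    have ut: "\<bar>u $ tau\<bar> \<le> b" using component_le_norm_cart[of u tau] u by simp
    have "q $ tau - \<phi> p $ tau - 2 * om (\<phi> p) q = (q $ tau - p $ tau - 2 * om p q) - u $ tau - 2 * om u q"
      by (simp add: u_def om_simps)
    then have "\<bar>q $ tau - \<phi> p $ tau - 2 * om (\<phi> p) q\<bar> \<le> r\<^sup>2 + b * 1 + 2 * (b * (\<rho> + r))"
      using t ut ou by linarith
    also have "\<dots> \<le> r\<^sup>2 + b * (k\<^sup>2 * r\<^sup>2) + 2 * (b * (\<rho> * (k\<^sup>2 * r\<^sup>2) + r * (k * r)))"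
    proof -
      have k2: "1 \<le> k\<^sup>2 * r\<^sup>2" using one_le_power[OF kr, of 2] by (simp add: power_mult_distrib)
      have "b * 1 \<le> b * (k\<^sup>2 * r\<^sup>2)" by (rule mult_left_mono[OF k2 b0])
      moreover have "\<rho> * 1 + r * 1 \<le> \<rho> * (k\<^sup>2 * r\<^sup>2) + r * (k * r)"
        by (intro add_mono mult_left_mono k2 kr \<rho> r0)
      then have "b * (\<rho> + r) \<le> b * (\<rho> * (k\<^sup>2 * r\<^sup>2) + r * (k * r))" using b0 by (intro mult_left_mono) auto
      ultimately show ?thesis by linarith
    qed
    also have "\<dots> = r\<^sup>2 * (1 + b * k\<^sup>2 * (1 + 2 * \<rho>) + 2 * b * k)"
      by (simp add: power2_eq_square algebra_simps)
    finally have "sqrt \<bar>q $ tau - \<phi> p $ tau - 2 * om (\<phi> p) q\<bar> \<le> sqrt (r\<^sup>2 * (1 + b * k\<^sup>2 * (1 + 2 * \<rho>) + 2 * b * k))"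
      by (rule real_sqrt_le_mono)
    also have "\<dots> = r * sqrt (1 + b * k\<^sup>2 * (1 + 2 * \<rho>) + 2 * b * k)"
      using r0 by (simp only: real_sqrt_mult real_sqrt_abs abs_of_nonneg)
    finally show ?thesis
      unfolding q' nrm_diff[of "\<phi> p"] r_def[symmetric] Cb_def using H by (simp add: algebra_simps)
  qed
  define C where "C = max 1 (max Ca Cb)"
  have C: "C \<ge> 1" "C \<ge> Ca" "C \<ge> Cb" by (auto simp: C_def)
  have half: "nrm (- \<phi> p \<odot> \<phi> q) \<le> C / sqrt \<epsilon> * nrm (- p \<odot> q)"
    if \<epsilon>: "0 < \<epsilon>" "\<epsilon> \<le> 1" and pq: "p \<in> lattice \<epsilon> \<union> {p. norm p \<ge> \<rho> + 1}" "q \<in> lattice \<epsilon> \<union> {p. norm p \<ge> \<rho> + 1}"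
      and p: "norm p < \<rho>" for \<epsilon> p q
  proof -
    have s: "0 < sqrt \<epsilon>" "sqrt \<epsilon> \<le> 1" using \<epsilon> by auto
    have Cs: "C \<le> C / sqrt \<epsilon>" using C s by (simp add: pos_le_divide_eq mult_left_le)
    consider "p = q" | "norm q \<ge> \<rho> + 1" | "p \<noteq> q" "norm q < \<rho> + 1" by linarith
    then show ?thesis
    proof cases
      case 1 then show ?thesis by simp
    next
      case 2
      have "Cb * nrm (- p \<odot> q) \<le> C / sqrt \<epsilon> * nrm (- p \<odot> q)"
        using C Cs by (intro mult_right_mono) (auto simp: nrm_nonneg)
      then show ?thesis using far[OF p 2] by linarith
    next
      case 3
      have L: "p \<in> lattice \<epsilon>" "q \<in> lattice \<epsilon>" using pq p 3 by auto
      have "- p \<odot> q \<noteq> 0" using 3(1) mul_cancel(1)[of p q] by (metis mul_0(1))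
      then have "nrm (- p \<odot> q) \<ge> \<epsilon>" using lattice_nrm_ge[OF lattice_diff[OF L] _ \<epsilon>(1)] by blast
      then have "nrm (- \<phi> p \<odot> \<phi> q) \<le> Ca / sqrt \<epsilon> * nrm (- p \<odot> q)" by (rule near[OF \<epsilon> p 3(2)])
      also have "\<dots> \<le> C / sqrt \<epsilon> * nrm (- p \<odot> q)"
        using C s by (intro mult_right_mono divide_right_mono) (auto simp: nrm_nonneg)
      finally show ?thesis .
    qed
  qed
  have "nrm (- \<phi> p \<odot> \<phi> q) \<le> C / sqrt \<epsilon> * nrm (- p \<odot> q)"
    if \<epsilon>: "0 < \<epsilon>" "\<epsilon> \<le> 1" and pq: "p \<in> lattice \<epsilon> \<union> {p. norm p \<ge> \<rho> + 1}" "q \<in> lattice \<epsilon> \<union> {p. norm p \<ge> \<rho> + 1}" for \<epsilon> p q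
  proof -
    consider "norm p < \<rho>" | "norm q < \<rho>" | "norm p \<ge> \<rho>" "norm q \<ge> \<rho>" by linarith
    then show ?thesis
    proof cases
      case 1 then show ?thesis by (rule half[OF \<epsilon> pq])
    next
      case 2 then show ?thesis using half[OF \<epsilon> pq(2,1)] by (simp only: nrm_sym)
    next
      case 3
      have "1 * nrm (- p \<odot> q) \<le> C / sqrt \<epsilon> * nrm (- p \<odot> q)"
      proof (rule mult_right_mono[OF _ nrm_nonneg])
        have "sqrt \<epsilon> \<le> C" using \<epsilon> C by (meson order_trans real_sqrt_le_1_iff)
        then show "1 \<le> C / sqrt \<epsilon>" using \<epsilon> by (simp add: pos_le_divide_eq)
      qed
      then show ?thesis using id[OF 3(1)] id[OF 3(2)] by simp
    qed
  qed
  then show ?thesis using that C(1) by blast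
qed

end

section \<open>The extension property\<close>

text \<open>The strict inequality yields an admissible constant below \<open>c\<close> directly from
  the infimum.\<close>

lemma LipD:
  assumes "Lip A dX dY g < ennreal c" "\<And>x y. x \<in> A \<Longrightarrow> y \<in> A \<Longrightarrow> 0 \<le> dX x y" "x \<in> A" "y \<in> A"
  shows "dY (g x) (g y) \<le> c * dX x y"
proof -
  obtain L where L: "L \<ge> 0" "\<forall>x\<in>A. \<forall>y\<in>A. dY (g x) (g y) \<le> L * dX x y" "ennreal L < ennreal c"
    using assms(1) unfolding Lip_def Inf_less_iff by blast
  then have "L \<le> c" by (simp add: ennreal_less_iff)
  then have "L * dX x y \<le> c * dX x y" by (intro mult_right_mono assms)
  then show ?thesis using L(2) assms(3,4) by force
qed

lemma Lip_le:
  assumes "L \<ge> 0" "\<And>x y. x \<in> A \<Longrightarrow> y \<in> A \<Longrightarrow> dY (g x) (g y) \<le> L * dX x y"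
  shows "Lip A dX dY g \<le> ennreal L"
  unfolding Lip_def by (rule Inf_lower) (use assms in blast)

lemma hdist_nonneg: "0 \<le> hdist p q" by (simp add: hdist_def)
lemma d_cc_nonneg: "0 \<le> d_cc p q" using hdist_le_d_cc[of p q] hdist_nonneg[of p q] by linarith

context heis_coords begin

text \<open>\<open>h\<close> embeds the index set of the smaller group, and the remaining
  coordinates are filled with zeros; for injective \<open>h\<close> the homogeneous distance is
  preserved. With the identity for \<open>h\<close> it is the passage from vectors to
  triples.\<close>

definition emb :: "('m \<Rightarrow> 'n::finite) \<Rightarrow> 'N pt \<Rightarrow> 'n heis"
  where "emb h p = ((\<chi> j. if j \<in> range h then p $ xi (inv h j) else 0),
    (\<chi> j. if j \<in> range h then p $ yi (inv h j) else 0), p $ tau)"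

lemma sum_range_inv:
  fixes h :: "'m \<Rightarrow> 'n::finite" and f :: "'m \<Rightarrow> real"
  assumes "inj h"
  shows "(\<Sum>j\<in>UNIV. if j \<in> range h then f (inv h j) else 0) = (\<Sum>i\<in>UNIV. f i)"
proof -
  have "(\<Sum>j\<in>UNIV. if j \<in> range h then f (inv h j) else 0) = (\<Sum>j\<in>range h. f (inv h j))"
    by (simp add: sum.If_cases)
  also have "\<dots> = (\<Sum>i\<in>UNIV. f i)"
    by (subst sum.reindex[OF assms]) (simp add: inv_f_f[OF assms])
  finally show ?thesis .
qed

lemma hdist_emb:
  fixes h :: "'m \<Rightarrow> 'n::finite"
  assumes h: "inj h"
  shows "hdist (emb h p) (emb h q) = nrm (- p \<odot> q)"
proof -
  have ip: "(\<chi> j. if j \<in> range h then f (inv h j) else 0) \<bullet> (\<chi> j. if j \<in> range h then g (inv h j) else 0) = (\<Sum>i\<in>UNIV. f i * g i)"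
    for f g :: "'m \<Rightarrow> real"
    using sum_range_inv[OF h, of "\<lambda>i. f i * g i"] by (simp add: inner_vec_def if_distrib cong: if_cong)
  have df: "(\<chi> j. if j \<in> range h then f (inv h j) else 0) - (\<chi> j. if j \<in> range h then g (inv h j) else 0)
      = (\<chi> j. if j \<in> range h then f (inv h j) - g (inv h j) else (0::real))" for f g :: "'m \<Rightarrow> real"
    by (simp add: vec_eq_iff)
  have "norm (fst (emb h q) - fst (emb h p), fst (snd (emb h q)) - fst (snd (emb h p))) = norm (hor (q - p))"
  proof -
    have "(norm (fst (emb h q) - fst (emb h p), fst (snd (emb h q)) - fst (snd (emb h p))))\<^sup>2 =
        (\<Sum>i\<in>UNIV. (q $ xi i - p $ xi i) * (q $ xi i - p $ xi i)) + (\<Sum>i\<in>UNIV. (q $ yi i - p $ yi i) * (q $ yi i - p $ yi i))"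
      unfolding power2_norm_eq_inner emb_def fst_conv snd_conv df[of "\<lambda>i. q $ xi i" "\<lambda>i. p $ xi i"]
        df[of "\<lambda>i. q $ yi i" "\<lambda>i. p $ yi i"] inner_Pair
      by (simp only: ip[of "\<lambda>i. q $ xi i - p $ xi i" "\<lambda>i. q $ xi i - p $ xi i"]
          ip[of "\<lambda>i. q $ yi i - p $ yi i" "\<lambda>i. q $ yi i - p $ yi i"])
    also have "\<dots> = (norm (hor (q - p)))\<^sup>2"
      by (simp add: power2_norm_eq_inner inner_vec_def sum_coords)
    finally show ?thesis by simp
  qed
  moreover have "fst (snd (emb h p)) \<bullet> fst (emb h q) - fst (emb h p) \<bullet> fst (snd (emb h q)) = om p q"
    unfolding emb_def fst_conv snd_conv
    by (simp only: ip[of "\<lambda>i. p $ yi i" "\<lambda>i. q $ xi i"] ip[of "\<lambda>i. p $ xi i" "\<lambda>i. q $ yi i"])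
      (simp add: om_def sum_subtractf)
  moreover have "snd (snd (emb h p)) = p $ tau" for p by (simp add: emb_def)
  ultimately show ?thesis unfolding hdist_def nrm_diff by simp
qed

lemma inj_emb:
  fixes h :: "'m \<Rightarrow> 'n::finite"
  assumes "inj h" shows "inj (emb h)"
proof (rule injI)
  fix p q assume eq: "emb h p = emb h q"
  show "p = q"
  proof (rule vec_eqI)
    show "p $ tau = q $ tau" using eq by (simp add: emb_def)
    fix i
    have "fst (emb h p) $ h i = fst (emb h q) $ h i" "fst (snd (emb h p)) $ h i = fst (snd (emb h q)) $ h i"
      using eq by simp_all
    then show "p $ xi i = q $ xi i" "p $ yi i = q $ yi i" by (simp_all add: emb_def inv_f_f[OF assms])
  qed
qed

lemma ex_emb_id: "\<exists>p. emb (\<lambda>i::'m. i) p = u"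
proof -
  define p where "p = (\<chi> k. if k = tau then snd (snd u) else if k \<in> range xi then fst u $ inv xi k else fst (snd u) $ inv yi k)"
  have "p $ tau = snd (snd u)" by (simp add: p_def)
  moreover have "p $ xi i = fst u $ i" for i by (simp add: p_def inv_f_f[OF inj_xi])
  moreover have "p $ yi i = fst (snd u) $ i" for i
  proof -
    have "yi i \<notin> range xi" by auto
    then show ?thesis by (simp add: p_def inv_f_f[OF inj_yi])
  qed
  moreover have "inv (\<lambda>i::'m. i) j = j" for j using inv_f_f[of "\<lambda>i::'m. i" j] by (simp add: inj_on_def)
  ultimately have "emb (\<lambda>i::'m. i) p = u" by (simp add: emb_def prod_eq_iff vec_eq_iff)
  then show ?thesis by blast
qed

text \<open>A partial map on the smaller group is carried to its image in the larger one, extended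
  there, and restricted again. Exchanging \<open>d_cc\<close> and the homogeneous distance costs
  \<open>3 * 400 = 1200\<close>, once for the given map and once for the extension.\<close>

lemma hlip_extension:
  fixes h :: "'m \<Rightarrow> 'n::finite"
  assumes h: "inj h" and ext: "Lipschitz_extension_property (UNIV :: 'n heis set) d_cc (UNIV :: 'm heis set) d_cc"
  obtains C where "C \<ge> 1" "\<forall>A f L. L \<ge> 1 \<longrightarrow>
    (\<forall>p\<in>A. \<forall>q\<in>A. nrm (- f p \<odot> f q) \<le> L * nrm (- p \<odot> q)) \<longrightarrow>
    (\<exists>F. hlip (C * L) F \<and> (\<forall>p\<in>A. F p = f p))"
proof -
  obtain C0 :: real where C0: "C0 \<ge> 1" and E: "\<And>A f. f \<in> A \<rightarrow> (UNIV :: 'm heis set) \<Longrightarrow>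
      Lipschitz_map A d_cc d_cc f \<Longrightarrow> \<exists>F. (\<forall>x\<in>A. F x = f x) \<and>
        Lip (UNIV :: 'n heis set) d_cc d_cc F \<le> ennreal C0 * Lip A d_cc d_cc f"
    using ext unfolding Lipschitz_extension_property_def by (metis subset_UNIV)
  let ?I = "emb (\<lambda>i::'m. i)"
  have injI: "inj (\<lambda>i::'m. i)" by (simp add: inj_on_def)
  have isoI: "hdist (?I p) (?I q) = nrm (- p \<odot> q)" for p q by (rule hdist_emb[OF injI])
  obtain J where J: "\<And>u. ?I (J u) = u" using ex_emb_id by metis
  define C where "C = 1200 * (1200 * C0 + 1)"
  have "\<exists>F. hlip (C * L) F \<and> (\<forall>p\<in>A. F p = f p)"
    if L: "L \<ge> 1" and f: "\<forall>p\<in>A. \<forall>q\<in>A. nrm (- f p \<odot> f q) \<le> L * nrm (- p \<odot> q)" for A f L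
  proof -
    define A' where "A' = emb h ` A"
    define f' where "f' u = ?I (f (inv (emb h) u))" for u :: "'n heis"
    have f'e: "f' (emb h p) = ?I (f p)" for p by (simp add: f'_def inv_f_f[OF inj_emb[OF h]])
    have lipf: "d_cc (f' u) (f' v) \<le> (1200 * L) * d_cc u v" if uv: "u \<in> A'" "v \<in> A'" for u v
    proof -
      obtain p q where pq: "p \<in> A" "u = emb h p" "q \<in> A" "v = emb h q" using uv unfolding A'_def by blast
      have "d_cc (f' u) (f' v) \<le> 400 * hdist (f' u) (f' v)" by (rule d_cc_le_hdist)
      also have "hdist (f' u) (f' v) = nrm (- f p \<odot> f q)" unfolding pq f'e isoI ..
      also have "\<dots> \<le> L * nrm (- p \<odot> q)" using f pq by blast
      also have "nrm (- p \<odot> q) = hdist u v" unfolding pq hdist_emb[OF h] ..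
      also have "L * hdist u v \<le> L * (3 * d_cc u v)" using L by (intro mult_left_mono hdist_le_d_cc) auto
      finally show ?thesis by simp
    qed
    have Lf: "Lip A' d_cc d_cc f' \<le> ennreal (1200 * L)" 
    proof (rule Lip_le)
      show "d_cc (f' u) (f' v) \<le> (1200 * L) * d_cc u v" if "u \<in> A'" "v \<in> A'" for u v by (rule lipf[OF that])
    qed (use L in simp)
    then have "Lipschitz_map A' d_cc d_cc f'"
      unfolding Lipschitz_map_def by (metis ennreal_less_top infinity_ennreal_def order_le_less_trans)
    then obtain F' where F': "\<forall>u\<in>A'. F' u = f' u" "Lip (UNIV :: 'n heis set) d_cc d_cc F' \<le> ennreal C0 * Lip A' d_cc d_cc f'"
      using E[of f' A'] by blast
    have "ennreal C0 * Lip A' d_cc d_cc f' \<le> ennreal C0 * ennreal (1200 * L)" by (rule mult_left_mono[OF Lf]) simp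
    also have "\<dots> = ennreal (C0 * (1200 * L))" using C0 L by (simp add: ennreal_mult)
    \<comment> \<open>The summand 1 makes the inequality strict, as \<open>LipD\<close>
      asks.\<close>
    also have "\<dots> < ennreal ((1200 * C0 + 1) * L)" 
    proof (rule ennreal_lessI)
      show "0 < (1200 * C0 + 1) * L" using C0 L by simp
    qed (use L in \<open>simp add: algebra_simps\<close>)
    finally have "Lip (UNIV :: 'n heis set) d_cc d_cc F' < ennreal ((1200 * C0 + 1) * L)" using F'(2) by (rule order_le_less_trans[rotated])
    then have lipF': "d_cc (F' u) (F' v) \<le> ((1200 * C0 + 1) * L) * d_cc u v" for u v
      by (rule LipD) (auto simp: d_cc_nonneg)
    define F where "F p = J (F' (emb h p))" for p
    have IF: "?I (F p) = F' (emb h p)" for p by (simp add: F_def J)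
    have "hlip (C * L) F"
      unfolding hlip_def
    proof (intro conjI allI)
      show "0 \<le> C * L" using C0 L by (simp add: C_def)
      fix p q
      have "nrm (- F p \<odot> F q) = hdist (F' (emb h p)) (F' (emb h q))" unfolding isoI[symmetric] IF ..
      also have "\<dots> \<le> 3 * d_cc (F' (emb h p)) (F' (emb h q))" by (rule hdist_le_d_cc)
      also have "\<dots> \<le> 3 * (((1200 * C0 + 1) * L) * d_cc (emb h p) (emb h q))" by (intro mult_left_mono lipF') simp
      also have "\<dots> \<le> 3 * (((1200 * C0 + 1) * L) * (400 * hdist (emb h p) (emb h q)))"
        using C0 L by (intro mult_left_mono d_cc_le_hdist) auto
      also have "\<dots> = C * L * nrm (- p \<odot> q)" by (simp add: C_def hdist_emb[OF h])
      finally show "nrm (- F p \<odot> F q) \<le> C * L * nrm (- p \<odot> q)" .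
    qed
    moreover have "F p = f p" if "p \<in> A" for p
    proof -
      have "?I (F p) = ?I (f p)" using F'(1) that by (simp add: IF A'_def f'e)
      then show ?thesis using inj_emb[OF injI] by (simp add: inj_eq)
    qed
    ultimately show ?thesis by blast
  qed
  then have "\<forall>A f L. L \<ge> 1 \<longrightarrow>
    (\<forall>p\<in>A. \<forall>q\<in>A. nrm (- f p \<odot> f q) \<le> L * nrm (- p \<odot> q)) \<longrightarrow>
    (\<exists>F. hlip (C * L) F \<and> (\<forall>p\<in>A. F p = f p))" by (intro allI impI)
  moreover have "C \<ge> 1" using C0 by (simp add: C_def)
  ultimately show ?thesis by (intro that)
qed

text \<open>The extension property thus makes every Euclidean Lipschitz map a uniform limit of maps that
  are Lipschitz for the homogeneous distance.\<close>

lemma hlip_approximation: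
  fixes \<phi> :: "'N pt \<Rightarrow> 'N pt"
  assumes C: "C \<ge> 1" and ext: "\<forall>A f L. L \<ge> 1 \<longrightarrow>
    (\<forall>p\<in>A. \<forall>q\<in>A. nrm (- f p \<odot> f q) \<le> L * nrm (- p \<odot> q)) \<longrightarrow>
    (\<exists>F. hlip (C * L) F \<and> (\<forall>p\<in>A. F p = f p))"
    and K: "K \<ge> 0" "\<And>p q. norm (\<phi> q - \<phi> p) \<le> K * norm (q - p)"
    and \<rho>: "\<rho> \<ge> 0" and id: "\<And>p. norm p \<ge> \<rho> \<Longrightarrow> \<phi> p = p" and \<delta>: "\<delta> > 0"
  obtains L F where "hlip L F" "\<And>p. norm p \<ge> \<rho> + 1 \<Longrightarrow> F p = p" "\<And>p. norm p \<le> \<rho> + 1 \<Longrightarrow> norm (F p - \<phi> p) \<le> \<delta>"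
proof -
  obtain C' where C': "C' \<ge> 1" "\<And>\<epsilon> p q. 0 < \<epsilon> \<Longrightarrow> \<epsilon> \<le> 1 \<Longrightarrow> p \<in> lattice \<epsilon> \<union> {p. norm p \<ge> \<rho> + 1} \<Longrightarrow>
    q \<in> lattice \<epsilon> \<union> {p. norm p \<ge> \<rho> + 1} \<Longrightarrow> nrm (- \<phi> p \<odot> \<phi> q) \<le> C' / sqrt \<epsilon> * nrm (- p \<odot> q)"
    by (rule lattice_Lipschitz[OF K \<rho> id]) (assumption | rule that)+
  define M where "M = real CARD('N) + 1"
  have M: "M \<ge> 0" by (simp add: M_def)
  define B where "B = norm (\<phi> 0) + K * (\<rho> + 1)"
  define t where "t \<epsilon> = M * \<epsilon> * (1 + M * \<epsilon> + 2 * (\<rho> + 1))" for \<epsilon>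
  define s where "s \<epsilon> = C * C' * M * sqrt \<epsilon>" for \<epsilon>
  \<comment> \<open>The error at a point \<open>p\<close> with nearby lattice point
    \<open>g\<close>: \<open>s \<epsilon>\<close>, the Lipschitz constant
    \<open>C * C' / sqrt \<epsilon>\<close> times the distance \<open>M * \<epsilon>\<close>,
    controls \<open>F p - F g\<close>, and \<open>K * t \<epsilon>\<close> controls
    \<open>\<phi> g - \<phi> p\<close>.\<close>
  define w where "w \<epsilon> = s \<epsilon> * (1 + 2 * (B + K * t \<epsilon>)) + (s \<epsilon>)\<^sup>2 + K * t \<epsilon>" for \<epsilon>
  have "(w \<longlongrightarrow> w 0) (at_right 0)" unfolding w_def s_def t_def by (intro tendsto_intros)
  then have wl: "(w \<longlongrightarrow> 0) (at_right 0)" by (simp add: w_def s_def t_def)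
  have "\<forall>\<^sub>F \<epsilon> in at_right 0. w \<epsilon> < \<delta>" by (rule order_tendstoD(2)[OF wl \<delta>])
  then obtain b where b: "b > 0" "\<And>\<epsilon>. 0 < \<epsilon> \<Longrightarrow> \<epsilon> < b \<Longrightarrow> w \<epsilon> < \<delta>"
    unfolding eventually_at_right_field by auto
  define \<epsilon> where "\<epsilon> = min 1 (b / 2)"
  have \<epsilon>: "0 < \<epsilon>" "\<epsilon> \<le> 1" "w \<epsilon> < \<delta>" using b by (auto simp: \<epsilon>_def min_def)
  define A where "A = lattice \<epsilon> \<union> {p. norm p \<ge> \<rho> + 1}"
  have sq: "0 < sqrt \<epsilon>" "sqrt \<epsilon> \<le> 1" using \<epsilon> by auto
  have L1: "C' / sqrt \<epsilon> \<ge> 1" using order_trans[OF sq(2) C'(1)] sq(1) by (simp add: pos_le_divide_eq)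
  obtain F where F: "hlip (C * (C' / sqrt \<epsilon>)) F" "\<And>p. p \<in> A \<Longrightarrow> F p = \<phi> p"
  proof -
    have "\<forall>p\<in>A. \<forall>q\<in>A. nrm (- \<phi> p \<odot> \<phi> q) \<le> C' / sqrt \<epsilon> * nrm (- p \<odot> q)"
      unfolding A_def by (intro ballI C'(2)[OF \<epsilon>(1,2)])
    then obtain F where "hlip (C * (C' / sqrt \<epsilon>)) F" "\<forall>p\<in>A. F p = \<phi> p" 
      using ext[THEN spec[of _ A], THEN spec[of _ \<phi>], THEN spec[of _ "C' / sqrt \<epsilon>"]] L1 by blast
    then show ?thesis using that by blast
  qed
  have "F p = p" if "norm p \<ge> \<rho> + 1" for p using F(2)[of p] id[of p] that by (simp add: A_def)
  moreover have "norm (F p - \<phi> p) \<le> \<delta>" if p: "norm p \<le> \<rho> + 1" for p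
  proof -
    obtain g where g: "g \<in> lattice \<epsilon>" "nrm (- g \<odot> p) \<le> M * \<epsilon>" unfolding M_def by (rule lattice_dense[OF \<epsilon>(1)])
    have "norm (g - p) \<le> nrm (- p \<odot> g) * (1 + nrm (- p \<odot> g) + 2 * norm p)" by (rule norm_diff_le_nrm)
    also have "\<dots> \<le> t \<epsilon>"
      unfolding t_def using g(2) p M \<epsilon> \<rho> nrm_nonneg[of "- p \<odot> g"]
      by (intro mult_mono add_mono) (auto simp: nrm_sym[of p g])
    finally have gp: "norm (g - p) \<le> t \<epsilon>" .
    have \<phi>gp: "norm (\<phi> g - \<phi> p) \<le> K * t \<epsilon>" using order_trans[OF K(2) mult_left_mono[OF gp K(1)]] .
    have "norm (\<phi> p) \<le> norm (\<phi> 0) + norm (\<phi> p - \<phi> 0)" using norm_triangle_ineq[of "\<phi> 0" "\<phi> p - \<phi> 0"] by simp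
    also have "norm (\<phi> p - \<phi> 0) \<le> K * norm p" using K(2)[of p 0] by simp
    also have "K * norm p \<le> K * (\<rho> + 1)" by (rule mult_left_mono[OF p K(1)])
    finally have "norm (\<phi> p) \<le> B" by (simp add: B_def)
    then have "norm (\<phi> g) \<le> B + K * t \<epsilon>" using \<phi>gp norm_triangle_ineq[of "\<phi> p" "\<phi> g - \<phi> p"] by simp
    then have hg: "norm (hor (F g)) \<le> B + K * t \<epsilon>" using F(2)[of g] g(1) norm_hor_le[of "\<phi> g"] by (simp add: A_def)
    define r where "r = C * (C' / sqrt \<epsilon>) * nrm (- g \<odot> p)"
    have r0: "r \<ge> 0" using C C' sq by (simp add: r_def nrm_nonneg)
    have "r \<le> C * (C' / sqrt \<epsilon>) * (M * \<epsilon>)" unfolding r_def using g(2) C C' sq by (intro mult_left_mono) auto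
    also have "\<dots> = s \<epsilon>"
    proof -
      have "\<epsilon> = sqrt \<epsilon> * sqrt \<epsilon>" using \<epsilon> by simp
      then have "C * (C' / sqrt \<epsilon>) * (M * \<epsilon>) = C * (C' / sqrt \<epsilon>) * (M * (sqrt \<epsilon> * sqrt \<epsilon>))" by simp
      also have "\<dots> = s \<epsilon>" using sq(1) unfolding s_def by (simp add: field_simps)
      finally show ?thesis .
    qed
    finally have rs: "r \<le> s \<epsilon>" .
    have "norm (F p - F g) \<le> r * (1 + 2 * norm (hor (F g))) + r\<^sup>2"
      unfolding r_def by (rule hlip_dist[OF F(1)])
    also have "\<dots> \<le> s \<epsilon> * (1 + 2 * (B + K * t \<epsilon>)) + (s \<epsilon>)\<^sup>2"
      using rs r0 hg by (intro add_mono mult_mono power_mono) auto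
    finally have "norm (F p - F g) \<le> s \<epsilon> * (1 + 2 * (B + K * t \<epsilon>)) + (s \<epsilon>)\<^sup>2" .
    moreover have "F g = \<phi> g" using F(2)[of g] g(1) by (simp add: A_def)
    ultimately have "norm (F p - \<phi> p) \<le> w \<epsilon>"
      using norm_diff_triangle_le[of "F p" "\<phi> g" _ "\<phi> p", OF _ \<phi>gp] unfolding w_def by simp
    then show ?thesis using \<epsilon>(3) by linarith
  qed
  ultimately show ?thesis using that F(1) by blast
qed

text \<open>The map \<open>\<phi>\<close> pushes the unit ball along the vertical axis onto a region
  that it also fixes, and is cut off linearly; an approximation within 1/4 inherits the double
  covering.\<close>

theorem no_extension:
  fixes h :: "'m \<Rightarrow> 'n::finite"
  assumes odd: "odd CARD('m)" and h: "inj h"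
  shows "\<not> Lipschitz_extension_property (UNIV :: 'n heis set) d_cc (UNIV :: 'm heis set) d_cc"
proof
  assume "Lipschitz_extension_property (UNIV :: 'n heis set) d_cc (UNIV :: 'm heis set) d_cc"
  then obtain C where C: "C \<ge> 1" "\<forall>A f L. L \<ge> 1 \<longrightarrow>
    (\<forall>p\<in>A. \<forall>q\<in>A. nrm (- f p \<odot> f q) \<le> L * nrm (- p \<odot> q)) \<longrightarrow>
    (\<exists>F. hlip (C * L) F \<and> (\<forall>p\<in>A. F p = f p))"
    by (rule hlip_extension[OF h]) (rule that)
  \<comment> \<open>Length 6 puts \<open>cball v 3\<close> between the norms 3 and 9: disjoint from
    the unit ball, in the region where \<open>\<phi>\<close> is the identity, and inside the ball of
    radius 10.\<close>
  define v where "v = axis tau (6::real)"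
  have nv: "norm v = 6" using scale_axis[of 6 tau 1] by (metis v_def mult.right_neutral norm_axis_1 norm_scaleR abs_numeral)
  \<comment> \<open>Equal to 1 on the unit ball, 0 from norm 2 on, and of slope 1 between, so
    \<open>\<phi>\<close> has Lipschitz constant \<open>1 + 6 = 7\<close>.\<close>
  define \<chi>' where "\<chi>' p = max 0 (min 1 (2 - norm p))" for p :: "'N pt"
  define \<phi> where "\<phi> p = p + \<chi>' p *\<^sub>R v" for p
  have K: "norm (\<phi> q - \<phi> p) \<le> 7 * norm (q - p)" for p q
  proof -
    have "\<bar>\<chi>' q - \<chi>' p\<bar> \<le> \<bar>norm q - norm p\<bar>" unfolding \<chi>'_def by (auto simp: max_def min_def abs_if)
    also have "\<dots> \<le> norm (q - p)" by (rule norm_triangle_ineq3)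
    finally have 1: "\<bar>\<chi>' q - \<chi>' p\<bar> \<le> norm (q - p)" .
    have "\<phi> q - \<phi> p = (q - p) + (\<chi>' q - \<chi>' p) *\<^sub>R v" by (simp add: \<phi>_def algebra_simps)
    then have "norm (\<phi> q - \<phi> p) \<le> norm (q - p) + \<bar>\<chi>' q - \<chi>' p\<bar> * 6"
      using norm_triangle_ineq[of "q - p" "(\<chi>' q - \<chi>' p) *\<^sub>R v"] nv by simp
    also have "\<dots> \<le> norm (q - p) + norm (q - p) * 6" by (intro add_left_mono mult_right_mono 1) simp
    finally show ?thesis by simp
  qed
  have id: "\<phi> p = p" if "norm p \<ge> 2" for p using that by (simp add: \<phi>_def \<chi>'_def)
  obtain L F where F: "hlip L F" "\<And>p. norm p \<ge> 9 + 1 \<Longrightarrow> F p = p" "\<And>p. norm p \<le> 9 + 1 \<Longrightarrow> norm (F p - \<phi> p) \<le> 1 / 4"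
  proof (rule hlip_approximation[OF C(1) C(2) _ K, where \<rho> = 9 and \<delta> = "1/4"])
    show "\<phi> p = p" if "norm p \<ge> 9" for p using id[of p] that by simp
  qed (assumption | simp | rule that)+
  show False
  proof (rule no_hlip_double_cover[OF odd F(1), where R = 10 and r = 1 and ?c1.0 = 0 and ?c2.0 = v])
    show "F p = p" if "norm p \<ge> 10" for p using F(2) that by simp
    show "norm (F x - (x + (v - 0))) \<le> 1 / 4" if "x \<in> cball 0 1" for x
      using F(3)[of x] that by (simp add: \<phi>_def \<chi>'_def)
    have c2: "norm x \<ge> 3" "norm x \<le> 9" if "x \<in> cball v (3 * 1)" for x
      using that norm_triangle_ineq2[of v "v - x"] norm_triangle_ineq4[of v "v - x"] nv by (auto simp: dist_norm)
    show "norm (F x - x) \<le> 1 / 4" if "x \<in> cball v (3 * 1)" for x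
      using F(3)[of x] id[of x] c2[OF that] by simp
    show "cball 0 1 \<inter> cball v (3 * 1) = {}" using c2(1) by fastforce
    show "cball 0 1 \<subseteq> cball (0::'N pt) 10" by auto
    show "cball v (3 * 1) \<subseteq> cball 0 10" using c2(2) by fastforce
  qed simp
qed

end

text \<open>\<open>'m bit1\<close> is a finite well-ordered type with
  \<open>2 * CARD('m) + 1\<close> elements, as many as two copies of \<open>'m\<close> and one
  vertical index.\<close>

lemma ex_heis_coords:
  "\<exists>(xi :: 'm::finite \<Rightarrow> 'm bit1) yi tau. heis_coords xi yi tau"
proof -
  have "CARD(('m + 'm) option) = CARD('m bit1)" by simp
  then obtain b :: "('m + 'm) option \<Rightarrow> 'm bit1" where b: "bij_betw b UNIV UNIV"
    using finite_same_card_bij[of "UNIV :: ('m + 'm) option set" "UNIV :: 'm bit1 set"] by auto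
  have inj: "b u = b v \<longleftrightarrow> u = v" for u v using b by (auto simp: bij_betw_def inj_eq)
  have "heis_coords (\<lambda>i. b (Some (Inl i))) (\<lambda>i. b (Some (Inr i))) (b None)"
  proof
    fix k
    obtain u where "k = b u" using b by (metis bij_betw_def surjD)
    then show "k = b None \<or> k \<in> range (\<lambda>i. b (Some (Inl i))) \<or> k \<in> range (\<lambda>i. b (Some (Inr i)))"
    proof (cases u)
      case (Some x)
      then show ?thesis using \<open>k = b u\<close> by (cases x) auto
    qed simp
  qed (auto simp: inj inj_on_def)
  then show ?thesis by blast
qed

theorem theorem1:
  fixes k n :: nat
  assumes "n \<ge> 1" and "n \<ge> 2 * k + 1"
    and "CARD('n::finite) = n"
    and "CARD('m::finite) = 2 * k + 1"
  shows "\<not> Lipschitz_extension_property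
    (UNIV :: 'n heis set) d_cc (UNIV :: 'm heis set) d_cc"
proof -
  obtain xi yi :: "'m \<Rightarrow> 'm bit1" and tau where "heis_coords xi yi tau" using ex_heis_coords by blast
  then interpret heis_coords xi yi tau .
  obtain h :: "'m \<Rightarrow> 'n" where "inj h"
    using card_le_inj[of "UNIV :: 'm set" "UNIV :: 'n set"] assms by auto
  then show ?thesis using no_extension assms(4) by simp
qed

end
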